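(* In the priority polling system described in the context, for $i=1,2$, the probability generating function $\widetilde V_{b_i}(z_H,z_L,z_2)=\mathbb{E}\big[z_H^{N_H}z_L^{N_L}z_2^{N_2}\big]$ of the joint stationary numbers $(N_H,N_L,N_2)$ of type-$H$, type-$L$ and type-$2$ customers present at polling epochs of $Q_i$ (the instants at which the server begins a visit to $Q_i$) is given, for $z_H,z_L,z_2\in[0,1]$, by $$\widetilde V_{b_i}(z_H,z_L,z_2)=\widetilde V_{b_i}\Big(\frac{\lambda_Hz_H+\lambda_Lz_L}{\lambda_1},\,z_2\Big),$$ where on the right-hand side $\widetilde V_{b_i}(z_1,z_2)$, $i=1,2$, are the functions of two variables $$\widetilde V_{b_1}(z_1,z_2)=r_{11}\widetilde M_{11}(z_1,z_2)\prod_{j=0}^\infty a_1(f_1^{(j)}(z_2))+r_{21}\widetilde M_{21}(z_1,z_2)\prod_{j=0}^\infty a_2(f_2^{(j)}(z_1)),$$ $$\widetilde V_{b_2}(z_1,z_2)=r_{12}\widetilde M_{12}(z_1,z_2)\prod_{j=0}^\infty a_1(f_1^{(j)}(z_2))+r_{22}\widetilde M_{22}(z_1,z_2)\prod_{j=0}^\infty a_2(f_2^{(j)}(z_1)),$$ which are the PGFs of the joint stationary queue lengths at polling epochs of $Q_i$ in the corresponding non-priority system (all notation in the context).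
   Context: Model. A single server attends two infinite-buffer queues $Q_1,Q_2$. Customers of type $H$ and $L$ arrive at $Q_1$, customers of type $2$ arrive at $Q_2$, according to independent Poisson processes with rates $\lambda_H,\lambda_L,\lambda_2>0$. Service times of type-$i$ customers are i.i.d. copies of $B_i$ with LST (Laplace–Stieltjes transform) $\widetilde B_i(s)=\mathbb{E}e^{-sB_i}$ and finite mean $\mathbb{E}B_i$, $i=H,L,2$. In $Q_1$, type-$H$ customers have non-preemptive priority over type-$L$ customers; within each type, service is FCFS. Service is exhaustive: the server leaves a queue when that queue is empty. After finishing a visit to $Q_i$ the server next polls $Q_i$ again with probability $p_i$, after a switch-over time distributed as $S_{ii}$, and otherwise (probability $1-p_i$) polls the other queue $Q_j$, after a switch-over time distributed as $S_{ij}$; here $0\le p_i<1$, the routing choices are Markovian, and arrivals, service times, switch-over times and routing choices are all independent. Switch-over times have LSTs $\widetilde S_{ij}(s)$ and finite means. Put $\rho_i=\lambda_i\mathbb{E}B_i$ ($i=H,L,2$), $\lambda_1=\lambda_H+\lambda_L$, $\rho_1=\rho_H+\rho_L$, $\rho=\rho_1+\rho_2$, and assume $\rho<1$ (stability). The system is in steady state. Corresponding non-priority system: the same system where type-$H$ and type-$L$ customers are merged into type-$1$ customers with arrival rate $\lambda_1$ and generic service time $B_1$, distributed as the mixture equal to $B_H$ with probability $\lambda_H/\lambda_1$ and to $B_L$ with probability $\lambda_L/\lambda_1$, so $\widetilde B_1(s)=\frac{\lambda_H}{\lambda_1}\widetilde B_H(s)+\frac{\lambda_L}{\lambda_1}\widetilde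 B_L(s)$. Notation. $r_{ij}=\Pr\{$the previous polled queue is $Q_i\mid$ the current polled queue is $Q_j\}$ in stationarity, i.e. $r_{11}=p_1$, $r_{21}=1-p_1$, $r_{12}=1-p_2$, $r_{22}=p_2$. $\widetilde\theta_i(s)$ is the LST of the busy period of an $M/G/1$ queue with arrival rate $\lambda_i$ and service time $B_i$, $i=1,2$. $\widetilde M_{ij}(z_1,z_2)=\widetilde S_{ij}(\lambda_1(1-z_1)+\lambda_2(1-z_2))$. $\widetilde K_{ij}(z)=\widetilde\theta_i(\lambda_j(1-z))$. $f_1(z_2)=\widetilde K_{21}(\widetilde K_{12}(z_2))$, $f_2(z_1)=\widetilde K_{12}(\widetilde K_{21}(z_1))$, $f_i^{(0)}(z)=z$, $f_i^{(j)}(z)=f_i(f_i^{(j-1)}(z))$ for $j\ge1$, and $$a_1(z_2)=\frac{r_{21}\widetilde M_{21}(\widetilde K_{12}(z_2),z_2)}{1-r_{11}\widetilde M_{11}(\widetilde K_{12}(z_2),z_2)}\cdot\frac{r_{12}\widetilde M_{12}(\widetilde K_{12}(z_2),f_1(z_2))}{1-r_{22}\widetilde M_{22}(\widetilde K_{12}(z_2),f_1(z_2))},$$ $$a_2(z_1)=\frac{r_{12}\widetilde M_{12}(z_1,\widetilde K_{21}(z_1))}{1-r_{22}\widetilde M_{22}(z_1,\widetilde K_{21}(z_1))}\cdot\frac{r_{21}\widetilde M_{21}(f_2(z_1),\widetilde K_{21}(z_1))}{1-r_{11}\widetilde M_{11}(f_2(z_1),\widetilde K_{21}(z_1))}.$$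 *)

theory Defs
  imports "HOL-Probability.Probability"
begin

definition nonneg_law :: "real measure \<Rightarrow> bool" where
  "nonneg_law D \<longleftrightarrow> real_distribution D \<and> (AE x in D. 0 \<le> x) \<and> integrable D (\<lambda>x. x)"

definition mean :: "real measure \<Rightarrow> real" where
  "mean D = (\<integral>x. x \<partial>D)"

definition lst :: "real measure \<Rightarrow> real \<Rightarrow> real" where
  "lst D s = (\<integral>x. exp (- s * x) \<partial>D)"

text \<open>\<open>N t \<omega>\<close> is the number of arrivals in the interval from \<open>0\<close> (exclusive) to \<open>t\<close> (inclusive);
  only its values at times \<open>t \<ge> 0\<close> matter.\<close>

locale poisson_process = prob_space M for M :: "'a measure" +
  fixes rate :: real and N :: "real \<Rightarrow> 'a \<Rightarrow> nat"
  assumes rate_pos: "0 < rate"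
    and measurable_count: "\<And>t. 0 \<le> t \<Longrightarrow> N t \<in> measurable M (count_space UNIV)"
    and start: "\<And>\<omega>. \<omega> \<in> space M \<Longrightarrow> N 0 \<omega> = 0"
    and mono: "\<And>\<omega> s t. \<omega> \<in> space M \<Longrightarrow> 0 \<le> s \<Longrightarrow> s \<le> t \<Longrightarrow> N s \<omega> \<le> N t \<omega>"
    and right_cont: "\<And>\<omega> t. \<omega> \<in> space M \<Longrightarrow> 0 \<le> t \<Longrightarrow> eventually (\<lambda>u. N u \<omega> = N t \<omega>) (at_right t)"
    and increments: "\<And>s t. 0 \<le> s \<Longrightarrow> s < t \<Longrightarrow>
      distr M (count_space UNIV) (\<lambda>\<omega>. N t \<omega> - N s \<omega>) = measure_pmf (poisson_pmf (rate * (t - s)))"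
    and indep_increments: "\<And>(ts :: nat \<Rightarrow> real) n. 0 \<le> ts 0 \<Longrightarrow> incseq ts \<Longrightarrow>
      indep_vars (\<lambda>_. count_space UNIV) (\<lambda>k \<omega>. N (ts (Suc k)) \<omega> - N (ts k) \<omega>) {..<n}"

definition process_events :: "'a measure \<Rightarrow> (real \<Rightarrow> 'a \<Rightarrow> nat) \<Rightarrow> 'a set set" where
  "process_events M N = sigma_sets (space M) {N t -` A \<inter> space M | t A. 0 \<le> t}"

definition variable_events :: "'a measure \<Rightarrow> 'b measure \<Rightarrow> ('a \<Rightarrow> 'b) \<Rightarrow> 'a set set" where
  "variable_events M M' X = {X -` A \<inter> space M | A. A \<in> sets M'}"

text \<open>Arrival process and service times of an M/G/1 queue; \<open>B k\<close> is the service time of the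
  customer that is served as number \<open>k\<close>.\<close>

locale mg1_queue = poisson_process M rate N
  for M :: "'a measure" and rate :: real and N :: "real \<Rightarrow> 'a \<Rightarrow> nat" +
  fixes D :: "real measure" and B :: "nat \<Rightarrow> 'a \<Rightarrow> real"
  assumes service_measurable: "\<And>k. B k \<in> borel_measurable M"
    and service_nonneg: "\<And>k \<omega>. \<omega> \<in> space M \<Longrightarrow> 0 \<le> B k \<omega>"
    and service_law: "\<And>k. distr M borel (B k) = D"
    and independent: "indep_sets
      (\<lambda>i. case i of None \<Rightarrow> process_events M N | Some k \<Rightarrow> variable_events M borel (B k)) UNIV"

text \<open>Departure \<open>n\<close> takes place at time \<open>T n\<close>, the sum of the first \<open>n\<close> service times, as long as
  the server has been working without interruption since time \<open>0\<close>, when a single customer was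
  present. It leaves \<open>1 + N (T n) - n\<close> customers behind, so that the busy period ends at the first
  departure \<open>n\<close> with \<open>N (T n) + 1 = n\<close>. When the load is below \<open>1\<close>, such an \<open>n\<close> exists almost surely,
  and the value of \<open>LEAST\<close> when there is none is irrelevant.\<close>

definition busy_period :: "(real \<Rightarrow> 'a \<Rightarrow> nat) \<Rightarrow> (nat \<Rightarrow> 'a \<Rightarrow> real) \<Rightarrow> 'a \<Rightarrow> real" where
  "busy_period N B \<omega> =
    (let T = (\<lambda>n. \<Sum>k<n. B k \<omega>) in T (LEAST n. N (T n) \<omega> + 1 = n))"

datatype queue = Q1 | Q2

lemma UNIV_queue: "UNIV = {Q1, Q2}"
  using queue.exhaust by auto

instance queue :: finite
  by standard (simp add: UNIV_queue)

text \<open>The random input of a system with customer types \<open>'c\<close>: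
  \<^item> the polled queue and the numbers of customers present at time \<open>0\<close>, which is a polling epoch;
  \<^item> the arrival processes;
  \<^item> the service time of customer \<open>k\<close> of a type, numbered in order of service; this is the order of
    arrival, as service is FCFS within each type;
  \<^item> the switch-over time from \<open>i\<close> to \<open>j\<close> after visit \<open>k\<close>, used if that visit is to \<open>i\<close> and \<open>j\<close> is
    polled next;
  \<^item> the queue polled next if visit \<open>k\<close> is to \<open>i\<close>.\<close>

record ('a, 'c) polling_input =
  initial :: "'a \<Rightarrow> queue \<times> ('c \<Rightarrow> nat)"
  arrivals :: "'c \<Rightarrow> real \<Rightarrow> 'a \<Rightarrow> nat"
  service :: "'c \<Rightarrow> nat \<Rightarrow> 'a \<Rightarrow> real"
  switch :: "queue \<Rightarrow> queue \<Rightarrow> nat \<Rightarrow> 'a \<Rightarrow> real"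
  route :: "queue \<Rightarrow> nat \<Rightarrow> 'a \<Rightarrow> queue"

datatype 'c source =
  Initial | Arrival 'c | Service 'c nat | Switch queue queue nat | Route queue nat

fun source_events :: "'a measure \<Rightarrow> ('a, 'c) polling_input \<Rightarrow> 'c source \<Rightarrow> 'a set set" where
  "source_events M I Initial = variable_events M (count_space UNIV) (initial I)"
| "source_events M I (Arrival c) = process_events M (arrivals I c)"
| "source_events M I (Service c k) = variable_events M borel (service I c k)"
| "source_events M I (Switch i j k) = variable_events M borel (switch I i j k)"
| "source_events M I (Route i k) = variable_events M (count_space UNIV) (route I i k)"

locale polling_system = prob_space M for M :: "'a measure" +
  fixes lam :: "'c::finite \<Rightarrow> real" and B :: "'c \<Rightarrow> real measure"
    and S :: "queue \<Rightarrow> queue \<Rightarrow> real measure" and p :: "queue \<Rightarrow> real"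
    and I :: "('a, 'c) polling_input"
  assumes initial_measurable: "initial I \<in> measurable M (count_space UNIV)"
    and arrivals_poisson: "\<And>c. poisson_process M (lam c) (arrivals I c)"
    and service_measurable: "\<And>c k. service I c k \<in> borel_measurable M"
    and service_nonneg: "\<And>c k \<omega>. \<omega> \<in> space M \<Longrightarrow> 0 \<le> service I c k \<omega>"
    and service_law: "\<And>c k. distr M borel (service I c k) = B c"
    and switch_measurable: "\<And>i j k. switch I i j k \<in> borel_measurable M"
    and switch_nonneg: "\<And>i j k \<omega>. \<omega> \<in> space M \<Longrightarrow> 0 \<le> switch I i j k \<omega>"
    and switch_law: "\<And>i j k. distr M borel (switch I i j k) = S i j"
    and route_measurable: "\<And>i k. route I i k \<in> measurable M (count_space UNIV)"
    and route_prob: "\<And>i k. prob {\<omega> \<in> space M. route I i k \<omega> = i} = p i"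
    and independent: "indep_sets (source_events M I) UNIV"

text \<open>The system is followed from one polling epoch or service completion to the next.
  \<open>served\<close> counts the services started so far, per type, and \<open>visits\<close> the completed visits including
  the switch-over times after them.\<close>

record 'c state =
  location :: queue
  content :: "'c \<Rightarrow> nat"
  clock :: real
  served :: "'c \<Rightarrow> nat"
  visits :: nat

text \<open>A service discipline \<open>d\<close> gives the type \<open>d i n\<close> of the customer that the server takes into service
  at queue \<open>i\<close> when \<open>n\<close> customers of the various types are present. If it is \<open>None\<close>, queue \<open>i\<close> is
  empty and the server leaves. Arrivals during a service cannot interrupt it.\<close>

type_synonym 'c discipline = "queue \<Rightarrow> ('c \<Rightarrow> nat) \<Rightarrow> 'c option"

definition step :: "'c discipline \<Rightarrow> ('a, 'c) polling_input \<Rightarrow> 'a \<Rightarrow> 'c state \<Rightarrow> 'c state" where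
  "step d I \<omega> s =
    (case d (location s) (content s) of
      Some c \<Rightarrow>
        let t = clock s + service I c (served s c) \<omega>
        in s\<lparr> content := (\<lambda>e. content s e - (if e = c then 1 else 0)
                 + (arrivals I e t \<omega> - arrivals I e (clock s) \<omega>)),
              clock := t,
              served := (served s)(c := Suc (served s c)) \<rparr>
    | None \<Rightarrow>
        let i = location s;
            j = route I i (visits s) \<omega>;
            t = clock s + switch I i j (visits s) \<omega>
        in s\<lparr> location := j,
              content := (\<lambda>e. content s e + (arrivals I e t \<omega> - arrivals I e (clock s) \<omega>)),
              clock := t,
              visits := Suc (visits s) \<rparr>)"

definition state_after :: "'c discipline \<Rightarrow> ('a, 'c) polling_input \<Rightarrow> nat \<Rightarrow> 'a \<Rightarrow> 'c state" where
  "state_after d I n \<omega> = (step d I \<omega> ^^ n)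
    \<lparr> location = fst (initial I \<omega>), content = snd (initial I \<omega>), clock = 0,
      served = (\<lambda>_. 0), visits = 0 \<rparr>"

text \<open>The polled queue and the numbers of customers present at polling epoch \<open>k\<close>. In a stable system,
  all visits are finite almost surely, and the value of \<open>LEAST\<close> when one is not is irrelevant.\<close>

definition polled :: "'c discipline \<Rightarrow> ('a, 'c) polling_input \<Rightarrow> nat \<Rightarrow> 'a \<Rightarrow> queue \<times> ('c \<Rightarrow> nat)" where
  "polled d I k \<omega> =
    (let s = state_after d I (LEAST n. visits (state_after d I n \<omega>) = k) \<omega>
     in (location s, content s))"

definition steady_state :: "'a measure \<Rightarrow> 'c discipline \<Rightarrow> ('a, 'c) polling_input \<Rightarrow> bool" where
  "steady_state M d I \<longleftrightarrow>
    (\<forall>k. distr M (count_space UNIV) (polled d I k) = distr M (count_space UNIV) (polled d I 0))"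

text \<open>The probability generating function of the numbers of customers present at polling epoch \<open>k\<close>,
  given that it is a polling epoch of queue \<open>i\<close>.\<close>

definition polling_pgf ::
    "'a measure \<Rightarrow> 'c::finite discipline \<Rightarrow> ('a, 'c) polling_input \<Rightarrow> nat \<Rightarrow> queue \<Rightarrow> ('c \<Rightarrow> real) \<Rightarrow> real" where
  "polling_pgf M d I k i z =
    (\<integral>\<omega>. (\<Prod>c\<in>UNIV. z c ^ snd (polled d I k \<omega>) c)
       \<partial>uniform_measure M {\<omega> \<in> space M. fst (polled d I k \<omega>) = i})"

datatype customer = Type_H | Type_L | Type_2

lemma UNIV_customer: "UNIV = {Type_H, Type_L, Type_2}"
  using customer.exhaust by auto

instance customer :: finite
  by standard (simp add: UNIV_customer)

fun priority :: "customer discipline" where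
  "priority Q1 n =
    (if 0 < n Type_H then Some Type_H else if 0 < n Type_L then Some Type_L else None)"
| "priority Q2 n = (if 0 < n Type_2 then Some Type_2 else None)"

text \<open>In the non-priority system, the type of a customer is given by its queue.\<close>

definition no_priority :: "queue discipline" where
  "no_priority i n = (if 0 < n i then Some i else None)"

fun merged_rate :: "(customer \<Rightarrow> real) \<Rightarrow> queue \<Rightarrow> real" where
  "merged_rate lam Q1 = lam Type_H + lam Type_L"
| "merged_rate lam Q2 = lam Type_2"

fun merged_service :: "(customer \<Rightarrow> real) \<Rightarrow> (customer \<Rightarrow> real measure) \<Rightarrow> queue \<Rightarrow> real measure" where
  "merged_service lam B Q1 =
    bind (measure_pmf (bernoulli_pmf (lam Type_H / (lam Type_H + lam Type_L))))
      (\<lambda>h. if h then B Type_H else B Type_L)"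
| "merged_service lam B Q2 = B Type_2"

text \<open>Here \<open>l i\<close> is the total arrival rate at queue \<open>i\<close> and \<open>theta i\<close> the LST of the busy period of the
  corresponding M/G/1 queue.\<close>

context
  fixes l :: "queue \<Rightarrow> real" and S :: "queue \<Rightarrow> queue \<Rightarrow> real measure"
    and p :: "queue \<Rightarrow> real" and theta :: "queue \<Rightarrow> real \<Rightarrow> real"
begin

text \<open>The stationary probability that the previously polled queue is \<open>i\<close>, given that the current one
  is \<open>j\<close>. As the stationary probabilities of polling \<open>Q1\<close> and \<open>Q2\<close> are proportional to \<open>1 - p Q2\<close>
  and \<open>1 - p Q1\<close>, it depends on \<open>p j\<close> only.\<close>

definition r :: "queue \<Rightarrow> queue \<Rightarrow> real" where
  "r i j = (if i = j then p j else 1 - p j)"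

definition M_pgf :: "queue \<Rightarrow> queue \<Rightarrow> real \<Rightarrow> real \<Rightarrow> real" where
  "M_pgf i j z1 z2 = lst (S i j) (l Q1 * (1 - z1) + l Q2 * (1 - z2))"

definition K12 :: "real \<Rightarrow> real" where
  "K12 z = theta Q1 (l Q2 * (1 - z))"

definition K21 :: "real \<Rightarrow> real" where
  "K21 z = theta Q2 (l Q1 * (1 - z))"

definition f1 :: "real \<Rightarrow> real" where
  "f1 z2 = K21 (K12 z2)"

definition f2 :: "real \<Rightarrow> real" where
  "f2 z1 = K12 (K21 z1)"

definition a1 :: "real \<Rightarrow> real" where
  "a1 z2 =
    (r Q2 Q1 * M_pgf Q2 Q1 (K12 z2) z2) / (1 - r Q1 Q1 * M_pgf Q1 Q1 (K12 z2) z2) *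
    ((r Q1 Q2 * M_pgf Q1 Q2 (K12 z2) (f1 z2)) / (1 - r Q2 Q2 * M_pgf Q2 Q2 (K12 z2) (f1 z2)))"

definition a2 :: "real \<Rightarrow> real" where
  "a2 z1 =
    (r Q1 Q2 * M_pgf Q1 Q2 z1 (K21 z1)) / (1 - r Q2 Q2 * M_pgf Q2 Q2 z1 (K21 z1)) *
    ((r Q2 Q1 * M_pgf Q2 Q1 (f2 z1) (K21 z1)) / (1 - r Q1 Q1 * M_pgf Q1 Q1 (f2 z1) (K21 z1)))"

definition V :: "queue \<Rightarrow> real \<Rightarrow> real \<Rightarrow> real" where
  "V i z1 z2 =
    r Q1 i * M_pgf Q1 i z1 z2 * (\<Prod>j. a1 ((f1 ^^ j) z2)) +
    r Q2 i * M_pgf Q2 i z1 z2 * (\<Prod>j. a2 ((f2 ^^ j) z1))"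

end

end

theory Submission
  imports Defs
begin

text \<open>Along a fixed finite path of discrete states (polled queue, customers present, services and visits
  so far), the time between two consecutive states is one particular service or switch-over time. So the
  arrivals during it are increments of Poisson processes at times that are independent of these processes,
  and no strong Markov property is needed: independence lets us integrate over the arrivals first, with all
  other sources of randomness fixed, and a sum over the countably many paths turns the result into
  one-step transition formulas for generating functions.

  During a visit to a queue, the product of the powers \<open>z c ^ n c\<close>, for \<open>n c\<close> customers of type \<open>c\<close>, is a
  martingale if \<open>z c\<close> is the LST of the service times at the total discount rate
  \<open>\<Sum>e. lam e * (1 - z e)\<close> for each type \<open>c\<close> that is served there. The average of these \<open>z c\<close>, weighted by the
  arrival rates, is then the LST of the busy period. So a visit
  acts on generating functions by a substitution, whatever the order of service, and types served at the
  same queue enter only through the average of their arguments. Inserting the two stationary equations into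
  each other gives a factor \<open>a1\<close> or \<open>a2\<close> and moves the argument by \<open>f1\<close> or \<open>f2\<close>. With
  \<open>\<gamma> = \<rho>1 \<rho>2 / ((1 - \<rho>1) (1 - \<rho>2)) < 1\<close> we have \<open>1 - f1 z \<le> \<gamma> (1 - z)\<close>, so iteration converges to
  the infinite products.\<close>

section \<open>Preliminaries\<close>

text \<open>The obstacle is that visits must be glued from single steps, and that the finiteness of
  visits is not given: \<open>polled\<close> is defined by \<open>LEAST\<close> and has some value
  even if epoch \<open>k\<close> never comes, so \<open>steady_state\<close> alone does not exclude
  a visit without end. The load therefore enters twice. With arguments slightly below 1 the product
  of powers is a strict submartingale with values in [0, 1]; so the total weight in service over all
  steps is finite, the weight still present vanishes, and letting the arguments tend to 1 shows that
  no mass is lost. Only then can the martingale be stopped at the end of a visit. The busy period of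
  the M/G/1 queue is treated by the same two steps. Up to that point all quantities are in
  \<open>ennreal\<close>, where sums and limits of possibly deficient masses need no integrability.
  The constant \<gamma> comes from the bound
  \<open>1 - theta i s \<le> s * m i / (1 - l i * m i)\<close>, in which the fraction is the mean of
  a busy period: each of the two substitutions in \<open>f1\<close> contributes one such factor. For
  loads below 1, \<gamma> < 1 says exactly that the two loads have a sum below 1.\<close>

lemma pred_all_less:
  fixes n :: nat
  assumes "\<And>k. k < n \<Longrightarrow> Measurable.pred L (P k)"
  shows "Measurable.pred L (\<lambda>x. \<forall>k<n. P k x)"
proof -
  have "Measurable.pred L (\<lambda>x. \<forall>k\<in>{..<n}. P k x)"
    by (rule pred_intros_finite) (use assms in auto)
  moreover have "(\<lambda>x. \<forall>k\<in>{..<n}. P k x) = (\<lambda>x. \<forall>k<n. P k x)" by auto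
  ultimately show ?thesis by argo
qed

lemma pred_all_finite:
  assumes "\<And>e::'e::finite. Measurable.pred L (P e)"
  shows "Measurable.pred L (\<lambda>x. \<forall>e. P e x)"
proof -
  have "Measurable.pred L (\<lambda>x. \<forall>e\<in>UNIV. P e x)"
    by (rule pred_intros_finite) (use assms in auto)
  moreover have "(\<lambda>x. \<forall>e\<in>UNIV. P e x) = (\<lambda>x. \<forall>e. P e x)" by auto
  ultimately show ?thesis by argo
qed

lemma borel_measurable_of_bool_pred:
  assumes "Measurable.pred L P"
  shows "(\<lambda>x. of_bool (P x) :: ennreal) \<in> borel_measurable L"
  by (rule measurable_compose[OF assms]) simp

lemma measurable_diff_nat:
  fixes f g :: "'x \<Rightarrow> nat"
  assumes "f \<in> measurable L (count_space UNIV)" "g \<in> measurable L (count_space UNIV)"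
  shows "(\<lambda>x. f x - g x) \<in> measurable L (count_space UNIV)"
  by (rule measurable_compose_countable[OF _ assms(2), where f = "\<lambda>i x. f x - i"],
      rule measurable_compose[OF assms(1)]) simp

text \<open>The two densities, pushed forward along \<open>X\<close>, have the same point masses,
  and on a countable space these determine the total mass. In this form a sum over all paths never
  has to be written out, and infinite values do no harm.\<close>

lemma nn_integral_partition_cong:
  fixes X :: "'a \<Rightarrow> 'b::countable"
  assumes X: "X \<in> measurable M (count_space UNIV)"
    and f: "f \<in> borel_measurable M" and g: "g \<in> borel_measurable M"
    and eq: "\<And>x. (\<integral>\<^sup>+\<omega>. f \<omega> * of_bool (X \<omega> = x) \<partial>M) = (\<integral>\<^sup>+\<omega>. g \<omega> * of_bool (X \<omega> = x) \<partial>M)"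
  shows "(\<integral>\<^sup>+\<omega>. f \<omega> \<partial>M) = (\<integral>\<^sup>+\<omega>. g \<omega> \<partial>M)"
proof -
  let ?D = "\<lambda>h. distr (density M h) (count_space UNIV) X"
  have em: "emeasure (?D h) A = (\<integral>\<^sup>+\<omega>. h \<omega> * of_bool (X \<omega> \<in> A) \<partial>M)" if h: "h \<in> borel_measurable M" for h A
  proof -
    have "emeasure (?D h) A = emeasure (density M h) (X -` A \<inter> space M)"
      using X by (subst emeasure_distr) (auto simp: measurable_def)
    also have "\<dots> = (\<integral>\<^sup>+\<omega>. h \<omega> * indicator (X -` A \<inter> space M) \<omega> \<partial>M)"
      using h X by (intro emeasure_density) (auto simp: measurable_def)
    also have "\<dots> = (\<integral>\<^sup>+\<omega>. h \<omega> * of_bool (X \<omega> \<in> A) \<partial>M)"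
      by (intro nn_integral_cong) (auto simp: indicator_def)
    finally show ?thesis .
  qed
  have "?D f = ?D g"
    by (rule measure_eqI_countable[where A = UNIV]) (use eq in \<open>auto simp: em f g\<close>)
  then have "emeasure (?D f) UNIV = emeasure (?D g) UNIV" by simp
  then show ?thesis by (simp add: em f g)
qed

lemma borel_measurable_exp_cmult:
  fixes f :: "'a \<Rightarrow> real"
  assumes "f \<in> borel_measurable M"
  shows "(\<lambda>x. ennreal (exp (c * f x))) \<in> borel_measurable M"
  using assms by measurable

lemma sigma_algebra_variable_events:
  assumes "X \<in> measurable M L"
  shows "sigma_algebra (space M) (variable_events M L X)"
proof -
  have "variable_events M L X = sets (vimage_algebra (space M) X L)"
    using assms by (simp add: variable_events_def sets_vimage_algebra2 measurable_space Pi_iff)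
  then show ?thesis
    using sets.sigma_algebra_axioms[of "vimage_algebra (space M) X L"] by simp
qed

lemma measurable_list_of_nats:
  assumes "\<And>k. k < n \<Longrightarrow> f k \<in> measurable M (count_space (UNIV :: 'b::countable set))"
  shows "(\<lambda>\<omega>. map (\<lambda>k. f k \<omega>) [0..<n]) \<in> measurable M (count_space UNIV)"
  using assms
proof (induction n)
  case (Suc n)
  have tail: "f n \<in> measurable M (count_space UNIV)"
    and init: "(\<lambda>\<omega>. map (\<lambda>k. f k \<omega>) [0..<n]) \<in> measurable M (count_space UNIV)"
    using Suc by auto
  have "(\<lambda>\<omega>. map (\<lambda>k. f k \<omega>) [0..<n] @ [f n \<omega>]) \<in> measurable M (count_space UNIV)"
    by (rule measurable_compose_countable[OF _ tail, where f = "\<lambda>x \<omega>. map (\<lambda>k. f k \<omega>) [0..<n] @ [x]"],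
        rule measurable_compose[OF init]) simp
  also have "(\<lambda>\<omega>. map (\<lambda>k. f k \<omega>) [0..<n] @ [f n \<omega>]) = (\<lambda>\<omega>. map (\<lambda>k. f k \<omega>) [0..<Suc n])"
    by simp
  finally show ?case .
qed simp

lemma one_le_if_all_less_one_le:
  assumes "\<And>y. 0 < y \<Longrightarrow> y < 1 \<Longrightarrow> ennreal y \<le> x"
  shows "1 \<le> x"
proof (rule ccontr)
  assume "\<not> 1 \<le> x"
  then have "x < 1" by simp
  then obtain u where u: "x < u" "u < 1" using dense by blast
  then have "u < top" using order.strict_trans ennreal_one_less_top by blast
  then have eu: "u = ennreal (enn2real u)" by simp
  have "0 < enn2real u" using u by (metis enn2real_positive_iff le_less_trans zero_le \<open>u < top\<close>)
  moreover have "enn2real u < 1" using u eu by (metis ennreal_1 enn2real_nonneg ennreal_less_iff)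
  ultimately have "u \<le> x" using assms[of "enn2real u"] eu by simp
  then show False using u by simp
qed

lemma ennreal_summable_tendsto_0:
  fixes f :: "nat \<Rightarrow> ennreal"
  assumes "(\<Sum>k. f k) < top"
  shows "f \<longlonglongrightarrow> 0"
proof -
  have "f k \<le> (\<Sum>k. f k)" for k
    using sum_le_suminf[of f "{k}"] by simp
  then have eq: "ennreal (enn2real (f k)) = f k" for k
    by (metis assms ennreal_enn2real le_less_trans)
  have "summable (\<lambda>k. enn2real (f k))"
    using assms by (intro summable_suminf_not_top) (auto simp: eq)
  then have "(\<lambda>k. ennreal (enn2real (f k))) \<longlonglongrightarrow> ennreal 0"
    by (intro tendsto_ennrealI summable_LIMSEQ_zero)
  then show ?thesis by (simp add: eq)
qed

lemma ennreal_tendsto_0_le: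
  fixes f :: "nat \<Rightarrow> ennreal"
  assumes "\<And>n. f n \<le> g n" "g \<longlonglongrightarrow> 0"
  shows "f \<longlonglongrightarrow> 0"
  by (rule tendsto_sandwich[OF _ _ tendsto_const assms(2)]) (use assms(1) in auto)

lemma nn_integral_of_bool:
  assumes "{\<omega> \<in> space M. P \<omega>} \<in> sets M"
  shows "(\<integral>\<^sup>+\<omega>. of_bool (P \<omega>) \<partial>M) = emeasure M {\<omega> \<in> space M. P \<omega>}"
proof -
  have "(\<integral>\<^sup>+\<omega>. of_bool (P \<omega>) \<partial>M) = (\<integral>\<^sup>+\<omega>. indicator {\<omega> \<in> space M. P \<omega>} \<omega> \<partial>M)"
    by (intro nn_integral_cong) (simp add: indicator_def)
  also have "\<dots> = emeasure M {\<omega> \<in> space M. P \<omega>}" by (rule nn_integral_indicator[OF assms])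
  finally show ?thesis .
qed

lemma suminf_of_bool_unique:
  fixes f :: "nat \<Rightarrow> ennreal"
  assumes "\<And>m n. P m \<Longrightarrow> P n \<Longrightarrow> m = n" "P n"
  shows "(\<Sum>k. of_bool (P k) * f k) = f n"
proof -
  have "(\<Sum>k. of_bool (P k) * f k) = (\<Sum>k\<in>{n}. of_bool (P k) * f k)"
    by (rule suminf_finite) (use assms in auto)
  then show ?thesis using assms by simp
qed

lemma map_upt_eq_iff: "map f [0..<Suc n] = l \<longleftrightarrow> length l = Suc n \<and> (\<forall>k\<le>n. f k = l ! k)"
  by (auto simp: list_eq_iff_nth_eq less_Suc_eq_le simp del: upt_Suc)

section \<open>Laplace--Stieltjes transforms\<close>

lemma nonneg_law_prob: "nonneg_law D \<Longrightarrow> prob_space D"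
  by (simp add: nonneg_law_def real_distribution_def)

lemma nonneg_law_sets: "nonneg_law D \<Longrightarrow> sets D = sets borel"
  by (simp add: nonneg_law_def real_distribution_def real_distribution_axioms_def)

lemma nonneg_law_exp_integrable:
  assumes "nonneg_law D" "0 \<le> s"
  shows "integrable D (\<lambda>x. exp (- s * x))"
proof -
  interpret real_distribution D using assms by (simp add: nonneg_law_def)
  show ?thesis
    using assms
    by (intro integrable_const_bound[where B = 1])
      (auto simp: nonneg_law_def elim!: eventually_mono)
qed

lemma nn_integral_exp_eq_lst:
  assumes "nonneg_law D" "0 \<le> s"
  shows "(\<integral>\<^sup>+x. ennreal (exp (- s * x)) \<partial>D) = ennreal (lst D s)"
  unfolding lst_def using nonneg_law_exp_integrable[OF assms]
  by (intro nn_integral_eq_integral) auto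

text \<open>Tangent of the exponential at 0. All load estimates rest on this first-moment bound: the
  end of busy periods and of visits, the contraction, and the convergence of the products.\<close>

lemma lst_ge_linear:
  assumes "nonneg_law D" "0 \<le> s"
  shows "1 - s * mean D \<le> lst D s"
proof -
  interpret real_distribution D using assms by (simp add: nonneg_law_def)
  have "(\<integral>x. 1 - s * x \<partial>D) \<le> lst D s"
    unfolding lst_def
  proof (rule integral_mono)
    show "integrable D (\<lambda>x. 1 - s * x)" using assms by (auto simp: nonneg_law_def)
    show "1 - s * x \<le> exp (- s * x)" for x
      using exp_ge_add_one_self[of "- s * x"] by simp
  qed (rule nonneg_law_exp_integrable[OF assms])
  then show ?thesis
    using assms by (simp add: nonneg_law_def mean_def prob_space[unfolded space_eq_univ])
qed

lemma lst_le_1: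
  assumes "nonneg_law D" "0 \<le> s"
  shows "lst D s \<le> 1"
proof -
  interpret real_distribution D using assms by (simp add: nonneg_law_def)
  have "lst D s \<le> (\<integral>x. 1 \<partial>D)"
    unfolding lst_def using assms
    by (intro integral_mono_AE nonneg_law_exp_integrable)
      (auto simp: nonneg_law_def elim!: eventually_mono)
  then show ?thesis by (simp add: prob_space[unfolded space_eq_univ])
qed

lemma lst_pos:
  assumes "nonneg_law D" "0 \<le> s"
  shows "0 < lst D s"
proof -
  interpret real_distribution D using assms by (simp add: nonneg_law_def)
  have "lst D s \<noteq> 0"
    unfolding lst_def
    using integral_nonneg_eq_0_iff_AE[OF nonneg_law_exp_integrable[OF assms]] AE_False
    by (auto simp: prob_space[unfolded space_eq_univ])
  moreover have "0 \<le> lst D s" unfolding lst_def by simp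
  ultimately show ?thesis by simp
qed

lemma lst_0: "nonneg_law D \<Longrightarrow> lst D 0 = 1"
  using lst_ge_linear[of D 0] lst_le_1[of D 0] by simp

lemma mean_nonneg: "nonneg_law D \<Longrightarrow> 0 \<le> mean D"
  unfolding mean_def nonneg_law_def by (auto intro: integral_nonneg_AE)

text \<open>The mean is a Lipschitz constant. Continuity serves the intermediate value theorem for
  the busy-period equation.\<close>

lemma continuous_on_lst:
  assumes "nonneg_law D"
  shows "continuous_on {0..} (lst D)"
proof -
  interpret real_distribution D using assms by (simp add: nonneg_law_def)
  have *: "lst D s - lst D u \<le> \<bar>s - u\<bar> * mean D" if "0 \<le> s" "0 \<le> u" for s u
  proof -
    have "lst D s - lst D u = (\<integral>x. exp (- s * x) - exp (- u * x) \<partial>D)"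
      unfolding lst_def using nonneg_law_exp_integrable[OF assms] that by simp
    also have "\<dots> \<le> (\<integral>x. \<bar>s - u\<bar> * x \<partial>D)"
    proof (rule integral_mono_AE)
      have "AE x in D. 0 \<le> x" using assms by (simp add: nonneg_law_def)
      then show "AE x in D. exp (- s * x) - exp (- u * x) \<le> \<bar>s - u\<bar> * x"
      proof eventually_elim
        case (elim x)
        \<comment> \<open>Taking out \<open>exp (- s * x)\<close> leaves a factor that is at most
          \<open>(u - s) * x\<close> if \<open>s \<le> u\<close>, and at most 0 otherwise.\<close>
        have "exp (- s * x) - exp (- u * x) = exp (- s * x) * (1 - exp ((s - u) * x))"
          by (simp add: algebra_simps flip: exp_add)
        also have "\<dots> \<le> \<bar>s - u\<bar> * x"
        proof (cases "s \<le> u")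
          case True
          have "exp (- s * x) * (1 - exp ((s - u) * x)) \<le> 1 * (1 - exp ((s - u) * x))"
            using True elim that
            by (intro mult_right_mono) (auto simp: mult_nonpos_nonneg)
          also have "\<dots> \<le> \<bar>s - u\<bar> * x"
            using exp_ge_add_one_self[of "(s - u) * x"] True by (simp add: algebra_simps)
          finally show ?thesis .
        next
          case False
          then have "1 \<le> exp ((s - u) * x)" using elim by simp
          then have "exp (- s * x) * (1 - exp ((s - u) * x)) \<le> 0"
            by (intro mult_nonneg_nonpos) auto
          then show ?thesis using elim by (smt (verit) mult_nonneg_nonneg)
        qed
        finally show ?case .
      qed
    qed (use assms that in \<open>auto simp: nonneg_law_def intro!: Bochner_Integration.integrable_diff
          nonneg_law_exp_integrable[OF assms, simplified]\<close>)
    also have "\<dots> = \<bar>s - u\<bar> * mean D" by (simp add: mean_def)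
    finally show ?thesis .
  qed
  have "(mean D)-lipschitz_on {0..} (lst D)"
  proof (rule lipschitz_onI)
    fix s u :: real assume "s \<in> {0..}" "u \<in> {0..}"
    then show "dist (lst D s) (lst D u) \<le> mean D * dist s u"
      using *[of s u] *[of u s] by (simp add: dist_real_def abs_minus_commute mult.commute)
  qed (rule mean_nonneg[OF assms])
  then show ?thesis by (rule lipschitz_on_continuous_on)
qed

text \<open>Kendall's functional equation for the LST of a busy period. The difference of its sides
  changes sign between 0, where the LST on the right is positive, and 1, where it is at most
  1.\<close>

lemma busy_root_exists:
  assumes D: "nonneg_law D" and "0 \<le> s" "0 \<le> l"
  obtains y where "0 < y" "y \<le> 1" "y = lst D (s + l * (1 - y))"
proof -
  let ?f = "\<lambda>y. y - lst D (s + l * (1 - y))"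
  have "\<exists>y\<ge>0. y \<le> 1 \<and> ?f y = 0"
  proof (rule IVT')
    show "?f 0 \<le> 0" using lst_pos[OF D, of "s + l"] assms by simp
    show "0 \<le> ?f 1" using lst_le_1[OF D, of s] assms by simp
    show "continuous_on {0..1} ?f"
      using assms
      by (intro continuous_intros continuous_on_compose2[OF continuous_on_lst[OF D]]) auto
  qed simp
  then obtain y where y: "0 \<le> y" "y \<le> 1" "y = lst D (s + l * (1 - y))" by auto
  moreover have "0 < lst D (s + l * (1 - y))" using y assms by (intro lst_pos) auto
  ultimately show ?thesis using that by auto
qed

lemma nn_integral_bernoulli_mixture:
  assumes "nonneg_law D" "nonneg_law E" "0 \<le> a" "a \<le> 1" "f \<in> borel_measurable borel"
  shows "(\<integral>\<^sup>+x. f x \<partial>(measure_pmf (bernoulli_pmf a) \<bind> (\<lambda>h. if h then D else E)))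
    = ennreal a * (\<integral>\<^sup>+x. f x \<partial>D) + ennreal (1 - a) * (\<integral>\<^sup>+x. f x \<partial>E)"
proof -
  have "(\<integral>\<^sup>+x. f x \<partial>(measure_pmf (bernoulli_pmf a) \<bind> (\<lambda>h. if h then D else E)))
    = (\<integral>\<^sup>+h. (\<integral>\<^sup>+x. f x \<partial>(if h then D else E)) \<partial>measure_pmf (bernoulli_pmf a))"
    using assms
    by (intro nn_integral_bind[where B = borel])
      (auto simp: space_subprob_algebra nonneg_law_sets nonneg_law_prob
        intro!: prob_space_imp_subprob_space)
  also have "\<dots> = ennreal a * (\<integral>\<^sup>+x. f x \<partial>D) + ennreal (1 - a) * (\<integral>\<^sup>+x. f x \<partial>E)"
    using assms by (subst nn_integral_bernoulli_pmf) (auto simp: mult.commute)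
  finally show ?thesis .
qed

text \<open>Everything is read off nonnegative integrals, which are linear in the mixture;
  integrability of the mixture is a consequence of its finite first moment.\<close>

lemma bernoulli_mixture:
  assumes D: "nonneg_law D" and E: "nonneg_law E" and a: "0 \<le> a" "a \<le> 1"
  defines "F \<equiv> measure_pmf (bernoulli_pmf a) \<bind> (\<lambda>h. if h then D else E)"
  shows nonneg_law_mixture: "nonneg_law F"
    and mean_mixture: "mean F = a * mean D + (1 - a) * mean E"
    and lst_mixture: "0 \<le> s \<Longrightarrow> lst F s = a * lst D s + (1 - a) * lst E s"
proof -
  note nn = nn_integral_bernoulli_mixture[OF D E a, folded F_def]
  have kernel: "(\<lambda>h. if h then D else E) \<in> measurable (measure_pmf (bernoulli_pmf a)) (subprob_algebra borel)"
    using D E by (auto simp: space_subprob_algebra nonneg_law_sets nonneg_law_prob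
        intro!: prob_space_imp_subprob_space)
  have sets_F: "sets F = sets borel"
    unfolding F_def using D E by (intro sets_bind) (auto simp: nonneg_law_sets)
  interpret D: real_distribution D using D by (simp add: nonneg_law_def)
  interpret E: real_distribution E using E by (simp add: nonneg_law_def)
  have ab: "ennreal a + ennreal (1 - a) = 1" using a by (simp flip: ennreal_plus)
  have "prob_space F"
    by (rule prob_spaceI)
      (use nn[of "\<lambda>_. 1"] ab D.emeasure_space_1 E.emeasure_space_1 in simp)
  then interpret F: real_distribution F
    using sets_F by (simp add: real_distribution_def real_distribution_axioms_def)
  have "emeasure F {..<0} = 0"
  proof -
    have D0: "AE x in D. 0 \<le> x" and E0: "AE x in E. 0 \<le> x"
      using D E by (auto simp: nonneg_law_def)
    have "(\<integral>\<^sup>+x. indicator {..<0::real} x \<partial>D) = 0" "(\<integral>\<^sup>+x. indicator {..<0::real} x \<partial>E) = 0"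
      using D0 E0 by (auto simp: nn_integral_0_iff_AE indicator_def elim!: eventually_mono)
    then show ?thesis using nn[of "indicator {..<0}"] by simp
  qed
  then have AE0: "AE x in F. 0 \<le> x"
    by (intro AE_I[where N = "{..<0}"]) (auto simp: not_le)
  have mean_nn: "(\<integral>\<^sup>+x. ennreal x \<partial>G) = ennreal (mean G)" if "nonneg_law G" for G
    unfolding mean_def using that by (intro nn_integral_eq_integral) (auto simp: nonneg_law_def)
  have mF: "(\<integral>\<^sup>+x. ennreal x \<partial>F) = ennreal (a * mean D + (1 - a) * mean E)"
    using a mean_nonneg[OF D] mean_nonneg[OF E]
    by (subst nn) (auto simp: mean_nn[OF D] mean_nn[OF E] ennreal_mult ennreal_plus)
  have int: "integrable F (\<lambda>x. x)"
    using AE0 mF by (intro integrableI_nonneg) auto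
  show law: "nonneg_law F"
    using AE0 int F.real_distribution_axioms by (simp add: nonneg_law_def)
  have "ennreal (mean F) = ennreal (a * mean D + (1 - a) * mean E)"
    using mF mean_nn[OF law] by simp
  then show "mean F = a * mean D + (1 - a) * mean E"
    using a mean_nonneg[OF D] mean_nonneg[OF E] mean_nonneg[OF law] by (subst (asm) ennreal_inj) auto
  show "lst F s = a * lst D s + (1 - a) * lst E s" if s: "0 \<le> s"
  proof -
    have "ennreal (lst F s) = ennreal (a * lst D s + (1 - a) * lst E s)"
      using a lst_pos[OF D s] lst_pos[OF E s]
      by (subst nn_integral_exp_eq_lst[symmetric, OF law s], subst nn)
        (auto simp: nn_integral_exp_eq_lst[OF D s, simplified] nn_integral_exp_eq_lst[OF E s, simplified]
          ennreal_mult ennreal_plus)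
    then show ?thesis
      using a lst_pos[OF D s] lst_pos[OF E s] lst_pos[OF law s] by (subst (asm) ennreal_inj) auto
  qed
qed

section \<open>Independent sources of randomness\<close>

locale independent_sources = prob_space M for M :: "'a measure" +
  fixes F :: "'s \<Rightarrow> 'a set set"
  assumes indep_sources: "indep_sets F UNIV"
    and sigma_algebra_source: "\<And>s. sigma_algebra (space M) (F s)"
begin

text \<open>Serves only as a measurable space, the information carried by the sources in
  \<open>A\<close>. Integrals are taken with respect to \<open>M\<close> or to an image of
  \<open>M\<close>.\<close>

definition collect :: "'s set \<Rightarrow> 'a measure" where
  "collect A = sigma (space M) (\<Union>s\<in>A. F s)"

lemma source_subset: "F s \<subseteq> Pow (space M)"
  using sigma_algebra_source[of s] by (simp add: sigma_algebra_iff2)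

lemma space_collect [simp]: "space (collect A) = space M"
  unfolding collect_def by (intro space_measure_of) (use source_subset in auto)

lemma sets_collect: "sets (collect A) = sigma_sets (space M) (\<Union>s\<in>A. F s)"
  unfolding collect_def by (intro sets_measure_of) (use source_subset in auto)

lemma source_in_collect: "s \<in> A \<Longrightarrow> X \<in> F s \<Longrightarrow> X \<in> sets (collect A)"
  unfolding sets_collect by (intro sigma_sets.Basic) auto

lemma sets_collect_subset: "sets (collect A) \<subseteq> sets M"
proof -
  have "F s \<subseteq> sets M" for s
    using indep_sources by (auto simp: indep_sets_def)
  then show ?thesis unfolding sets_collect by (intro sets.sigma_sets_subset) auto
qed

lemma measurable_collect: "f \<in> measurable (collect A) N \<Longrightarrow> f \<in> measurable M N"
  using sets_collect_subset[of A] by (auto simp: measurable_def)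

lemma measurable_collectI:
  assumes "s \<in> A" "f \<in> measurable M N" "\<And>X. X \<in> sets N \<Longrightarrow> f -` X \<inter> space M \<in> F s"
  shows "f \<in> measurable (collect A) N"
  using assms by (auto simp: measurable_def intro: source_in_collect)

lemma Int_stable_source: "Int_stable (F s)"
proof -
  interpret sigma_algebra "space M" "F s" by (rule sigma_algebra_source)
  show ?thesis by (auto simp: Int_stable_def)
qed

text \<open>The image of \<open>M\<close> under the identity, as a map into
  \<open>collect A\<close>, is the restriction of \<open>M\<close> to that sigma-algebra.
  Measurability in the parameter is then the usual part of Tonelli's theorem.\<close>

lemma borel_measurable_partial_nn_integral:
  assumes H: "H \<in> borel_measurable (collect A \<Otimes>\<^sub>M collect B)"
  shows "(\<lambda>\<omega>'. \<integral>\<^sup>+\<omega>. H (\<omega>, \<omega>') \<partial>M) \<in> borel_measurable (collect B)"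
proof -
  have id: "(\<lambda>\<omega>. \<omega>) \<in> measurable M (collect A)"
    using measurable_collect[of "\<lambda>\<omega>. \<omega>" A "collect A"] by simp
  interpret A: prob_space "distr M (collect A) (\<lambda>\<omega>. \<omega>)" by (rule prob_space_distr[OF id])
  have "(\<lambda>(\<omega>', \<omega>). H (\<omega>, \<omega>')) \<in> borel_measurable (collect B \<Otimes>\<^sub>M collect A)"
    using H by measurable
  also have "borel_measurable (collect B \<Otimes>\<^sub>M collect A)
      = borel_measurable (collect B \<Otimes>\<^sub>M distr M (collect A) (\<lambda>\<omega>. \<omega>))"
    by (intro measurable_cong_sets sets_pair_measure_cong) auto
  finally have "(\<lambda>\<omega>'. \<integral>\<^sup>+\<omega>. H (\<omega>, \<omega>') \<partial>distr M (collect A) (\<lambda>\<omega>. \<omega>)) \<in> borel_measurable (collect B)"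
    by (rule A.borel_measurable_nn_integral)
  moreover have "(\<integral>\<^sup>+\<omega>. H (\<omega>, \<omega>') \<partial>distr M (collect A) (\<lambda>\<omega>. \<omega>)) = (\<integral>\<^sup>+\<omega>. H (\<omega>, \<omega>') \<partial>M)"
    if "\<omega>' \<in> space (collect B)" for \<omega>'
    by (rule nn_integral_distr[OF id]) (use H that in measurable)
  ultimately show ?thesis by (rule measurable_cong[THEN iffD1, rotated])
qed

text \<open>This takes the place of conditioning. The pair of identities into two independent
  sigma-algebras has a product law, so the sample point may be duplicated, and one copy can be
  frozen while the other is integrated.\<close>

lemma decouple:
  assumes disj: "A \<inter> B = {}"
    and H: "H \<in> borel_measurable (collect A \<Otimes>\<^sub>M collect B)"
  shows "(\<integral>\<^sup>+\<omega>. H (\<omega>, \<omega>) \<partial>M) = (\<integral>\<^sup>+\<omega>'. \<integral>\<^sup>+\<omega>. H (\<omega>, \<omega>') \<partial>M \<partial>M)"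
proof -
  have id: "(\<lambda>\<omega>. \<omega>) \<in> measurable M (collect C)" for C
    using measurable_collect[of "\<lambda>\<omega>. \<omega>" C "collect C"] by simp
  have "indep_sets (\<lambda>b. sigma_sets (space M) (\<Union>s\<in>case_bool A B b. F s)) UNIV"
  proof (rule indep_sets_collect_sigma)
    show "indep_sets F (\<Union>b\<in>UNIV. case_bool A B b)"
      using indep_sources by (rule indep_sets_mono_index[rotated]) auto
    show "disjoint_family_on (case_bool A B) UNIV"
      using disj by (auto simp: disjoint_family_on_def split: bool.splits)
  qed (rule Int_stable_source)
  also have "(\<lambda>b. sigma_sets (space M) (\<Union>s\<in>case_bool A B b. F s))
      = case_bool (sets (collect A)) (sets (collect B))"
    by (auto simp: fun_eq_iff sets_collect split: bool.splits)
  finally have ind: "indep_set (sets (collect A)) (sets (collect B))"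
    by (simp add: indep_set_def)
  \<comment> \<open>The identity generates exactly the events of its target, so independence of the
    two sigma-algebras is independence of two copies of the identity.\<close>
  have eq: "sigma_sets (space M) {(\<lambda>\<omega>. \<omega>) -` X \<inter> space M |X. X \<in> sets (collect C)} = sets (collect C)" for C
  proof -
    have "{(\<lambda>\<omega>. \<omega>) -` X \<inter> space M |X. X \<in> sets (collect C)} = (\<lambda>X. X) ` sets (collect C)"
      unfolding Setcompr_eq_image
      by (intro image_cong refl) (use sets.sets_into_space[of _ "collect C"] in auto)
    then show ?thesis using sets.sigma_sets_eq[of "collect C"] by simp
  qed
  have "indep_var (collect A) (\<lambda>\<omega>. \<omega>) (collect B) (\<lambda>\<omega>. \<omega>)"
    unfolding indep_var_eq eq using ind id by simp
  then have joint: "distr M (collect A) (\<lambda>\<omega>. \<omega>) \<Otimes>\<^sub>M distr M (collect B) (\<lambda>\<omega>. \<omega>)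
      = distr M (collect A \<Otimes>\<^sub>M collect B) (\<lambda>\<omega>. (\<omega>, \<omega>))"
    by (simp add: indep_var_distribution_eq)
  interpret A: prob_space "distr M (collect A) (\<lambda>\<omega>. \<omega>)" by (rule prob_space_distr[OF id])
  interpret B: prob_space "distr M (collect B) (\<lambda>\<omega>. \<omega>)" by (rule prob_space_distr[OF id])
  interpret AB: pair_sigma_finite "distr M (collect A) (\<lambda>\<omega>. \<omega>)" "distr M (collect B) (\<lambda>\<omega>. \<omega>)" ..
  have "(\<integral>\<^sup>+\<omega>. H (\<omega>, \<omega>) \<partial>M)
      = (\<integral>\<^sup>+x. H x \<partial>(distr M (collect A \<Otimes>\<^sub>M collect B) (\<lambda>\<omega>. (\<omega>, \<omega>))))"
    using H id by (subst nn_integral_distr) auto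
  also have "\<dots> = (\<integral>\<^sup>+\<omega>'. \<integral>\<^sup>+\<omega>. H (\<omega>, \<omega>') \<partial>distr M (collect A) (\<lambda>\<omega>. \<omega>) \<partial>distr M (collect B) (\<lambda>\<omega>. \<omega>))"
    unfolding joint[symmetric]
  proof -
    have "borel_measurable (distr M (collect A) (\<lambda>\<omega>. \<omega>) \<Otimes>\<^sub>M distr M (collect B) (\<lambda>\<omega>. \<omega>))
        = borel_measurable (collect A \<Otimes>\<^sub>M collect B)"
      by (intro measurable_cong_sets sets_pair_measure_cong) auto
    then show "integral\<^sup>N (distr M (collect A) (\<lambda>\<omega>. \<omega>) \<Otimes>\<^sub>M distr M (collect B) (\<lambda>\<omega>. \<omega>)) H
      = (\<integral>\<^sup>+\<omega>'. \<integral>\<^sup>+\<omega>. H (\<omega>, \<omega>') \<partial>distr M (collect A) (\<lambda>\<omega>. \<omega>) \<partial>distr M (collect B) (\<lambda>\<omega>. \<omega>))"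
      using AB.nn_integral_snd[of H] H by simp
  qed
  also have "\<dots> = (\<integral>\<^sup>+\<omega>'. \<integral>\<^sup>+\<omega>. H (\<omega>, \<omega>') \<partial>M \<partial>distr M (collect B) (\<lambda>\<omega>. \<omega>))"
    by (intro nn_integral_cong nn_integral_distr[OF id]) (use H in measurable)
  also have "\<dots> = (\<integral>\<^sup>+\<omega>'. \<integral>\<^sup>+\<omega>. H (\<omega>, \<omega>') \<partial>M \<partial>M)"
    by (rule nn_integral_distr[OF id], subst measurable_distr_eq1)
      (rule borel_measurable_partial_nn_integral[OF H])
  finally show ?thesis .
qed

lemma nn_integral_mult_indep:
  assumes "A \<inter> B = {}" "f \<in> borel_measurable (collect A)" "g \<in> borel_measurable (collect B)"
  shows "(\<integral>\<^sup>+\<omega>. f \<omega> * g \<omega> \<partial>M) = (\<integral>\<^sup>+\<omega>. f \<omega> \<partial>M) * (\<integral>\<^sup>+\<omega>. g \<omega> \<partial>M)"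
proof -
  have "(\<integral>\<^sup>+\<omega>. f \<omega> * g \<omega> \<partial>M) = (\<integral>\<^sup>+\<omega>'. \<integral>\<^sup>+\<omega>. f \<omega> * g \<omega>' \<partial>M \<partial>M)"
    using decouple[OF assms(1), of "\<lambda>x. f (fst x) * g (snd x)"] assms by simp
  also have "\<dots> = (\<integral>\<^sup>+\<omega>'. (\<integral>\<^sup>+\<omega>. f \<omega> \<partial>M) * g \<omega>' \<partial>M)"
    using assms by (intro nn_integral_cong nn_integral_multc measurable_collect)
  also have "\<dots> = (\<integral>\<^sup>+\<omega>. f \<omega> \<partial>M) * (\<integral>\<^sup>+\<omega>. g \<omega> \<partial>M)"
    using assms by (intro nn_integral_cmult measurable_collect)
  finally show ?thesis .
qed

lemma nn_integral_prod_indep: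
  fixes Y :: "'i \<Rightarrow> 'a \<Rightarrow> ennreal"
  assumes "finite J" "inj_on g J" "\<And>i. i \<in> J \<Longrightarrow> Y i \<in> borel_measurable (collect {g i})"
  shows "(\<integral>\<^sup>+\<omega>. (\<Prod>i\<in>J. Y i \<omega>) \<partial>M) = (\<Prod>i\<in>J. \<integral>\<^sup>+\<omega>. Y i \<omega> \<partial>M)"
  using assms
proof (induction J rule: finite_induct)
  case (insert i J)
  have "(\<integral>\<^sup>+\<omega>. (\<Prod>j\<in>insert i J. Y j \<omega>) \<partial>M) = (\<integral>\<^sup>+\<omega>. Y i \<omega> * (\<Prod>j\<in>J. Y j \<omega>) \<partial>M)"
    using insert by simp
  also have "\<dots> = (\<integral>\<^sup>+\<omega>. Y i \<omega> \<partial>M) * (\<integral>\<^sup>+\<omega>. (\<Prod>j\<in>J. Y j \<omega>) \<partial>M)"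
  proof (rule nn_integral_mult_indep)
    show "{g i} \<inter> g ` J = {}" using insert by auto
    show "(\<lambda>\<omega>. \<Prod>j\<in>J. Y j \<omega>) \<in> borel_measurable (collect (g ` J))"
    proof (rule borel_measurable_prod_ennreal)
      fix j assume "j \<in> J"
      then have "Y j \<in> borel_measurable (collect {g j})" using insert by auto
      moreover have "sets (collect {g j}) \<subseteq> sets (collect (g ` J))"
        unfolding sets_collect using \<open>j \<in> J\<close> by (intro sigma_sets_mono') auto
      ultimately show "Y j \<in> borel_measurable (collect (g ` J))"
        by (auto simp: measurable_def)
    qed
  qed (use insert in auto)
  finally show ?case using insert by simp
qed (simp add: emeasure_space_1)

end

section \<open>Poisson processes at random times\<close>

context poisson_process
begin

lemma count_in_events: "0 \<le> t \<Longrightarrow> N t -` X \<inter> space M \<in> process_events M N"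
  unfolding process_events_def by (intro sigma_sets.Basic) auto

lemma sigma_algebra_process_events: "sigma_algebra (space M) (process_events M N)"
  unfolding process_events_def by (intro sigma_algebra_sigma_sets) auto

text \<open>A right-continuous process is the limit of its values at times with countably many
  values, for which joint measurability is clear. The sample point of the process and that of the
  time are kept apart, as \<open>decouple\<close> requires.\<close>

lemma measurable_count_at_random_time:
  assumes G: "space G = space M" "process_events M N \<subseteq> sets G"
    and T: "T \<in> borel_measurable H" "\<And>\<omega>. \<omega> \<in> space H \<Longrightarrow> 0 \<le> T \<omega>"
  shows "(\<lambda>x. N (T (snd x)) (fst x)) \<in> measurable (G \<Otimes>\<^sub>M H) (count_space UNIV)"
proof -
  \<comment> \<open>The first dyadic number of level \<open>m\<close> that is strictly above
    \<open>x\<close>. Strictness matters, because right continuity is stated for the filter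
    \<open>at_right\<close>.\<close>
  define t where "t m x = real (Suc (nat \<lfloor>2 ^ m * x\<rfloor>)) / 2 ^ m" for m :: nat and x :: real
  have t_gt: "x < t m x" and t_le: "t m x \<le> x + 1 / 2 ^ m" if "0 \<le> x" for x m
  proof -
    have *: "real (nat \<lfloor>2 ^ m * x\<rfloor>) = of_int \<lfloor>2 ^ m * x\<rfloor>" using that by simp
    show "x < t m x" "t m x \<le> x + 1 / 2 ^ m"
      unfolding t_def of_nat_Suc * using that
      by (simp_all add: field_simps) linarith+
  qed
  have t_lim: "filterlim (\<lambda>m. t m x) (at_right x) sequentially" if "0 \<le> x" for x
  proof (rule tendsto_imp_filterlim_at_right)
    have "(\<lambda>m. x + 1 / 2 ^ m) \<longlonglongrightarrow> x + 0"
      by (intro tendsto_add tendsto_const LIMSEQ_divide_realpow_zero) auto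
    then have "(\<lambda>m. x + 1 / 2 ^ m) \<longlonglongrightarrow> x" by simp
    then show "(\<lambda>m. t m x) \<longlonglongrightarrow> x"
      by (rule real_tendsto_sandwich[where f = "\<lambda>_. x", rotated -1])
        (use t_gt[OF that] t_le[OF that] in \<open>auto intro!: always_eventually less_imp_le\<close>)
  qed (use t_gt[OF that] in simp)
  have meas: "(\<lambda>x. real (N (t m (T (snd x))) (fst x))) \<in> borel_measurable (G \<Otimes>\<^sub>M H)" for m
  proof -
    have "(\<lambda>x. real (N (real (Suc (nat \<lfloor>2 ^ m * T (snd x)\<rfloor>)) / 2 ^ m) (fst x))) \<in> borel_measurable (G \<Otimes>\<^sub>M H)"
    proof (rule measurable_compose_countable[where f = "\<lambda>i x. real (N (real (Suc i) / 2 ^ m) (fst x))"])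
      fix i :: nat
      have "N (real (Suc i) / 2 ^ m) \<in> measurable G (count_space UNIV)"
        using G count_in_events[of "real (Suc i) / 2 ^ m"] by (auto simp: measurable_def)
      then show "(\<lambda>x. real (N (real (Suc i) / 2 ^ m) (fst x))) \<in> borel_measurable (G \<Otimes>\<^sub>M H)"
        by measurable
    qed (use T in measurable)
    then show ?thesis by (simp add: t_def)
  qed
  have lim: "(\<lambda>m. real (N (t m (T (snd x))) (fst x))) \<longlonglongrightarrow> real (N (T (snd x)) (fst x))"
    if x: "x \<in> space (G \<Otimes>\<^sub>M H)" for x
  proof -
    have "fst x \<in> space M" "0 \<le> T (snd x)" using x G T by (auto simp: space_pair_measure)
    then have "eventually (\<lambda>m. N (t m (T (snd x))) (fst x) = N (T (snd x)) (fst x)) sequentially"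
      by (intro eventually_compose_filterlim[OF right_cont t_lim])
    then show ?thesis by (intro tendsto_eventually) (auto elim: eventually_mono)
  qed
  have "(\<lambda>x. real (N (T (snd x)) (fst x))) \<in> borel_measurable (G \<Otimes>\<^sub>M H)"
    by (rule borel_measurable_LIMSEQ_real[OF lim meas])
  then have "(\<lambda>x. nat \<lfloor>real (N (T (snd x)) (fst x))\<rfloor>) \<in> measurable (G \<Otimes>\<^sub>M H) (count_space UNIV)"
    by measurable
  then show ?thesis by simp
qed

lemma nn_integral_poisson_pgf:
  assumes "0 < c" "0 \<le> z"
  shows "(\<integral>\<^sup>+k. ennreal (z ^ k) \<partial>measure_pmf (poisson_pmf c)) = ennreal (exp (- c * (1 - z)))"
proof -
  have "(\<integral>\<^sup>+k. ennreal (z ^ k) \<partial>measure_pmf (poisson_pmf c))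
      = (\<Sum>k. ennreal (exp (- c) * ((c * z) ^ k /\<^sub>R fact k)))"
    using assms
    by (auto simp: nn_integral_measure_pmf nn_integral_count_space_nat power_mult_distrib
        divide_inverse mult_ac simp flip: ennreal_mult intro!: suminf_cong)
  also have "\<dots> = ennreal (exp (- c) * exp (c * z))"
    using assms by (intro suminf_ennreal_eq sums_mult exp_converges) auto
  finally show ?thesis by (simp add: algebra_simps flip: exp_add)
qed

lemma nn_integral_increment_pgf:
  assumes "0 \<le> s" "s \<le> t" "0 \<le> z" "z \<le> 1"
  shows "(\<integral>\<^sup>+\<omega>. ennreal (z ^ (N t \<omega> - N s \<omega>)) \<partial>M) = ennreal (exp (- rate * (1 - z) * (t - s)))"
proof (cases "s = t")
  case True
  then show ?thesis by (simp add: emeasure_space_1)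
next
  case False
  have meas: "(\<lambda>\<omega>. N t \<omega> - N s \<omega>) \<in> measurable M (count_space UNIV)"
    by (intro measurable_diff_nat measurable_count) (use assms in auto)
  have "(\<integral>\<^sup>+\<omega>. ennreal (z ^ (N t \<omega> - N s \<omega>)) \<partial>M)
      = (\<integral>\<^sup>+k. ennreal (z ^ k) \<partial>distr M (count_space UNIV) (\<lambda>\<omega>. N t \<omega> - N s \<omega>))"
    using meas by (subst nn_integral_distr) auto
  also have "\<dots> = ennreal (exp (- (rate * (t - s)) * (1 - z)))"
    using False assms rate_pos by (subst increments) (auto simp: nn_integral_poisson_pgf[simplified])
  finally show ?thesis by (simp add: algebra_simps)
qed

text \<open>Independent increments at deterministic times: the event fixes the first
  \<open>n\<close> increments, and the power is a function of the next one.\<close>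

lemma nn_integral_history_increment:
  fixes t :: "nat \<Rightarrow> real"
  assumes "0 \<le> t 0" "\<And>k. k < n \<Longrightarrow> t k \<le> t (Suc k)" "0 \<le> u" "0 \<le> z" "z \<le> 1"
  shows "(\<integral>\<^sup>+\<omega>. of_bool (\<forall>k<n. N (t (Suc k)) \<omega> - N (t k) \<omega> = a k) *
        ennreal (z ^ (N (t n + u) \<omega> - N (t n) \<omega>)) \<partial>M)
    = (\<integral>\<^sup>+\<omega>. of_bool (\<forall>k<n. N (t (Suc k)) \<omega> - N (t k) \<omega> = a k) \<partial>M) *
      ennreal (exp (- rate * (1 - z) * u))"
proof -
  \<comment> \<open>Repeating the last time keeps the sequence increasing at all indices, as
    \<open>indep_increments\<close> demands; increment number \<open>n\<close> is the one over the
    interval of length \<open>u\<close>.\<close>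
  define s where "s k = (if k \<le> n then t k else t n + u)" for k
  define g where "g k x = (if k < n then of_bool (x = a k) else ennreal (z ^ x))" for k x
  have inc: "incseq s"
    using assms by (intro incseq_SucI) (auto simp: s_def not_le less_Suc_eq_le)
  have s0: "0 \<le> s 0" using assms by (simp add: s_def)
  have t_nonneg: "0 \<le> t k" if "k \<le> n" for k
    using incseqD[OF inc, of 0 k] assms(1) that by (simp add: s_def)
  \<comment> \<open>Used for \<open>m = n\<close> and \<open>m = Suc n\<close>; comparing the two
    factorizations splits the last increment from the history.\<close>
  have *: "(\<integral>\<^sup>+\<omega>. (\<Prod>k<m. g k (N (s (Suc k)) \<omega> - N (s k) \<omega>)) \<partial>M)
      = (\<Prod>k<m. \<integral>\<^sup>+\<omega>. g k (N (s (Suc k)) \<omega> - N (s k) \<omega>) \<partial>M)" for m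
    by (intro indep_vars_nn_integral indep_vars_compose2[OF indep_increments])
      (auto simp: s0 inc)
  have hist: "(\<Prod>k<n. g k (N (s (Suc k)) \<omega> - N (s k) \<omega>))
      = of_bool (\<forall>k<n. N (t (Suc k)) \<omega> - N (t k) \<omega> = a k)" for \<omega>
  proof -
    have "(\<Prod>k<n. g k (N (s (Suc k)) \<omega> - N (s k) \<omega>))
        = (\<Prod>k<n. of_bool (N (t (Suc k)) \<omega> - N (t k) \<omega> = a k))"
      by (intro prod.cong) (auto simp: g_def s_def)
    also have "\<dots> = of_bool (\<forall>k<n. N (t (Suc k)) \<omega> - N (t k) \<omega> = a k)"
      by (cases "\<forall>k<n. N (t (Suc k)) \<omega> - N (t k) \<omega> = a k") (auto intro!: prod_zero)
    finally show ?thesis .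
  qed
  have last: "g n (N (s (Suc n)) \<omega> - N (s n) \<omega>) = ennreal (z ^ (N (t n + u) \<omega> - N (t n) \<omega>))" for \<omega>
    by (simp add: g_def s_def)
  have "(\<integral>\<^sup>+\<omega>. ennreal (z ^ (N (t n + u) \<omega> - N (t n) \<omega>)) \<partial>M) = ennreal (exp (- rate * (1 - z) * u))"
    using assms t_nonneg[of n] nn_integral_increment_pgf[of "t n" "t n + u" z] by simp
  then show ?thesis
    using *[of n] *[of "Suc n"] by (simp add: hist last)
qed

end

locale poisson_sources = independent_sources M F
  for M :: "'a measure" and F :: "'s \<Rightarrow> 'a set set" +
  fixes lam :: "'c::finite \<Rightarrow> real" and N :: "'c \<Rightarrow> real \<Rightarrow> 'a \<Rightarrow> nat" and arr :: "'c \<Rightarrow> 's"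
  assumes poisson: "\<And>e. poisson_process M (lam e) (N e)"
    and arrival_source: "\<And>e. F (arr e) = process_events M (N e)"
    and inj_arr: "inj arr"
begin

lemma measurable_count_pair:
  assumes "T \<in> borel_measurable (collect A)" "\<And>\<omega>. \<omega> \<in> space M \<Longrightarrow> 0 \<le> T \<omega>"
  shows "(\<lambda>x. N e (T (snd x)) (fst x)) \<in> measurable (collect (range arr) \<Otimes>\<^sub>M collect A) (count_space UNIV)"
proof -
  interpret poisson_process M "lam e" "N e" by (rule poisson)
  show ?thesis
    using assms
    by (intro measurable_count_at_random_time)
      (auto simp: arrival_source intro: source_in_collect[of "arr e"])
qed

lemma measurable_count_random:
  assumes "T \<in> borel_measurable M" "\<And>\<omega>. \<omega> \<in> space M \<Longrightarrow> 0 \<le> T \<omega>"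
  shows "(\<lambda>\<omega>. N e (T \<omega>) \<omega>) \<in> measurable M (count_space UNIV)"
proof -
  interpret poisson_process M "lam e" "N e" by (rule poisson)
  have "(\<lambda>x. N e (T (snd x)) (fst x)) \<in> measurable (M \<Otimes>\<^sub>M M) (count_space UNIV)"
  proof (rule measurable_count_at_random_time)
    show "process_events M (N e) \<subseteq> sets M"
      unfolding process_events_def
      by (intro sets.sigma_sets_subset) (auto intro: measurable_sets[OF measurable_count])
  qed (use assms in auto)
  then have "(\<lambda>x. N e (T (snd x)) (fst x)) \<circ> (\<lambda>\<omega>. (\<omega>, \<omega>)) \<in> measurable M (count_space UNIV)"
    by (intro measurable_comp[OF measurable_Pair]) auto
  then show ?thesis by (simp add: comp_def)
qed

text \<open>Each type contributes a factor that depends on its own arrival source only. So both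
  integrals are products over the types, and for a single type the claim is the independence of
  increments of one Poisson process.\<close>

lemma deterministic_history_increment:
  fixes t :: "nat \<Rightarrow> real"
  assumes t: "0 \<le> t 0" "\<And>k. k < n \<Longrightarrow> t k \<le> t (Suc k)" "0 \<le> u"
    and z: "\<And>e. 0 \<le> z e" "\<And>e. z e \<le> 1"
  shows "(\<integral>\<^sup>+\<omega>. of_bool (\<forall>k<n. \<forall>e. N e (t (Suc k)) \<omega> - N e (t k) \<omega> = a k e) *
        (\<Prod>e\<in>UNIV. ennreal (z e ^ (N e (t n + u) \<omega> - N e (t n) \<omega>))) \<partial>M)
    = (\<integral>\<^sup>+\<omega>. of_bool (\<forall>k<n. \<forall>e. N e (t (Suc k)) \<omega> - N e (t k) \<omega> = a k e) \<partial>M) *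
      ennreal (exp (- (\<Sum>e\<in>UNIV. lam e * (1 - z e)) * u))"
proof -
  define h where "h e \<omega> = (of_bool (\<forall>k<n. N e (t (Suc k)) \<omega> - N e (t k) \<omega> = a k e) :: ennreal)" for e \<omega>
  define g where "g e \<omega> = ennreal (z e ^ (N e (t n + u) \<omega> - N e (t n) \<omega>))" for e \<omega>
  have t_nonneg: "0 \<le> t k" if "k \<le> n" for k
    using that by (induction k) (use t in \<open>auto intro: order_trans\<close>)
  have count: "N e s \<in> measurable (collect {arr e}) (count_space UNIV)" if "0 \<le> s" for e s
  proof -
    interpret poisson_process M "lam e" "N e" by (rule poisson)
    show ?thesis
      by (rule measurable_collectI[of "arr e"])
        (use that measurable_count count_in_events in \<open>auto simp: arrival_source\<close>)
  qed
  have diff: "(\<lambda>\<omega>. N e s \<omega> - N e s' \<omega>) \<in> measurable (collect {arr e}) (count_space UNIV)"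
    if "0 \<le> s" "0 \<le> s'" for e s s'
    by (intro measurable_diff_nat count that)
  have h: "h e \<in> borel_measurable (collect {arr e})" for e
    unfolding h_def
    by (intro borel_measurable_of_bool_pred pred_all_less pred_eq_const1[OF diff])
      (auto intro!: t_nonneg)
  have g: "g e \<in> borel_measurable (collect {arr e})" for e
    unfolding g_def
    by (rule measurable_compose[OF diff[of "t n + u" "t n" e]])
      (use t_nonneg[of n] t in auto)
  have H: "of_bool (\<forall>k<n. \<forall>e. N e (t (Suc k)) \<omega> - N e (t k) \<omega> = a k e) = (\<Prod>e\<in>UNIV. h e \<omega>)" for \<omega>
    by (cases "\<forall>k<n. \<forall>e. N e (t (Suc k)) \<omega> - N e (t k) \<omega> = a k e") (auto simp: h_def intro!: prod_zero)
  have one: "(\<integral>\<^sup>+\<omega>. h e \<omega> * g e \<omega> \<partial>M) = (\<integral>\<^sup>+\<omega>. h e \<omega> \<partial>M) * ennreal (exp (- lam e * (1 - z e) * u))" for e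
  proof -
    interpret poisson_process M "lam e" "N e" by (rule poisson)
    show ?thesis
      unfolding h_def g_def by (rule nn_integral_history_increment) (use t z in auto)
  qed
  have "(\<integral>\<^sup>+\<omega>. (\<Prod>e\<in>UNIV. h e \<omega>) * (\<Prod>e\<in>UNIV. g e \<omega>) \<partial>M) = (\<integral>\<^sup>+\<omega>. (\<Prod>e\<in>UNIV. h e \<omega> * g e \<omega>) \<partial>M)"
    by (simp add: prod.distrib)
  also have "\<dots> = (\<Prod>e\<in>UNIV. \<integral>\<^sup>+\<omega>. h e \<omega> * g e \<omega> \<partial>M)"
    using h g inj_arr by (intro nn_integral_prod_indep) auto
  also have "\<dots> = (\<Prod>e\<in>UNIV. \<integral>\<^sup>+\<omega>. h e \<omega> \<partial>M) * (\<Prod>e\<in>UNIV. ennreal (exp (- lam e * (1 - z e) * u)))"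
    by (simp add: one prod.distrib)
  also have "(\<Prod>e\<in>UNIV. \<integral>\<^sup>+\<omega>. h e \<omega> \<partial>M) = (\<integral>\<^sup>+\<omega>. (\<Prod>e\<in>UNIV. h e \<omega>) \<partial>M)"
    using h inj_arr by (intro nn_integral_prod_indep[symmetric]) auto
  also have "(\<Prod>e\<in>UNIV. ennreal (exp (- lam e * (1 - z e) * u)))
      = ennreal (exp (- (\<Sum>e\<in>UNIV. lam e * (1 - z e)) * u))"
    by (simp add: prod_ennreal exp_sum[symmetric] sum_distrib_right sum_negf)
  finally show ?thesis unfolding H g_def .
qed

text \<open>\<open>A\<close> stands for the sources used so far, \<open>B\<close> for those of the
  next step. Neither contains an arrival process, so all times can be frozen by
  \<open>decouple\<close> and the deterministic case applies. This is the substitute for a strong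
  Markov property.\<close>

lemma random_history_increment:
  fixes T :: "nat \<Rightarrow> 'a \<Rightarrow> real" and a :: "nat \<Rightarrow> 'c \<Rightarrow> nat"
  assumes disj: "A \<inter> B = {}" "A \<inter> range arr = {}" "B \<inter> range arr = {}"
    and T: "\<And>k. k \<le> n \<Longrightarrow> T k \<in> borel_measurable (collect A)"
      "\<And>\<omega>. \<omega> \<in> space M \<Longrightarrow> 0 \<le> T 0 \<omega>"
      "\<And>k \<omega>. k < n \<Longrightarrow> \<omega> \<in> space M \<Longrightarrow> T k \<omega> \<le> T (Suc k) \<omega>"
    and U: "U \<in> borel_measurable (collect B)" "\<And>\<omega>. \<omega> \<in> space M \<Longrightarrow> 0 \<le> U \<omega>"
    and R: "R \<in> borel_measurable (collect A)" and Q: "Q \<in> borel_measurable (collect B)"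
    and z: "\<And>e. 0 \<le> z e" "\<And>e. z e \<le> 1"
  defines "hist \<equiv> \<lambda>\<omega>. \<forall>k<n. \<forall>e. N e (T (Suc k) \<omega>) \<omega> - N e (T k \<omega>) \<omega> = a k e"
  shows "(\<integral>\<^sup>+\<omega>. R \<omega> * of_bool (hist \<omega>) *
        (Q \<omega> * (\<Prod>e\<in>UNIV. ennreal (z e ^ (N e (T n \<omega> + U \<omega>) \<omega> - N e (T n \<omega>) \<omega>)))) \<partial>M)
    = (\<integral>\<^sup>+\<omega>. R \<omega> * of_bool (hist \<omega>) \<partial>M) *
      (\<integral>\<^sup>+\<omega>. Q \<omega> * ennreal (exp (- (\<Sum>e\<in>UNIV. lam e * (1 - z e)) * U \<omega>)) \<partial>M)"
proof -
  let ?AR = "collect (range arr)"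
  define c where "c = (\<Sum>e\<in>UNIV. lam e * (1 - z e))"
  define h where "h x = (of_bool (\<forall>k<n. \<forall>e. N e (T (Suc k) (snd x)) (fst x) - N e (T k (snd x)) (fst x) = a k e) :: ennreal)"
    for x :: "'a \<times> 'a"
  define g where "g x = (\<Prod>e\<in>UNIV. ennreal (z e ^ (N e (T n (snd x) + U (snd x)) (fst x) - N e (T n (snd x)) (fst x))))"
    for x :: "'a \<times> 'a"
  have T_nonneg: "0 \<le> T k \<omega>" if "k \<le> n" "\<omega> \<in> space M" for k \<omega>
    using that(1) by (induction k) (use T that(2) in \<open>auto intro: order_trans\<close>)
  have mono: "sets (collect A) \<subseteq> sets (collect (A \<union> B))" "sets (collect B) \<subseteq> sets (collect (A \<union> B))"
    unfolding sets_collect by (intro sigma_sets_mono'; auto)+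
  then have up: "f \<in> measurable (collect A) L \<Longrightarrow> f \<in> measurable (collect (A \<union> B)) L"
      "f \<in> measurable (collect B) L \<Longrightarrow> f \<in> measurable (collect (A \<union> B)) L" for f and L :: "'z measure"
    by (auto simp: measurable_def)
  have diff: "(\<lambda>x. N e (S' (snd x)) (fst x) - N e (S (snd x)) (fst x)) \<in> measurable (?AR \<Otimes>\<^sub>M collect C) (count_space UNIV)"
    if "S \<in> borel_measurable (collect C)" "\<And>\<omega>. \<omega> \<in> space M \<Longrightarrow> 0 \<le> S \<omega>"
       "S' \<in> borel_measurable (collect C)" "\<And>\<omega>. \<omega> \<in> space M \<Longrightarrow> 0 \<le> S' \<omega>" for e S S' C
    by (intro measurable_diff_nat measurable_count_pair that)
  \<comment> \<open>Needed over both sigma-algebras: that of \<open>A \<union> B\<close> for the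
    first decoupling, that of \<open>A\<close> for the one that restores the history.\<close>
  have h_meas: "h \<in> borel_measurable (?AR \<Otimes>\<^sub>M collect C)" if "C = A \<or> C = A \<union> B" for C
  proof -
    have T': "T k \<in> borel_measurable (collect C)" if "k \<le> n" for k
      using \<open>C = A \<or> C = A \<union> B\<close> T(1)[OF that] up(1)[OF T(1)[OF that]] by auto
    show ?thesis
      unfolding h_def
      by (intro borel_measurable_of_bool_pred pred_all_less pred_all_finite pred_eq_const1[OF diff])
        (auto intro!: T' T_nonneg)
  qed
  have g_meas: "g \<in> borel_measurable (?AR \<Otimes>\<^sub>M collect (A \<union> B))"
    unfolding g_def
  proof (rule borel_measurable_prod_ennreal)
    fix e
    have "(\<lambda>x. N e (T n (snd x) + U (snd x)) (fst x) - N e (T n (snd x)) (fst x))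
        \<in> measurable (?AR \<Otimes>\<^sub>M collect (A \<union> B)) (count_space UNIV)"
    proof (rule diff)
      show "T n \<in> borel_measurable (collect (A \<union> B))" by (intro up(1) T(1) order_refl)
      moreover have "U \<in> borel_measurable (collect (A \<union> B))" by (intro up(2) U(1))
      ultimately show "(\<lambda>\<omega>. T n \<omega> + U \<omega>) \<in> borel_measurable (collect (A \<union> B))"
        by (rule borel_measurable_add)
    qed (auto intro!: T_nonneg U(2) add_nonneg_nonneg)
    then show "(\<lambda>x. ennreal (z e ^ (N e (T n (snd x) + U (snd x)) (fst x) - N e (T n (snd x)) (fst x))))
        \<in> borel_measurable (?AR \<Otimes>\<^sub>M collect (A \<union> B))"
      by (rule measurable_compose) simp
  qed
  have [measurable]: "R \<in> borel_measurable (collect (A \<union> B))" "Q \<in> borel_measurable (collect (A \<union> B))"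
    by (rule up(1)[OF R], rule up(2)[OF Q])
  have hg: "(\<integral>\<^sup>+\<omega>. h (\<omega>, \<omega>') * g (\<omega>, \<omega>') \<partial>M) = (\<integral>\<^sup>+\<omega>. h (\<omega>, \<omega>') \<partial>M) * ennreal (exp (- c * U \<omega>'))"
    if "\<omega>' \<in> space M" for \<omega>'
    unfolding h_def g_def c_def fst_conv snd_conv
    by (rule deterministic_history_increment) (use that T U z in auto)
  have h1: "(\<lambda>\<omega>. h (\<omega>, \<omega>')) \<in> borel_measurable M" if "\<omega>' \<in> space M" for \<omega>'
  proof -
    have "(\<lambda>\<omega>. h (\<omega>, \<omega>')) \<in> borel_measurable ?AR"
      by (rule measurable_compose[OF measurable_Pair2' h_meas[of A]]) (use that in auto)
    then show ?thesis by (rule measurable_collect)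
  qed
  have hg1: "(\<lambda>\<omega>. h (\<omega>, \<omega>') * g (\<omega>, \<omega>')) \<in> borel_measurable M" if "\<omega>' \<in> space M" for \<omega>'
  proof -
    have "(\<lambda>\<omega>. h (\<omega>, \<omega>') * g (\<omega>, \<omega>')) \<in> borel_measurable ?AR"
      by (intro borel_measurable_times_ennreal measurable_compose[OF measurable_Pair2' h_meas[of "A \<union> B"]]
          measurable_compose[OF measurable_Pair2' g_meas]) (use that in auto)
    then show ?thesis by (rule measurable_collect)
  qed
  have "(\<integral>\<^sup>+\<omega>. R \<omega> * of_bool (hist \<omega>) *
        (Q \<omega> * (\<Prod>e\<in>UNIV. ennreal (z e ^ (N e (T n \<omega> + U \<omega>) \<omega> - N e (T n \<omega>) \<omega>)))) \<partial>M)
      = (\<integral>\<^sup>+\<omega>. (\<lambda>x. (R (snd x) * Q (snd x)) * (h x * g x)) (\<omega>, \<omega>) \<partial>M)"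
    by (simp add: h_def g_def hist_def mult_ac)
  also have "\<dots> = (\<integral>\<^sup>+\<omega>'. \<integral>\<^sup>+\<omega>. (R \<omega>' * Q \<omega>') * (h (\<omega>, \<omega>') * g (\<omega>, \<omega>')) \<partial>M \<partial>M)"
  proof (subst decouple)
    show "range arr \<inter> (A \<union> B) = {}" using disj by auto
    show "(\<lambda>x. R (snd x) * Q (snd x) * (h x * g x)) \<in> borel_measurable (?AR \<Otimes>\<^sub>M collect (A \<union> B))"
      using h_meas[of "A \<union> B"] g_meas by measurable
  qed simp
  \<comment> \<open>For fixed \<omega>', the last increment contributes a factor that depends on
    \<omega>' through \<open>U\<close> only. The integrand is now a part determined by
    \<open>A\<close> times a part determined by \<open>B\<close>.\<close>
  also have "\<dots> = (\<integral>\<^sup>+\<omega>'. (R \<omega>' * (\<integral>\<^sup>+\<omega>. h (\<omega>, \<omega>') \<partial>M)) * (Q \<omega>' * ennreal (exp (- c * U \<omega>'))) \<partial>M)"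
  proof (rule nn_integral_cong)
    fix \<omega>' assume w: "\<omega>' \<in> space M"
    show "(\<integral>\<^sup>+\<omega>. (R \<omega>' * Q \<omega>') * (h (\<omega>, \<omega>') * g (\<omega>, \<omega>')) \<partial>M)
        = (R \<omega>' * (\<integral>\<^sup>+\<omega>. h (\<omega>, \<omega>') \<partial>M)) * (Q \<omega>' * ennreal (exp (- c * U \<omega>')))"
      unfolding nn_integral_cmult[OF hg1[OF w]] hg[OF w] by (simp add: mult_ac)
  qed
  also have "\<dots> = (\<integral>\<^sup>+\<omega>'. R \<omega>' * (\<integral>\<^sup>+\<omega>. h (\<omega>, \<omega>') \<partial>M) \<partial>M) * (\<integral>\<^sup>+\<omega>'. Q \<omega>' * ennreal (exp (- c * U \<omega>')) \<partial>M)"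
  proof (rule nn_integral_mult_indep[OF disj(1)])
    show "(\<lambda>\<omega>'. R \<omega>' * (\<integral>\<^sup>+\<omega>. h (\<omega>, \<omega>') \<partial>M)) \<in> borel_measurable (collect A)"
      using R borel_measurable_partial_nn_integral[OF h_meas[of A]] by simp
    show "(\<lambda>\<omega>'. Q \<omega>' * ennreal (exp (- c * U \<omega>'))) \<in> borel_measurable (collect B)"
      using Q U(1) by measurable
  qed
  \<comment> \<open>The inner integral is removed by decoupling in the reverse direction, now with
    the sources of \<open>A\<close> only.\<close>
  also have "(\<integral>\<^sup>+\<omega>'. R \<omega>' * (\<integral>\<^sup>+\<omega>. h (\<omega>, \<omega>') \<partial>M) \<partial>M) = (\<integral>\<^sup>+\<omega>'. \<integral>\<^sup>+\<omega>. R \<omega>' * h (\<omega>, \<omega>') \<partial>M \<partial>M)"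
    by (intro nn_integral_cong) (simp add: nn_integral_cmult h1)
  also have "\<dots> = (\<integral>\<^sup>+\<omega>. (\<lambda>x. R (snd x) * h x) (\<omega>, \<omega>) \<partial>M)"
  proof (subst decouple)
    show "range arr \<inter> A = {}" using disj by auto
    show "(\<lambda>x. R (snd x) * h x) \<in> borel_measurable (?AR \<Otimes>\<^sub>M collect A)"
      using h_meas[of A] R by measurable
  qed simp
  also have "\<dots> = (\<integral>\<^sup>+\<omega>. R \<omega> * of_bool (hist \<omega>) \<partial>M)"
    by (simp add: h_def hist_def)
  finally show ?thesis unfolding c_def .
qed

end

section \<open>The busy period\<close>

context mg1_queue
begin

definition departure :: "nat \<Rightarrow> 'a \<Rightarrow> real" where
  "departure n \<omega> = (\<Sum>k<n. B k \<omega>)"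

definition busy :: "nat \<Rightarrow> 'a \<Rightarrow> bool" where
  "busy n \<omega> \<longleftrightarrow> (\<forall>k\<le>n. N (departure k \<omega>) \<omega> + 1 \<noteq> k)"

definition idle_at :: "nat \<Rightarrow> 'a \<Rightarrow> bool" where
  "idle_at n \<omega> \<longleftrightarrow> (\<forall>k<n. N (departure k \<omega>) \<omega> + 1 \<noteq> k) \<and> N (departure n \<omega>) \<omega> + 1 = n"

definition increment :: "nat \<Rightarrow> 'a \<Rightarrow> nat" where
  "increment k \<omega> = N (departure (Suc k) \<omega>) \<omega> - N (departure k \<omega>) \<omega>"

text \<open>The single arrival process is the case of one customer type, \<open>unit\<close>, so
  that the M/G/1 queue and the polling system share the lemma on histories.\<close>

sublocale sources: poisson_sources M
  "\<lambda>i. case i of None \<Rightarrow> process_events M N | Some k \<Rightarrow> variable_events M borel (B k)"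
  "\<lambda>_::unit. rate" "\<lambda>_. N" "\<lambda>_. None"
proof (intro poisson_sources.intro independent_sources.intro independent_sources_axioms.intro
    poisson_sources_axioms.intro)
  show "sigma_algebra (space M) (case i of None \<Rightarrow> process_events M N | Some k \<Rightarrow> variable_events M borel (B k))" for i
    by (auto split: option.split intro: sigma_algebra_process_events
        sigma_algebra_variable_events[OF service_measurable])
qed (use independent poisson_process_axioms prob_space_axioms in \<open>auto simp: inj_on_def\<close>)

lemma departure_nonneg: "\<omega> \<in> space M \<Longrightarrow> 0 \<le> departure n \<omega>"
  unfolding departure_def by (intro sum_nonneg service_nonneg)

lemma departure_0: "departure 0 \<omega> = 0"
  by (simp add: departure_def)

lemma departure_Suc: "departure (Suc n) \<omega> = departure n \<omega> + B n \<omega>"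
  by (simp add: departure_def)

lemma service_measurable_collect:
  "Some k \<in> A \<Longrightarrow> B k \<in> borel_measurable (sources.collect A)"
  by (rule sources.measurable_collectI[of "Some k"])
    (use service_measurable in \<open>auto simp: variable_events_def\<close>)

lemma departure_measurable: "departure n \<in> borel_measurable M"
  unfolding departure_def by (intro borel_measurable_sum service_measurable)

lemma count_at_departure_measurable: "(\<lambda>\<omega>. N (departure n \<omega>) \<omega>) \<in> measurable M (count_space UNIV)"
  by (rule sources.measurable_count_random[OF departure_measurable departure_nonneg])

lemma count_departure_mono: "\<omega> \<in> space M \<Longrightarrow> N (departure n \<omega>) \<omega> \<le> N (departure (Suc n) \<omega>) \<omega>"
  by (intro mono departure_nonneg) (auto simp: departure_Suc service_nonneg)

lemma increment_measurable: "increment k \<in> measurable M (count_space UNIV)"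
  unfolding increment_def by (intro measurable_diff_nat count_at_departure_measurable)

lemma count_eq_sum_increments:
  "\<omega> \<in> space M \<Longrightarrow> N (departure n \<omega>) \<omega> = (\<Sum>k<n. increment k \<omega>)"
proof (induction n)
  case 0
  then show ?case by (simp add: departure_0 start)
next
  case (Suc n)
  then show ?case using count_departure_mono[OF Suc.prems, of n] by (simp add: increment_def)
qed

text \<open>By induction, at least one customer is left behind at each departure. It makes the
  truncated difference in \<open>alive_weight\<close> a true one.\<close>

lemma busy_count: "\<omega> \<in> space M \<Longrightarrow> busy n \<omega> \<Longrightarrow> n \<le> N (departure n \<omega>) \<omega>"
proof (induction n)
  case (Suc n)
  then have "n \<le> N (departure n \<omega>) \<omega>" by (auto simp: busy_def)
  then have "n \<le> N (departure (Suc n) \<omega>) \<omega>" using count_departure_mono[OF Suc.prems(1), of n] by simp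
  moreover have "N (departure (Suc n) \<omega>) \<omega> + 1 \<noteq> Suc n" using Suc.prems(2) by (auto simp: busy_def)
  ultimately show ?case by simp
qed simp

lemma busy_0: "busy 0 \<omega>"
  by (simp add: busy_def)

lemma busy_split: "of_bool (busy n \<omega>) = (of_bool (busy (Suc n) \<omega>) + of_bool (idle_at (Suc n) \<omega>) :: ennreal)"
  by (auto simp: busy_def idle_at_def le_Suc_eq less_Suc_eq_le)

lemma busy_measurable: "Measurable.pred M (busy n)"
proof -
  have "Measurable.pred M (\<lambda>\<omega>. \<forall>k<Suc n. \<not> (N (departure k \<omega>) \<omega> = k - 1 \<and> 0 < k))"
    by (intro pred_all_less pred_intros_logic pred_eq_const1[OF count_at_departure_measurable]) auto
  also have "(\<lambda>\<omega>. \<forall>k<Suc n. \<not> (N (departure k \<omega>) \<omega> = k - 1 \<and> 0 < k)) = busy n"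
    unfolding busy_def less_Suc_eq_le by (intro ext all_cong1) auto
  finally show ?thesis .
qed

lemma idle_at_measurable: "Measurable.pred M (idle_at n)"
proof (cases n)
  case 0
  then have "idle_at n = (\<lambda>_. False)" by (auto simp: idle_at_def)
  then show ?thesis by simp
next
  case (Suc m)
  have "Measurable.pred M (\<lambda>\<omega>. busy m \<omega> \<and> N (departure n \<omega>) \<omega> = m)"
    by (intro pred_intros_logic busy_measurable pred_eq_const1[OF count_at_departure_measurable]) auto
  also have "(\<lambda>\<omega>. busy m \<omega> \<and> N (departure n \<omega>) \<omega> = m) = idle_at n"
    using Suc by (auto simp: fun_eq_iff busy_def idle_at_def less_Suc_eq_le)
  finally show ?thesis .
qed

lemma weight_measurable:
  assumes "Measurable.pred M P"
  shows "(\<lambda>\<omega>. of_bool (P \<omega>) * ennreal (exp (c * departure m \<omega>) * y ^ (N (departure k \<omega>) \<omega> - l)))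
    \<in> borel_measurable M"
proof -
  have [measurable]: "(\<lambda>\<omega>. of_bool (P \<omega>) :: ennreal) \<in> borel_measurable M"
    by (rule borel_measurable_of_bool_pred[OF assms])
  have [measurable]: "(\<lambda>\<omega>. y ^ (N (departure k \<omega>) \<omega> - l)) \<in> borel_measurable M"
    by (rule measurable_compose[OF count_at_departure_measurable]) simp
  have [measurable]: "departure m \<in> borel_measurable M" by (rule departure_measurable)
  show ?thesis by measurable
qed

text \<open>The exponent is one less than the number of customers left behind. So the value at
  \<open>n = 0\<close> is 1, and \<open>y\<close> times this weight is the part of the martingale
  that lives on busy sample points.\<close>

definition alive_weight :: "real \<Rightarrow> real \<Rightarrow> nat \<Rightarrow> ennreal" where
  "alive_weight s y n = (\<integral>\<^sup>+\<omega>. of_bool (busy n \<omega>) *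
    ennreal (exp (- s * departure n \<omega>) * y ^ (N (departure n \<omega>) \<omega> - n)) \<partial>M)"

text \<open>The part of the LST of the busy period that is due to busy periods with exactly
  \<open>n\<close> customers.\<close>

definition idle_weight :: "real \<Rightarrow> nat \<Rightarrow> ennreal" where
  "idle_weight s n = (\<integral>\<^sup>+\<omega>. of_bool (idle_at n \<omega>) * ennreal (exp (- s * departure n \<omega>)) \<partial>M)"

lemma service_law_nonneg:
  assumes "integrable D (\<lambda>x. x)"
  shows "nonneg_law D"
proof -
  have "prob_space D" using prob_space_distr[OF service_measurable[of 0]] by (simp add: service_law)
  moreover have "sets D = sets borel" using service_law[of 0] by auto
  moreover have "AE x in D. 0 \<le> x"
    using service_nonneg[of _ 0] service_measurable[of 0]
    by (subst service_law[of 0, symmetric], subst AE_distr_iff) auto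
  ultimately show ?thesis
    using assms by (simp add: nonneg_law_def real_distribution_def real_distribution_axioms_def)
qed

lemma nn_integral_service_exp:
  assumes "integrable D (\<lambda>x. x)" "0 \<le> s"
  shows "(\<integral>\<^sup>+\<omega>. ennreal (exp (- s * B k \<omega>)) \<partial>M) = ennreal (lst D s)"
proof -
  have "(\<integral>\<^sup>+\<omega>. ennreal (exp (- s * B k \<omega>)) \<partial>M) = (\<integral>\<^sup>+x. ennreal (exp (- s * x)) \<partial>distr M borel (B k))"
    using service_measurable by (subst nn_integral_distr) auto
  then show ?thesis
    using nn_integral_exp_eq_lst[OF service_law_nonneg[OF assms(1)] assms(2)] by (simp add: service_law)
qed

text \<open>The integral is decomposed according to the numbers of arrivals during the first
  \<open>n\<close> services. On one piece the number present is a constant, and the next service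
  with its arrivals is independent of the past; its factor is the LST of the service time at
  discount rate \<open>s + rate * (1 - y)\<close>.\<close>

lemma alive_weight_step_aux:
  assumes D: "integrable D (\<lambda>x. x)" and s: "0 \<le> s" and y: "0 \<le> y" "y \<le> 1"
  shows "(\<integral>\<^sup>+\<omega>. of_bool (busy n \<omega>) *
      ennreal (exp (- s * departure (Suc n) \<omega>) * y ^ (N (departure (Suc n) \<omega>) \<omega> - n)) \<partial>M)
    = ennreal (lst D (s + rate * (1 - y))) * alive_weight s y n"
proof -
  define hist where "hist \<omega> = map (\<lambda>k. increment k \<omega>) [0..<n]" for \<omega>
  define f where "f \<omega> = of_bool (busy n \<omega>) *
      ennreal (exp (- s * departure (Suc n) \<omega>) * y ^ (N (departure (Suc n) \<omega>) \<omega> - n))" for \<omega>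
  define g where "g \<omega> = of_bool (busy n \<omega>) *
      ennreal (exp (- s * departure n \<omega>) * y ^ (N (departure n \<omega>) \<omega> - n))" for \<omega>
  let ?\<kappa> = "ennreal (lst D (s + rate * (1 - y)))"
  have [measurable]: "f \<in> borel_measurable M" "g \<in> borel_measurable M"
    unfolding f_def g_def by (intro weight_measurable busy_measurable)+
  have hist: "hist \<in> measurable M (count_space UNIV)"
    unfolding hist_def by (intro measurable_list_of_nats increment_measurable)
  have "(\<integral>\<^sup>+\<omega>. f \<omega> \<partial>M) = (\<integral>\<^sup>+\<omega>. ?\<kappa> * g \<omega> \<partial>M)"
  proof (rule nn_integral_partition_cong[OF hist])
    fix a :: "nat list"
    show "(\<integral>\<^sup>+\<omega>. f \<omega> * of_bool (hist \<omega> = a) \<partial>M) = (\<integral>\<^sup>+\<omega>. ?\<kappa> * g \<omega> * of_bool (hist \<omega> = a) \<partial>M)"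
    proof (cases "\<exists>\<omega>\<in>space M. hist \<omega> = a \<and> busy n \<omega>")
      case False
      then have "(\<integral>\<^sup>+\<omega>. f \<omega> * of_bool (hist \<omega> = a) \<partial>M) = (\<integral>\<^sup>+\<omega>. 0 \<partial>M)"
          "(\<integral>\<^sup>+\<omega>. ?\<kappa> * g \<omega> * of_bool (hist \<omega> = a) \<partial>M) = (\<integral>\<^sup>+\<omega>. 0 \<partial>M)"
        by (intro nn_integral_cong; auto simp: f_def g_def)+
      then show ?thesis by simp
    next
      case True
      \<comment> \<open>Being busy depends on the sample point through the history of increments
        only, so one witness decides for the whole piece.\<close>
      then obtain \<omega>0 where \<omega>0: "\<omega>0 \<in> space M" "hist \<omega>0 = a" "busy n \<omega>0" by blast
      have len: "length a = n" using \<omega>0 by (auto simp: hist_def)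
      have hist_iff: "hist \<omega> = a \<longleftrightarrow> (\<forall>k<n. \<forall>e::unit. increment k \<omega> = a ! k)" for \<omega>
        using len by (auto simp: hist_def list_eq_iff_nth_eq)
      have count: "N (departure k \<omega>) \<omega> = (\<Sum>j<k. a ! j)" if "\<omega> \<in> space M" "hist \<omega> = a" "k \<le> n" for k \<omega>
        using that by (auto simp: count_eq_sum_increments hist_iff intro!: sum.cong)
      have busy: "busy n \<omega>" if "\<omega> \<in> space M" "hist \<omega> = a" for \<omega>
        using \<omega>0 that by (auto simp: busy_def count)
      define m where "m = (\<Sum>j<n. a ! j) - n"
      have le: "n \<le> (\<Sum>j<n. a ! j)" using busy_count[OF \<omega>0(1,3)] \<omega>0 by (simp add: count)
      have f_eq: "f \<omega> * of_bool (hist \<omega> = a) = ennreal (y ^ m) *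
          (ennreal (exp (- s * departure n \<omega>)) *
            of_bool (\<forall>k<n. \<forall>e::unit. N (departure (Suc k) \<omega>) \<omega> - N (departure k \<omega>) \<omega> = a ! k) *
           (ennreal (exp (- s * B n \<omega>)) *
            (\<Prod>e\<in>(UNIV::unit set). ennreal (y ^ (N (departure n \<omega> + B n \<omega>) \<omega> - N (departure n \<omega>) \<omega>)))))"
        if w: "\<omega> \<in> space M" for \<omega>
      proof (cases "hist \<omega> = a")
        case True
        have "N (departure (Suc n) \<omega>) \<omega> - n = m + (N (departure (Suc n) \<omega>) \<omega> - N (departure n \<omega>) \<omega>)"
          using count_departure_mono[OF w, of n] count[OF w True order_refl] le by (simp add: m_def)
        moreover have "exp (- s * departure (Suc n) \<omega>) = exp (- s * departure n \<omega>) * exp (- s * B n \<omega>)"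
          by (simp add: departure_Suc algebra_simps flip: exp_add)
        ultimately have "ennreal (exp (- s * departure (Suc n) \<omega>) * y ^ (N (departure (Suc n) \<omega>) \<omega> - n))
            = ennreal (y ^ m * (exp (- s * departure n \<omega>) *
                (exp (- s * B n \<omega>) * y ^ (N (departure (Suc n) \<omega>) \<omega> - N (departure n \<omega>) \<omega>))))"
          by (simp add: power_add mult_ac)
        then show ?thesis
          using True busy[OF w True] y
          by (simp add: f_def hist_iff increment_def departure_Suc ennreal_mult)
      next
        case False
        then have "\<not> (\<forall>k<n. \<forall>e::unit. N (departure (Suc k) \<omega>) \<omega> - N (departure k \<omega>) \<omega> = a ! k)"
          by (simp add: hist_iff increment_def)
        with False show ?thesis by (simp only: of_bool_eq mult_zero_left mult_zero_right)
      qed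
      have g_eq: "?\<kappa> * g \<omega> * of_bool (hist \<omega> = a) = ?\<kappa> * (ennreal (y ^ m) *
          (ennreal (exp (- s * departure n \<omega>)) *
            of_bool (\<forall>k<n. \<forall>e::unit. N (departure (Suc k) \<omega>) \<omega> - N (departure k \<omega>) \<omega> = a ! k)))"
        if w: "\<omega> \<in> space M" for \<omega>
      proof (cases "hist \<omega> = a")
        case True
        have "ennreal (exp (- s * departure n \<omega>) * y ^ (N (departure n \<omega>) \<omega> - n))
            = ennreal (y ^ m) * ennreal (exp (- s * departure n \<omega>))"
          using count[OF w True order_refl] y by (simp add: m_def mult.commute flip: ennreal_mult)
        then show ?thesis
          using True busy[OF w True] by (simp add: g_def hist_iff increment_def)
      next
        case False
        then have "\<not> (\<forall>k<n. \<forall>e::unit. N (departure (Suc k) \<omega>) \<omega> - N (departure k \<omega>) \<omega> = a ! k)"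
          by (simp add: hist_iff increment_def)
        with False show ?thesis by (simp only: of_bool_eq mult_zero_left mult_zero_right)
      qed
      let ?h = "\<lambda>\<omega>. ennreal (exp (- s * departure n \<omega>)) *
            of_bool (\<forall>k<n. \<forall>e::unit. N (departure (Suc k) \<omega>) \<omega> - N (departure k \<omega>) \<omega> = a ! k)"
      let ?j = "\<lambda>\<omega>. ennreal (exp (- s * B n \<omega>)) *
            (\<Prod>e\<in>(UNIV::unit set). ennreal (y ^ (N (departure n \<omega> + B n \<omega>) \<omega> - N (departure n \<omega>) \<omega>)))"
      have hist_pred: "Measurable.pred M (\<lambda>\<omega>. \<forall>k<n. \<forall>e::unit. N (departure (Suc k) \<omega>) \<omega> - N (departure k \<omega>) \<omega> = a ! k)"
      proof (rule pred_all_less, rule pred_all_finite)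
        fix k
        show "Measurable.pred M (\<lambda>\<omega>. N (departure (Suc k) \<omega>) \<omega> - N (departure k \<omega>) \<omega> = a ! k)"
          by (rule pred_eq_const1[OF increment_measurable[unfolded increment_def]]) simp
      qed
      have h_meas: "?h \<in> borel_measurable M"
        by (rule borel_measurable_times_ennreal[OF borel_measurable_exp_cmult[OF departure_measurable]
              borel_measurable_of_bool_pred[OF hist_pred]])
      have j_meas: "?j \<in> borel_measurable M"
      proof (rule borel_measurable_times_ennreal[OF borel_measurable_exp_cmult[OF service_measurable]
            borel_measurable_prod_ennreal])
        have "(\<lambda>\<omega>. ennreal (y ^ increment n \<omega>)) \<in> borel_measurable M"
          by (rule measurable_compose[OF increment_measurable]) simp
        then show "(\<lambda>\<omega>. ennreal (y ^ (N (departure n \<omega> + B n \<omega>) \<omega> - N (departure n \<omega>) \<omega>))) \<in> borel_measurable M"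
          unfolding increment_def departure_Suc .
      qed
      have KL: "(\<integral>\<^sup>+\<omega>. ?h \<omega> * ?j \<omega> \<partial>M) = (\<integral>\<^sup>+\<omega>. ?h \<omega> \<partial>M) *
          (\<integral>\<^sup>+\<omega>. ennreal (exp (- s * B n \<omega>)) *
            ennreal (exp (- (\<Sum>e\<in>(UNIV::unit set). rate * (1 - y)) * B n \<omega>)) \<partial>M)"
      proof (rule sources.random_history_increment[where A = "Some ` {..<n}" and B = "{Some n}"
              and T = departure and U = "B n" and z = "\<lambda>_. y" and a = "\<lambda>k _. a ! k"])
        show "departure k \<in> borel_measurable (sources.collect (Some ` {..<n}))" if "k \<le> n" for k
          unfolding departure_def
          by (intro borel_measurable_sum service_measurable_collect) (use that in auto)
        then show "(\<lambda>\<omega>. ennreal (exp (- s * departure n \<omega>))) \<in> borel_measurable (sources.collect (Some ` {..<n}))"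
          by (intro borel_measurable_exp_cmult) auto
        show "B n \<in> borel_measurable (sources.collect {Some n})"
          by (rule service_measurable_collect) simp
        then show "(\<lambda>\<omega>. ennreal (exp (- s * B n \<omega>))) \<in> borel_measurable (sources.collect {Some n})"
          by (intro borel_measurable_exp_cmult) auto
      qed (use y in \<open>auto simp: departure_nonneg departure_Suc service_nonneg\<close>)
      also have "(\<integral>\<^sup>+\<omega>. ennreal (exp (- s * B n \<omega>)) *
            ennreal (exp (- (\<Sum>e\<in>(UNIV::unit set). rate * (1 - y)) * B n \<omega>)) \<partial>M)
          = (\<integral>\<^sup>+\<omega>. ennreal (exp (- (s + rate * (1 - y)) * B n \<omega>)) \<partial>M)"
        by (intro nn_integral_cong) (simp add: algebra_simps flip: ennreal_mult exp_add)
      also have "\<dots> = ?\<kappa>"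
        using y s rate_pos by (intro nn_integral_service_exp[OF D]) auto
      finally have KL': "(\<integral>\<^sup>+\<omega>. ?h \<omega> * ?j \<omega> \<partial>M) = (\<integral>\<^sup>+\<omega>. ?h \<omega> \<partial>M) * ?\<kappa>" .
      have "(\<integral>\<^sup>+\<omega>. f \<omega> * of_bool (hist \<omega> = a) \<partial>M) = (\<integral>\<^sup>+\<omega>. ennreal (y ^ m) * (?h \<omega> * ?j \<omega>) \<partial>M)"
        by (intro nn_integral_cong f_eq)
      also have "\<dots> = ennreal (y ^ m) * (\<integral>\<^sup>+\<omega>. ?h \<omega> * ?j \<omega> \<partial>M)"
        by (intro nn_integral_cmult borel_measurable_times_ennreal h_meas j_meas)
      also have "\<dots> = ?\<kappa> * (ennreal (y ^ m) * (\<integral>\<^sup>+\<omega>. ?h \<omega> \<partial>M))"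
        unfolding KL' by (simp add: mult_ac)
      also have "\<dots> = (\<integral>\<^sup>+\<omega>. ?\<kappa> * (ennreal (y ^ m) * ?h \<omega>) \<partial>M)"
        unfolding nn_integral_cmult[OF h_meas, symmetric]
        by (rule nn_integral_cmult[symmetric])
          (intro borel_measurable_times_ennreal h_meas borel_measurable_const)
      also have "\<dots> = (\<integral>\<^sup>+\<omega>. ?\<kappa> * g \<omega> * of_bool (hist \<omega> = a) \<partial>M)"
        by (intro nn_integral_cong g_eq[symmetric])
      finally show ?thesis .
    qed
  qed measurable
  also have "\<dots> = ?\<kappa> * (\<integral>\<^sup>+\<omega>. g \<omega> \<partial>M)" by (rule nn_integral_cmult) measurable
  finally show ?thesis unfolding f_def g_def alive_weight_def .
qed

text \<open>After departure \<open>Suc n\<close> the server is either still busy, where the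
  departure lowers the exponent by one and frees a factor \<open>y\<close>, or idle, where the
  exponent is already 0.\<close>

lemma alive_weight_step:
  assumes D: "integrable D (\<lambda>x. x)" and s: "0 \<le> s" and y: "0 \<le> y" "y \<le> 1"
  shows "ennreal y * alive_weight s y (Suc n) + idle_weight s (Suc n)
    = ennreal (lst D (s + rate * (1 - y))) * alive_weight s y n"
proof -
  have eq: "of_bool (busy n \<omega>) *
      ennreal (exp (- s * departure (Suc n) \<omega>) * y ^ (N (departure (Suc n) \<omega>) \<omega> - n))
    = ennreal y * (of_bool (busy (Suc n) \<omega>) *
        ennreal (exp (- s * departure (Suc n) \<omega>) * y ^ (N (departure (Suc n) \<omega>) \<omega> - Suc n)))
      + of_bool (idle_at (Suc n) \<omega>) * ennreal (exp (- s * departure (Suc n) \<omega>))"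
    if w: "\<omega> \<in> space M" for \<omega>
  proof -
    have "y ^ (N (departure (Suc n) \<omega>) \<omega> - n) = y * y ^ (N (departure (Suc n) \<omega>) \<omega> - Suc n)"
      if "busy (Suc n) \<omega>"
      using busy_count[OF w that] by (simp add: Suc_diff_Suc flip: power_Suc)
    moreover have "y ^ (N (departure (Suc n) \<omega>) \<omega> - n) = 1" if "idle_at (Suc n) \<omega>"
      using that by (simp add: idle_at_def)
    moreover have "\<not> (busy (Suc n) \<omega> \<and> idle_at (Suc n) \<omega>)" by (auto simp: busy_def idle_at_def)
    ultimately show ?thesis
      using busy_split[of n \<omega>] y
      by (auto simp: algebra_simps simp flip: ennreal_mult split: if_splits)
  qed
  have "ennreal (lst D (s + rate * (1 - y))) * alive_weight s y n
      = (\<integral>\<^sup>+\<omega>. ennreal y * (of_bool (busy (Suc n) \<omega>) *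
        ennreal (exp (- s * departure (Suc n) \<omega>) * y ^ (N (departure (Suc n) \<omega>) \<omega> - Suc n)))
      + of_bool (idle_at (Suc n) \<omega>) * ennreal (exp (- s * departure (Suc n) \<omega>)) \<partial>M)"
    unfolding alive_weight_step_aux[OF assms, symmetric] by (intro nn_integral_cong eq)
  also have "\<dots> = ennreal y * alive_weight s y (Suc n) + idle_weight s (Suc n)"
    unfolding alive_weight_def idle_weight_def
    using weight_measurable[OF busy_measurable, of "Suc n" "- s" "Suc n" y "Suc n" "Suc n"]
      weight_measurable[OF idle_at_measurable, of "Suc n" "- s" "Suc n" 1 "Suc n" "Suc n"]
    by (simp add: nn_integral_add nn_integral_cmult)
  finally show ?thesis by simp
qed

lemma alive_weight_0: "alive_weight s y 0 = 1"
proof -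
  have "alive_weight s y 0 = (\<integral>\<^sup>+\<omega>. 1 \<partial>M)"
    unfolding alive_weight_def by (intro nn_integral_cong) (simp add: busy_0 departure_0 start)
  then show ?thesis by (simp add: emeasure_space_1)
qed

lemma idle_weight_0: "idle_weight s 0 = 0"
  by (simp add: idle_weight_def idle_at_def)

lemma idle_at_unique: "idle_at m \<omega> \<Longrightarrow> idle_at n \<omega> \<Longrightarrow> m = n"
  unfolding idle_at_def by (metis linorder_neqE_nat)

lemma busy_period_eq: "idle_at k \<omega> \<Longrightarrow> busy_period N B \<omega> = departure k \<omega>"
proof -
  assume k: "idle_at k \<omega>"
  have "(LEAST n. N (departure n \<omega>) \<omega> + 1 = n) = k"
    by (rule Least_equality) (use k in \<open>auto simp: idle_at_def not_le[symmetric]\<close>)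
  then show ?thesis by (simp add: busy_period_def departure_def)
qed

lemma idle_weight_measurable:
  "(\<lambda>\<omega>. of_bool (idle_at k \<omega>) * ennreal (exp (- s * departure k \<omega>))) \<in> borel_measurable M"
  by (intro borel_measurable_times_ennreal borel_measurable_of_bool_pred idle_at_measurable
      borel_measurable_exp_cmult departure_measurable)

lemma suminf_idle_weight:
  "(\<Sum>k. idle_weight s k) = (\<integral>\<^sup>+\<omega>. of_bool (\<exists>k. idle_at k \<omega>) * ennreal (exp (- s * busy_period N B \<omega>)) \<partial>M)"
proof -
  have "(\<Sum>k. idle_weight s k) = (\<integral>\<^sup>+\<omega>. (\<Sum>k. of_bool (idle_at k \<omega>) * ennreal (exp (- s * departure k \<omega>))) \<partial>M)"
    unfolding idle_weight_def by (rule nn_integral_suminf[symmetric]) (rule idle_weight_measurable)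
  also have "\<dots> = (\<integral>\<^sup>+\<omega>. of_bool (\<exists>k. idle_at k \<omega>) * ennreal (exp (- s * busy_period N B \<omega>)) \<partial>M)"
  proof (rule nn_integral_cong)
    fix \<omega>
    show "(\<Sum>k. of_bool (idle_at k \<omega>) * ennreal (exp (- s * departure k \<omega>)))
        = of_bool (\<exists>k. idle_at k \<omega>) * ennreal (exp (- s * busy_period N B \<omega>))"
    proof (cases "\<exists>k. idle_at k \<omega>")
      case True
      then obtain n where n: "idle_at n \<omega>" by blast
      have "(\<Sum>k. of_bool (idle_at k \<omega>) * ennreal (exp (- s * departure k \<omega>)))
          = ennreal (exp (- s * departure n \<omega>))"
        by (rule suminf_of_bool_unique[where P = "\<lambda>k. idle_at k \<omega>", OF idle_at_unique n])
      then show ?thesis using True busy_period_eq[OF n] by simp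
    qed simp
  qed
  finally show ?thesis .
qed

lemma alive_weight_le_prob_busy:
  assumes "0 \<le> s" "0 \<le> y" "y \<le> 1"
  shows "alive_weight s y n \<le> (\<integral>\<^sup>+\<omega>. of_bool (busy n \<omega>) \<partial>M)"
  unfolding alive_weight_def
proof (rule nn_integral_mono)
  fix \<omega> assume "\<omega> \<in> space M"
  then have "exp (- s * departure n \<omega>) * y ^ (N (departure n \<omega>) \<omega> - n) \<le> 1"
    using assms departure_nonneg[of \<omega> n] by (intro mult_le_one power_le_one) auto
  then show "of_bool (busy n \<omega>) * ennreal (exp (- s * departure n \<omega>) * y ^ (N (departure n \<omega>) \<omega> - n))
      \<le> of_bool (busy n \<omega>)"
    by (cases "busy n \<omega>") (auto simp: ennreal_le_1)
qed

lemma sum_idle_weight_le_1: "(\<Sum>k<n. idle_weight 0 k) \<le> 1"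
proof -
  have "(\<Sum>k<n. idle_weight 0 k) \<le> (\<Sum>k. idle_weight 0 k)"
    by (rule sum_le_suminf) auto
  also have "\<dots> \<le> (\<integral>\<^sup>+\<omega>. 1 \<partial>M)"
    unfolding suminf_idle_weight by (intro nn_integral_mono) auto
  finally show ?thesis by (simp add: emeasure_space_1)
qed

text \<open>For \<open>0 < y < 1\<close> and without discounting, the weight has a strictly positive
  drift while it is bounded by 1. So the weight of busy sample points is summable over the
  departures and vanishes, and the busy period ends with probability at least
  \<open>y\<close>.\<close>

lemma AE_busy_period_ends:
  assumes D: "integrable D (\<lambda>x. x)" and load: "rate * mean D < 1"
  shows "AE \<omega> in M. \<exists>k. idle_at k \<omega>"
proof -
  have "1 \<le> (\<Sum>k. idle_weight 0 k)"
  proof (rule one_le_if_all_less_one_le)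
    fix y :: real assume y: "0 < y" "y < 1"
    \<comment> \<open>The gap between the LST and \<open>y\<close> that the first-moment bound
      guarantees; it is positive because the load is below 1.\<close>
    define \<eta> where "\<eta> = (1 - rate * mean D) * (1 - y)"
    have \<eta>: "0 < \<eta>" using load y by (simp add: \<eta>_def)
    have \<kappa>: "y + \<eta> \<le> lst D (rate * (1 - y))"
      using lst_ge_linear[OF service_law_nonneg[OF D], of "rate * (1 - y)"] rate_pos y
      by (simp add: \<eta>_def algebra_simps)
    let ?p = "alive_weight 0 y" and ?e = "idle_weight 0"
    have step: "ennreal (y + \<eta>) * ?p n \<le> ennreal y * ?p (Suc n) + ?e (Suc n)" for n
      using alive_weight_step[OF D, of 0 y n] y \<kappa>
      by (auto intro!: mult_right_mono ennreal_leI)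
    \<comment> \<open>The drift inequality, telescoped: each departure that leaves the server busy
      gains \<eta> times the current weight.\<close>
    have main: "ennreal y + ennreal \<eta> * (\<Sum>k<n. ?p k) \<le> ennreal y * ?p n + (\<Sum>k<Suc n. ?e k)" for n
    proof (induction n)
      case 0
      then show ?case by (simp add: alive_weight_0)
    next
      case (Suc n)
      have "ennreal y + ennreal \<eta> * (\<Sum>k<Suc n. ?p k)
          = (ennreal y + ennreal \<eta> * (\<Sum>k<n. ?p k)) + ennreal \<eta> * ?p n"
        by (simp add: algebra_simps)
      also have "\<dots> \<le> (ennreal y * ?p n + (\<Sum>k<Suc n. ?e k)) + ennreal \<eta> * ?p n"
        by (intro add_right_mono Suc)
      also have "\<dots> = ennreal (y + \<eta>) * ?p n + (\<Sum>k<Suc n. ?e k)"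
        using y \<eta> by (simp add: algebra_simps)
      also have "\<dots> \<le> (ennreal y * ?p (Suc n) + ?e (Suc n)) + (\<Sum>k<Suc n. ?e k)"
        by (intro add_right_mono step)
      finally show ?case by (simp add: algebra_simps)
    qed
    have p_le: "?p n \<le> 1" for n
    proof -
      have "?p n \<le> (\<integral>\<^sup>+\<omega>. of_bool (busy n \<omega>) \<partial>M)" using y by (intro alive_weight_le_prob_busy) auto
      also have "\<dots> \<le> (\<integral>\<^sup>+\<omega>. 1 \<partial>M)" by (intro nn_integral_mono) auto
      finally show ?thesis by (simp add: emeasure_space_1)
    qed
    \<comment> \<open>The right-hand side of \<open>main\<close> is at most 2, uniformly in
      \<open>n\<close>.\<close>
    have "(\<Sum>k<n. ?p k) \<le> ennreal (2 / \<eta>)" for n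
    proof -
      have "ennreal \<eta> * (\<Sum>k<n. ?p k) \<le> ennreal y + ennreal \<eta> * (\<Sum>k<n. ?p k)" by simp
      also have "\<dots> \<le> ennreal y * ?p n + (\<Sum>k<Suc n. ?e k)" by (rule main)
      also have "\<dots> \<le> 1 * 1 + 1"
        using y p_le[of n] sum_idle_weight_le_1[of "Suc n"] by (intro add_mono mult_mono) (auto simp: ennreal_le_1)
      finally have "ennreal \<eta> * (\<Sum>k<n. ?p k) \<le> ennreal 2" by simp
      then have "ennreal (1 / \<eta>) * (ennreal \<eta> * (\<Sum>k<n. ?p k)) \<le> ennreal (1 / \<eta>) * ennreal 2"
        by (intro mult_left_mono) auto
      then show ?thesis using \<eta> by (simp add: mult.assoc[symmetric] ennreal_mult[symmetric] del: ennreal_numeral)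
    qed
    then have "(\<Sum>k. ?p k) \<le> ennreal (2 / \<eta>)"
      by (intro suminf_le_const) auto
    then have "(\<Sum>k. ?p k) < top" by (simp add: le_less_trans)
    then have "?p \<longlonglongrightarrow> 0" by (rule ennreal_summable_tendsto_0)
    then have "(\<lambda>n. ennreal y * ?p n + (\<Sum>k<Suc n. ?e k)) \<longlonglongrightarrow> ennreal y * 0 + (\<Sum>k. ?e k)"
      by (intro tendsto_add ennreal_tendsto_cmult LIMSEQ_Suc[OF summable_LIMSEQ]) auto
    moreover have "ennreal y \<le> ennreal y * ?p n + (\<Sum>k<Suc n. ?e k)" for n
      using main[of n] by (rule order_trans[rotated]) simp
    ultimately show "ennreal y \<le> (\<Sum>k. ?e k)"
      by (intro LIMSEQ_le_const[of _ "ennreal y * 0 + (\<Sum>k. ?e k)", simplified]) auto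
  qed
  also have "(\<Sum>k. idle_weight 0 k) = (\<integral>\<^sup>+\<omega>. of_bool (\<exists>k. idle_at k \<omega>) \<partial>M)"
    unfolding suminf_idle_weight by (intro nn_integral_cong) simp
  also have "\<dots> = emeasure M {\<omega> \<in> space M. \<exists>k. idle_at k \<omega>}"
  proof -
    have "{\<omega> \<in> space M. \<exists>k. idle_at k \<omega>} \<in> sets M"
      by (rule predE, rule pred_intros_countable) (rule idle_at_measurable)
    then show ?thesis by (rule nn_integral_of_bool)
  qed
  finally have "emeasure M {\<omega> \<in> space M. \<exists>k. idle_at k \<omega>} = 1"
    using emeasure_le_1 by (intro antisym) auto
  then have "prob {\<omega> \<in> space M. \<exists>k. idle_at k \<omega>} = 1" by (simp add: measure_def)
  then have "AE \<omega> in M. \<omega> \<in> {\<omega> \<in> space M. \<exists>k. idle_at k \<omega>}"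
    by (rule AE_prob_1)
  then show ?thesis by (auto elim: eventually_mono)
qed

lemma busy_period_measurable: "busy_period N B \<in> borel_measurable M"
proof -
  have P: "Measurable.pred M (\<lambda>\<omega>. N (departure n \<omega>) \<omega> + 1 = n)" for n
  proof (cases n)
    case (Suc m)
    have "Measurable.pred M (\<lambda>\<omega>. N (departure n \<omega>) \<omega> = m)"
      by (rule pred_eq_const1[OF count_at_departure_measurable]) simp
    then show ?thesis using Suc by (simp only: Suc_eq_plus1 add_right_cancel)
  next
    case 0
    then have "(\<lambda>\<omega>. N (departure n \<omega>) \<omega> + 1 = n) = (\<lambda>_. False)" by auto
    show ?thesis unfolding \<open>(\<lambda>\<omega>. N (departure n \<omega>) \<omega> + 1 = n) = (\<lambda>_. False)\<close> by simp
  qed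
  have "(\<lambda>\<omega>. departure (LEAST n. N (departure n \<omega>) \<omega> + 1 = n) \<omega>) \<in> borel_measurable M"
    by (rule measurable_compose_countable[OF departure_measurable measurable_Least[OF P]])
  also have "(\<lambda>\<omega>. departure (LEAST n. N (departure n \<omega>) \<omega> + 1 = n) \<omega>) = busy_period N B"
    by (simp add: fun_eq_iff busy_period_def departure_def)
  finally show ?thesis .
qed

text \<open>With \<open>y\<close> a root of \<open>y = lst D (s + rate * (1 - y))\<close>, discounting by \<open>y\<close> per customer present and
  by \<open>exp (- s t)\<close> in time gives a martingale, which is worth \<open>y\<close> at the start and the discount factor at
  the end of the busy period. So every such root is the LST, and no uniqueness argument is needed.\<close>

lemma suminf_idle_weight_root:
  assumes D: "integrable D (\<lambda>x. x)" and load: "rate * mean D < 1"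
    and s: "0 \<le> s" and y: "0 < y" "y \<le> 1" "y = lst D (s + rate * (1 - y))"
  shows "(\<Sum>k. idle_weight s k) = ennreal y"
proof -
  let ?p = "alive_weight s y" and ?e = "idle_weight s"
  have main: "ennreal y * ?p n + (\<Sum>k<Suc n. ?e k) = ennreal y" for n
  proof (induction n)
    case 0
    then show ?case by (simp add: alive_weight_0 idle_weight_0)
  next
    case (Suc n)
    have "ennreal y * ?p (Suc n) + ?e (Suc n) = ennreal y * ?p n"
      using alive_weight_step[OF D s, of y n] y by simp
    then show ?case using Suc by (metis add.commute add.left_commute sum.lessThan_Suc)
  qed
  \<comment> \<open>The weight on busy sample points is at most the probability of still being busy,
    which tends to 0.\<close>
  have "(\<lambda>n. \<integral>\<^sup>+\<omega>. of_bool (busy n \<omega>) \<partial>M) \<longlonglongrightarrow> (\<integral>\<^sup>+\<omega>. 0 \<partial>M)"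
  proof (rule nn_integral_dominated_convergence[where w = "\<lambda>_. 1"])
    show "AE \<omega> in M. (\<lambda>n. of_bool (busy n \<omega>) :: ennreal) \<longlonglongrightarrow> 0"
      using AE_busy_period_ends[OF D load]
    proof eventually_elim
      case (elim \<omega>)
      then obtain k where "idle_at k \<omega>" by blast
      then have "\<not> busy n \<omega>" if "k \<le> n" for n using that by (auto simp: idle_at_def busy_def)
      then have "eventually (\<lambda>n. of_bool (busy n \<omega>) = (0::ennreal)) sequentially"
        by (auto simp: eventually_sequentially)
      then show ?case by (rule tendsto_eventually)
    qed
  qed (auto intro: borel_measurable_of_bool_pred busy_measurable simp: emeasure_space_1)
  then have "?p \<longlonglongrightarrow> 0"
    by (intro ennreal_tendsto_0_le[where f = ?p and g = "\<lambda>n. \<integral>\<^sup>+\<omega>. of_bool (busy n \<omega>) \<partial>M"])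
      (use alive_weight_le_prob_busy[OF s, of y] y in simp_all)
  then have "(\<lambda>n. ennreal y * ?p n + (\<Sum>k<Suc n. ?e k)) \<longlonglongrightarrow> ennreal y * 0 + (\<Sum>k. ?e k)"
    by (intro tendsto_add ennreal_tendsto_cmult LIMSEQ_Suc[OF summable_LIMSEQ]) auto
  then have "(\<lambda>n. ennreal y) \<longlonglongrightarrow> (\<Sum>k. ?e k)" unfolding main by simp
  then show ?thesis using LIMSEQ_unique tendsto_const by blast
qed

text \<open>The intermediate value theorem yields some root, the martingale identifies it with the
  LST, and the three properties are those of the root.\<close>

lemma busy_period_lst:
  assumes D: "integrable D (\<lambda>x. x)" and load: "rate * mean D < 1" and s: "0 \<le> s"
  defines "\<theta> \<equiv> lst (distr M borel (busy_period N B)) s"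
  shows busy_period_lst_pos: "0 < \<theta>" and busy_period_lst_le_1: "\<theta> \<le> 1"
    and busy_period_lst_eq: "\<theta> = lst D (s + rate * (1 - \<theta>))"
proof -
  obtain y where y: "0 < y" "y \<le> 1" "y = lst D (s + rate * (1 - y))"
    using busy_root_exists[OF service_law_nonneg[OF D] s, of rate] rate_pos by auto
  have "ennreal y = (\<integral>\<^sup>+\<omega>. of_bool (\<exists>k. idle_at k \<omega>) * ennreal (exp (- s * busy_period N B \<omega>)) \<partial>M)"
    using suminf_idle_weight_root[OF D load s y] suminf_idle_weight[of s] by simp
  also have "\<dots> = (\<integral>\<^sup>+\<omega>. ennreal (exp (- s * busy_period N B \<omega>)) \<partial>M)"
    using AE_busy_period_ends[OF D load] by (intro nn_integral_cong_AE) (auto elim: eventually_mono)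
  finally have nn: "(\<integral>\<^sup>+\<omega>. ennreal (exp (- s * busy_period N B \<omega>)) \<partial>M) = ennreal y" by (rule sym)
  have "\<theta> = (\<integral>\<omega>. exp (- s * busy_period N B \<omega>) \<partial>M)"
    unfolding \<theta>_def lst_def by (rule integral_distr[OF busy_period_measurable]) measurable
  also have "\<dots> = enn2real (\<integral>\<^sup>+\<omega>. ennreal (exp (- s * busy_period N B \<omega>)) \<partial>M)"
    by (rule enn2real_nn_integral_eq_integral[symmetric])
      (use busy_period_measurable in \<open>auto intro!: borel_measurable_exp borel_measurable_times\<close>)
  also have "\<dots> = y" unfolding nn using y by simp
  finally have "\<theta> = y" .
  then show "0 < \<theta>" "\<theta> \<le> 1" "\<theta> = lst D (s + rate * (1 - \<theta>))" using y by auto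
qed

end

section \<open>The polling system as a Markov chain\<close>

text \<open>The state without its clock. It is countable for a finite set of types, which allows a
  decomposition into paths. The counters stay, since they name the service time, switch-over time
  and route that come next.\<close>

type_synonym 'c dstate = "queue \<times> ('c \<Rightarrow> nat) \<times> ('c \<Rightarrow> nat) \<times> nat"

definition discrete :: "'c state \<Rightarrow> 'c dstate" where
  "discrete s = (location s, content s, served s, visits s)"

fun current :: "'c discipline \<Rightarrow> 'c dstate \<Rightarrow> 'c option" where
  "current d (i, n, \<sigma>, v) = d i n"

fun remaining :: "'c discipline \<Rightarrow> 'c dstate \<Rightarrow> 'c \<Rightarrow> nat" where
  "remaining d (i, n, \<sigma>, v) e = n e - (if d i n = Some e then 1 else 0)"

text \<open>The conditions on a step that do not depend on the sample point. On leaving, the next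
  queue is left open here; \<open>routed\<close> ties it to the random routing.\<close>

fun legal_step :: "'c discipline \<Rightarrow> 'c dstate \<Rightarrow> 'c dstate \<Rightarrow> bool" where
  "legal_step d (i, n, \<sigma>, v) (j, m, \<tau>, w) \<longleftrightarrow>
    (\<forall>e. remaining d (i, n, \<sigma>, v) e \<le> m e) \<and>
    (case d i n of
      Some c \<Rightarrow> j = i \<and> \<tau> = \<sigma>(c := Suc (\<sigma> c)) \<and> w = v
    | None \<Rightarrow> \<tau> = \<sigma> \<and> w = Suc v)"

fun duration :: "'c discipline \<Rightarrow> ('a, 'c) polling_input \<Rightarrow> 'c dstate \<Rightarrow> 'c dstate \<Rightarrow> 'a \<Rightarrow> real" where
  "duration d I (i, n, \<sigma>, v) (j, m, \<tau>, w) =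
    (case d i n of Some c \<Rightarrow> service I c (\<sigma> c) | None \<Rightarrow> switch I i j v)"

fun routed :: "'c discipline \<Rightarrow> ('a, 'c) polling_input \<Rightarrow> 'c dstate \<Rightarrow> 'c dstate \<Rightarrow> 'a \<Rightarrow> bool" where
  "routed d I (i, n, \<sigma>, v) (j, m, \<tau>, w) \<omega> \<longleftrightarrow> (d i n = None \<longrightarrow> route I i v \<omega> = j)"

lemma discrete_step_iff:
  "discrete (step d I \<omega> s) = y \<longleftrightarrow>
    legal_step d (discrete s) y \<and> routed d I (discrete s) y \<omega> \<and>
    (\<forall>e. arrivals I e (clock s + duration d I (discrete s) y \<omega>) \<omega> - arrivals I e (clock s) \<omega>
      = fst (snd y) e - remaining d (discrete s) e)"
proof -
  obtain j m \<tau> w where y: "y = (j, m, \<tau>, w)" by (metis surj_pair)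
  \<comment> \<open>Arrival counts are truncated differences of naturals; this is the origin of the
    inequality in \<open>legal_step\<close>.\<close>
  have *: "a + k = b \<longleftrightarrow> a \<le> b \<and> k = b - a" for a b k :: nat by auto
  show ?thesis
  proof (cases "d (location s) (content s)")
    case None
    then show ?thesis
      by (auto simp: y discrete_def step_def Let_def fun_eq_iff *)
  next
    case (Some c)
    have e: "(if e = c then 1 else 0) = (if c = e then 1 else (0::nat))" for e by auto
    show ?thesis
      by (auto simp: y discrete_def step_def Let_def Some fun_eq_iff e *)
  qed
qed

lemma clock_step:
  "discrete (step d I \<omega> s) = y \<Longrightarrow> clock (step d I \<omega> s) = clock s + duration d I (discrete s) y \<omega>"
  by (cases y) (auto simp: discrete_def step_def Let_def split: option.splits)

text \<open>Here \<open>q\<close> assigns to each type its queue. A discipline is only asked to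
  serve customers of the current queue and to leave it when it is empty, so the priority system with
  three types and the plain one with two are both instances.\<close>

locale exhaustive_polling = polling_system M lam B S p I
  for M :: "'a measure" and lam :: "'c::finite \<Rightarrow> real" and B S p and I :: "('a, 'c) polling_input" +
  fixes d :: "'c discipline" and q :: "'c \<Rightarrow> queue"
  assumes serves: "d i n = Some c \<Longrightarrow> q c = i \<and> 0 < n c"
    and leaves: "d i n = None \<Longrightarrow> q c = i \<Longrightarrow> n c = 0"
    and service_nonneg_law: "nonneg_law (B c)"
    and switch_nonneg_law: "nonneg_law (S i j)"
begin

abbreviation state :: "nat \<Rightarrow> 'a \<Rightarrow> 'c state" where
  "state n \<omega> \<equiv> state_after d I n \<omega>"

definition dstate :: "nat \<Rightarrow> 'a \<Rightarrow> 'c dstate" where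
  "dstate n \<omega> = discrete (state n \<omega>)"

definition elapsed :: "(nat \<Rightarrow> 'c dstate) \<Rightarrow> nat \<Rightarrow> 'a \<Rightarrow> real" where
  "elapsed \<pi> n \<omega> = (\<Sum>k<n. duration d I (\<pi> k) (\<pi> (Suc k)) \<omega>)"

definition legal :: "(nat \<Rightarrow> 'c dstate) \<Rightarrow> nat \<Rightarrow> bool" where
  "legal \<pi> n \<longleftrightarrow> snd (snd (\<pi> 0)) = (\<lambda>_. 0, 0) \<and> (\<forall>k<n. legal_step d (\<pi> k) (\<pi> (Suc k)))"

definition increments_match :: "(nat \<Rightarrow> 'c dstate) \<Rightarrow> nat \<Rightarrow> 'a \<Rightarrow> bool" where
  "increments_match \<pi> n \<omega> \<longleftrightarrow> (\<forall>k<n. \<forall>e.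
    arrivals I e (elapsed \<pi> (Suc k) \<omega>) \<omega> - arrivals I e (elapsed \<pi> k \<omega>) \<omega>
      = fst (snd (\<pi> (Suc k))) e - remaining d (\<pi> k) e)"

definition start_and_routing :: "(nat \<Rightarrow> 'c dstate) \<Rightarrow> nat \<Rightarrow> 'a \<Rightarrow> bool" where
  "start_and_routing \<pi> n \<omega> \<longleftrightarrow>
    initial I \<omega> = (fst (\<pi> 0), fst (snd (\<pi> 0))) \<and> (\<forall>k<n. routed d I (\<pi> k) (\<pi> (Suc k)) \<omega>)"

lemma state_Suc: "state (Suc n) \<omega> = step d I \<omega> (state n \<omega>)"
  by (simp add: state_after_def)

text \<open>On a fixed path the clock is a sum of durations known by name. Both claims go through
  one induction, because the arrivals of the next step are counted from that clock.\<close>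

lemma follows_path_iff:
  "((\<forall>k\<le>n. dstate k \<omega> = \<pi> k) \<longleftrightarrow>
    legal \<pi> n \<and> start_and_routing \<pi> n \<omega> \<and> increments_match \<pi> n \<omega>) \<and>
   ((\<forall>k\<le>n. dstate k \<omega> = \<pi> k) \<longrightarrow> clock (state n \<omega>) = elapsed \<pi> n \<omega>)"
proof (induction n)
  case 0
  obtain i m \<sigma> v where "\<pi> 0 = (i, m, \<sigma>, v)" by (metis surj_pair)
  then show ?case
    by (cases "initial I \<omega>") (auto simp: dstate_def discrete_def state_after_def legal_def
        start_and_routing_def increments_match_def elapsed_def)
next
  case (Suc n)
  show ?case
  proof (cases "\<forall>k\<le>n. dstate k \<omega> = \<pi> k")
    case True
    then have clk: "clock (state n \<omega>) = elapsed \<pi> n \<omega>" and x: "discrete (state n \<omega>) = \<pi> n"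
      using Suc by (auto simp: dstate_def)
    have R: "legal \<pi> n" "start_and_routing \<pi> n \<omega>" "increments_match \<pi> n \<omega>" using Suc True by auto
    have "(\<forall>k\<le>Suc n. dstate k \<omega> = \<pi> k) \<longleftrightarrow> dstate (Suc n) \<omega> = \<pi> (Suc n)"
      using True by (auto simp: le_Suc_eq)
    also have "\<dots> \<longleftrightarrow> discrete (step d I \<omega> (state n \<omega>)) = \<pi> (Suc n)"
      by (simp add: dstate_def state_Suc)
    also have "\<dots> \<longleftrightarrow> legal_step d (\<pi> n) (\<pi> (Suc n)) \<and> routed d I (\<pi> n) (\<pi> (Suc n)) \<omega> \<and>
      (\<forall>e. arrivals I e (elapsed \<pi> (Suc n) \<omega>) \<omega> - arrivals I e (elapsed \<pi> n \<omega>) \<omega>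
        = fst (snd (\<pi> (Suc n))) e - remaining d (\<pi> n) e)"
      unfolding discrete_step_iff x clk by (simp add: elapsed_def)
    also have "\<dots> \<longleftrightarrow> legal \<pi> (Suc n) \<and> start_and_routing \<pi> (Suc n) \<omega> \<and> increments_match \<pi> (Suc n) \<omega>"
      using R by (auto simp: legal_def start_and_routing_def increments_match_def less_Suc_eq)
    finally have iff: "(\<forall>k\<le>Suc n. dstate k \<omega> = \<pi> k) \<longleftrightarrow>
      legal \<pi> (Suc n) \<and> start_and_routing \<pi> (Suc n) \<omega> \<and> increments_match \<pi> (Suc n) \<omega>" .
    moreover have "clock (state (Suc n) \<omega>) = elapsed \<pi> (Suc n) \<omega>" if "\<forall>k\<le>Suc n. dstate k \<omega> = \<pi> k"
      using clock_step[of d I \<omega> "state n \<omega>" "\<pi> (Suc n)"] that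
      by (auto simp: state_Suc clk x elapsed_def dstate_def)
    ultimately show ?thesis by blast
  next
    case False
    then have "\<not> (\<forall>k\<le>Suc n. dstate k \<omega> = \<pi> k)" using le_SucI by blast
    moreover have "\<not> (legal \<pi> (Suc n) \<and> start_and_routing \<pi> (Suc n) \<omega> \<and> increments_match \<pi> (Suc n) \<omega>)"
      using False Suc by (auto simp: legal_def start_and_routing_def increments_match_def)
    ultimately show ?thesis by blast
  qed
qed

sublocale sources: poisson_sources M "source_events M I" lam "arrivals I" Arrival
proof (intro poisson_sources.intro independent_sources.intro independent_sources_axioms.intro
    poisson_sources_axioms.intro)
  show "sigma_algebra (space M) (source_events M I s)" for s
    by (cases s) (auto intro: sigma_algebra_variable_events initial_measurable service_measurable
        switch_measurable route_measurable
        poisson_process.sigma_algebra_process_events[OF arrivals_poisson])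
qed (use independent arrivals_poisson prob_space_axioms in \<open>auto simp: inj_on_def\<close>)

lemma initial_measurable_collect:
  "Initial \<in> A \<Longrightarrow> initial I \<in> measurable (sources.collect A) (count_space UNIV)"
  by (rule sources.measurable_collectI[of Initial]) (use initial_measurable in \<open>auto simp: variable_events_def\<close>)

lemma service_measurable_collect:
  "Service c k \<in> A \<Longrightarrow> service I c k \<in> borel_measurable (sources.collect A)"
  by (rule sources.measurable_collectI[of "Service c k"]) (use service_measurable in \<open>auto simp: variable_events_def\<close>)

lemma switch_measurable_collect:
  "Switch i j k \<in> A \<Longrightarrow> switch I i j k \<in> borel_measurable (sources.collect A)"
  by (rule sources.measurable_collectI[of "Switch i j k"]) (use switch_measurable in \<open>auto simp: variable_events_def\<close>)

lemma route_measurable_collect: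
  "Route i k \<in> A \<Longrightarrow> route I i k \<in> measurable (sources.collect A) (count_space UNIV)"
  by (rule sources.measurable_collectI[of "Route i k"]) (use route_measurable in \<open>auto simp: variable_events_def\<close>)

text \<open>The sources that a path to \<open>x\<close> can have used, apart from the arrivals,
  which \<open>random_history_increment\<close> treats separately. Since \<open>x\<close> does not
  record which queues were visited, switch-over times and routes of earlier visits are included for
  all queues.\<close>

definition past :: "'c dstate \<Rightarrow> 'c source set" where
  "past x = {s. case s of Initial \<Rightarrow> True | Arrival _ \<Rightarrow> False
    | Service c k \<Rightarrow> k < fst (snd (snd x)) c
    | Switch _ _ k \<Rightarrow> k < snd (snd (snd x)) | Route _ k \<Rightarrow> k < snd (snd (snd x))}"

lemma past_step_mono: "legal_step d x y \<Longrightarrow> past x \<subseteq> past y"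
  by (cases x; cases y) (auto simp: past_def split: option.splits if_splits source.splits)

lemma past_mono: "legal \<pi> n \<Longrightarrow> k \<le> m \<Longrightarrow> m \<le> n \<Longrightarrow> past (\<pi> k) \<subseteq> past (\<pi> m)"
proof (induction m)
  case (Suc m)
  show ?case
  proof (cases "k = Suc m")
    case False
    then have "past (\<pi> k) \<subseteq> past (\<pi> m)" using Suc by auto
    also have "\<dots> \<subseteq> past (\<pi> (Suc m))" using Suc by (intro past_step_mono) (auto simp: legal_def)
    finally show ?thesis .
  qed auto
qed auto

lemma duration_measurable_past:
  assumes "legal_step d x y" "past y \<subseteq> A"
  shows "duration d I x y \<in> borel_measurable (sources.collect A)"
proof -
  obtain i n \<sigma> v where x: "x = (i, n, \<sigma>, v)" by (metis surj_pair)
  obtain j m \<tau> w where y: "y = (j, m, \<tau>, w)" by (metis surj_pair)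
  show ?thesis
  proof (cases "d i n")
    case None
    then have "Switch i j v \<in> A" using assms by (auto simp: x y past_def)
    then show ?thesis
      unfolding x y duration.simps None option.case by (rule switch_measurable_collect)
  next
    case (Some c)
    then have "Service c (\<sigma> c) \<in> A" using assms by (auto simp: x y past_def)
    then show ?thesis
      unfolding x y duration.simps Some option.case by (rule service_measurable_collect)
  qed
qed

lemma routed_measurable_past:
  assumes "legal_step d x y" "past y \<subseteq> A"
  shows "Measurable.pred (sources.collect A) (routed d I x y)"
proof -
  obtain i n \<sigma> v where x: "x = (i, n, \<sigma>, v)" by (metis surj_pair)
  obtain j m \<tau> w where y: "y = (j, m, \<tau>, w)" by (metis surj_pair)
  show ?thesis
  proof (cases "d i n")
    case None
    then have "Route i v \<in> A" using assms by (auto simp: x y past_def)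
    then have "Measurable.pred (sources.collect A) (\<lambda>\<omega>. route I i v \<omega> = j)"
      by (intro pred_eq_const1[OF route_measurable_collect]) auto
    also have "(\<lambda>\<omega>. route I i v \<omega> = j) = routed d I x y"
      using None by (auto simp: x y)
    finally show ?thesis .
  next
    case (Some c)
    then have "routed d I x y = (\<lambda>_. True)" by (auto simp: x y)
    then show ?thesis by simp
  qed
qed

lemma duration_nonneg: "\<omega> \<in> space M \<Longrightarrow> 0 \<le> duration d I x y \<omega>"
  by (cases x; cases y) (auto simp: service_nonneg switch_nonneg split: option.split)

lemma elapsed_measurable_past:
  assumes "legal \<pi> n" "k \<le> n"
  shows "elapsed \<pi> k \<in> borel_measurable (sources.collect (past (\<pi> n)))"
  unfolding elapsed_def
  by (intro borel_measurable_sum duration_measurable_past past_mono[OF assms(1)])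
    (use assms in \<open>auto simp: legal_def\<close>)

lemma elapsed_nonneg: "\<omega> \<in> space M \<Longrightarrow> 0 \<le> elapsed \<pi> k \<omega>"
  unfolding elapsed_def by (intro sum_nonneg duration_nonneg)

lemma start_and_routing_measurable_past:
  assumes "legal \<pi> n"
  shows "Measurable.pred (sources.collect (past (\<pi> n))) (start_and_routing \<pi> n)"
proof -
  have "Measurable.pred (sources.collect (past (\<pi> n))) (\<lambda>\<omega>. \<forall>k<n. routed d I (\<pi> k) (\<pi> (Suc k)) \<omega>)"
    by (intro pred_all_less routed_measurable_past past_mono[OF assms]) (use assms in \<open>auto simp: legal_def\<close>)
  moreover have "Measurable.pred (sources.collect (past (\<pi> n)))
      (\<lambda>\<omega>. initial I \<omega> = (fst (\<pi> 0), fst (snd (\<pi> 0))))"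
    by (intro pred_eq_const1[OF initial_measurable_collect]) (auto simp: past_def)
  ultimately show ?thesis
    unfolding start_and_routing_def by (intro pred_intros_logic)
qed

text \<open>For a legal path, the event of following it is a condition on
  \<open>past (\<pi> n)\<close> together with a history of arrival increments, and
  \<open>random_history_increment\<close> applies. Other paths are never followed, and both sides
  are 0.\<close>

lemma path_future_increment:
  assumes disj: "C \<inter> past (\<pi> n) = {}" "C \<inter> range Arrival = {}"
    and U: "U \<in> borel_measurable (sources.collect C)" "\<And>\<omega>. \<omega> \<in> space M \<Longrightarrow> 0 \<le> U \<omega>"
    and Q: "Q \<in> borel_measurable (sources.collect C)"
    and z: "\<And>e. 0 \<le> z e" "\<And>e. z e \<le> 1"
  shows "(\<integral>\<^sup>+\<omega>. of_bool (\<forall>k\<le>n. dstate k \<omega> = \<pi> k) * (Q \<omega> *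
      (\<Prod>e\<in>UNIV. ennreal (z e ^ (arrivals I e (clock (state n \<omega>) + U \<omega>) \<omega> - arrivals I e (clock (state n \<omega>)) \<omega>)))) \<partial>M)
    = (\<integral>\<^sup>+\<omega>. of_bool (\<forall>k\<le>n. dstate k \<omega> = \<pi> k) \<partial>M) *
      (\<integral>\<^sup>+\<omega>. Q \<omega> * ennreal (exp (- (\<Sum>e\<in>UNIV. lam e * (1 - z e)) * U \<omega>)) \<partial>M)"
proof (cases "legal \<pi> n")
  case False
  then have zero: "of_bool (\<forall>k\<le>n. dstate k \<omega> = \<pi> k) = (0 :: ennreal)" for \<omega>
    using follows_path_iff[of n \<omega> \<pi>] by auto
  show ?thesis unfolding zero by simp
next
  case True
  define hist where "hist \<omega> \<longleftrightarrow> (\<forall>k<n. \<forall>e. arrivals I e (elapsed \<pi> (Suc k) \<omega>) \<omega> - arrivals I e (elapsed \<pi> k \<omega>) \<omega>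
      = fst (snd (\<pi> (Suc k))) e - remaining d (\<pi> k) e)" for \<omega>
  have path: "of_bool (\<forall>k\<le>n. dstate k \<omega> = \<pi> k)
      = (of_bool (start_and_routing \<pi> n \<omega>) * of_bool (hist \<omega>) :: ennreal)" for \<omega>
    using follows_path_iff[of n \<omega> \<pi>] True by (auto simp: increments_match_def hist_def)
  have "of_bool (\<forall>k\<le>n. dstate k \<omega> = \<pi> k) * (Q \<omega> *
      (\<Prod>e\<in>UNIV. ennreal (z e ^ (arrivals I e (clock (state n \<omega>) + U \<omega>) \<omega> - arrivals I e (clock (state n \<omega>)) \<omega>))))
    = of_bool (start_and_routing \<pi> n \<omega>) * of_bool (hist \<omega>) * (Q \<omega> *
      (\<Prod>e\<in>UNIV. ennreal (z e ^ (arrivals I e (elapsed \<pi> n \<omega> + U \<omega>) \<omega> - arrivals I e (elapsed \<pi> n \<omega>) \<omega>))))" for \<omega>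
  proof (cases "\<forall>k\<le>n. dstate k \<omega> = \<pi> k")
    case True
    then have "clock (state n \<omega>) = elapsed \<pi> n \<omega>" using follows_path_iff[of n \<omega> \<pi>] by blast
    then show ?thesis unfolding path[symmetric] by (simp only:)
  next
    case False
    then show ?thesis unfolding path[symmetric] by (simp only: of_bool_eq mult_zero_left)
  qed
  then show ?thesis
    unfolding path hist_def
    by (simp only:, intro sources.random_history_increment[where A = "past (\<pi> n)" and B = C and n = n and
          T = "elapsed \<pi>" and U = U and Q = Q and z = z and
          R = "\<lambda>\<omega>. of_bool (start_and_routing \<pi> n \<omega>)" and
          a = "\<lambda>k e. fst (snd (\<pi> (Suc k))) e - remaining d (\<pi> k) e"]
        borel_measurable_of_bool_pred start_and_routing_measurable_past True elapsed_measurable_past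
        elapsed_nonneg U Q z disj)
      (use disj in \<open>auto simp: past_def elapsed_def duration_nonneg\<close>)
qed

lemma lam_pos: "0 < lam e"
  using poisson_process.rate_pos[OF arrivals_poisson] .

text \<open>Each single path is a measurable event by \<open>follows_path_iff\<close>, there are
  countably many of them, and the state is the last entry of the path.\<close>

lemma dstate_measurable: "dstate n \<in> measurable M (count_space UNIV)"
proof -
  have pred: "Measurable.pred M (\<lambda>\<omega>. \<forall>k\<le>n. dstate k \<omega> = \<pi> k)" for \<pi>
  proof (cases "legal \<pi> n")
    case False
    then have "(\<lambda>\<omega>. \<forall>k\<le>n. dstate k \<omega> = \<pi> k) = (\<lambda>_. False)"
      using follows_path_iff[of n _ \<pi>] by (intro ext) blast
    then show ?thesis by (simp only:) simp
  next
    case True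
    have el: "elapsed \<pi> k \<in> borel_measurable M" if "k \<le> n" for k
      using sources.measurable_collect[OF elapsed_measurable_past[OF True that]] .
    have "Measurable.pred M (increments_match \<pi> n)"
      unfolding increments_match_def
    proof (rule pred_all_less, rule pred_all_finite, rule pred_eq_const1)
      fix k e assume k: "k < n"
      show "(\<lambda>\<omega>. arrivals I e (elapsed \<pi> (Suc k) \<omega>) \<omega> - arrivals I e (elapsed \<pi> k \<omega>) \<omega>)
        \<in> measurable M (count_space UNIV)"
        by (intro measurable_diff_nat sources.measurable_count_random el elapsed_nonneg)
          (use k in linarith)+
    qed simp
    moreover have "Measurable.pred M (start_and_routing \<pi> n)"
      by (rule sources.measurable_collect[OF start_and_routing_measurable_past[OF True]])
    ultimately have "Measurable.pred M (\<lambda>\<omega>. start_and_routing \<pi> n \<omega> \<and> increments_match \<pi> n \<omega>)"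
      by (intro pred_intros_logic)
    also have "(\<lambda>\<omega>. start_and_routing \<pi> n \<omega> \<and> increments_match \<pi> n \<omega>) = (\<lambda>\<omega>. \<forall>k\<le>n. dstate k \<omega> = \<pi> k)"
      using follows_path_iff[of n _ \<pi>] True by (intro ext) blast
    finally show ?thesis .
  qed
  define path where "path \<omega> = map (\<lambda>k. dstate k \<omega>) [0..<Suc n]" for \<omega>
  have "path \<in> measurable M (count_space UNIV)"
  proof (rule measurable_count_space_eq2_countable[THEN iffD2], intro conjI ballI)
    fix l :: "'c dstate list"
    show "path -` {l} \<inter> space M \<in> sets M"
    proof (cases "length l = Suc n")
      case True
      then have "path -` {l} \<inter> space M = {\<omega> \<in> space M. \<forall>k\<le>n. dstate k \<omega> = l ! k}"
        unfolding path_def vimage_def singleton_iff map_upt_eq_iff by blast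
      then show ?thesis using predE[OF pred[of "(!) l"]] by (simp only:)
    next
      case False
      then have "path -` {l} \<inter> space M = {}"
        unfolding path_def vimage_def singleton_iff map_upt_eq_iff by blast
      then show ?thesis by (simp only: sets.empty_sets)
    qed
  qed auto
  then have "(\<lambda>\<omega>. last (path \<omega>)) \<in> measurable M (count_space UNIV)"
    by (rule measurable_compose) simp
  also have "(\<lambda>\<omega>. last (path \<omega>)) = dstate n" by (auto simp: path_def)
  finally show ?thesis .
qed

lemma path_measurable: "(\<lambda>\<omega>. map (\<lambda>k. dstate k \<omega>) [0..<n]) \<in> measurable M (count_space UNIV)"
  by (intro measurable_list_of_nats dstate_measurable)

section \<open>One-step transition formulas for generating functions\<close>

definition monomial :: "('c \<Rightarrow> real) \<Rightarrow> ('c \<Rightarrow> nat) \<Rightarrow> real" where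
  "monomial z n = (\<Prod>e\<in>UNIV. z e ^ n e)"

definition total :: "('c \<Rightarrow> real) \<Rightarrow> real" where
  "total z = (\<Sum>e\<in>UNIV. lam e * (1 - z e))"

text \<open>Forward probabilities of the routing chain. The formula to be proved uses those of the
  reversed chain, \<open>r\<close>; \<open>balance\<close> connects the two.\<close>

definition routing :: "queue \<Rightarrow> queue \<Rightarrow> real" where
  "routing i j = (if i = j then p i else 1 - p i)"

lemma monomial_nonneg: "(\<And>e. 0 \<le> z e) \<Longrightarrow> 0 \<le> monomial z n"
  unfolding monomial_def by (intro prod_nonneg) auto

lemma monomial_add: "monomial z (\<lambda>e. m e + n e) = monomial z m * monomial z n"
  by (simp add: monomial_def power_add prod.distrib)

lemma measurable_of_dstate:
  "(\<lambda>\<omega>. f (dstate n \<omega>)) \<in> borel_measurable M"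
  by (rule measurable_compose[OF dstate_measurable]) simp

lemma total_nonneg: "(\<And>e. z e \<le> 1) \<Longrightarrow> 0 \<le> total z"
  unfolding total_def using lam_pos by (intro sum_nonneg mult_nonneg_nonneg) (auto intro: less_imp_le)

lemma nn_integral_route:
  "(\<integral>\<^sup>+\<omega>. of_bool (route I i v \<omega> = j) \<partial>M) = ennreal (routing i j)"
proof -
  have sets: "{\<omega> \<in> space M. route I i v \<omega> = k} \<in> sets M" for k
    by (rule predE, rule pred_eq_const1[OF route_measurable]) simp
  have "(\<integral>\<^sup>+\<omega>. of_bool (route I i v \<omega> = j) \<partial>M) = ennreal (prob {\<omega> \<in> space M. route I i v \<omega> = j})"
    by (subst nn_integral_of_bool[OF sets]) (simp add: emeasure_eq_measure)
  also have "prob {\<omega> \<in> space M. route I i v \<omega> = j} = routing i j"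
  proof (cases "i = j")
    case False
    then have "{\<omega> \<in> space M. route I i v \<omega> = j} = space M - {\<omega> \<in> space M. route I i v \<omega> = i}"
      by (auto; metis queue.exhaust)
    then show ?thesis using False prob_compl[OF sets[of i]] by (simp add: routing_def route_prob)
  qed (simp add: routing_def route_prob)
  finally show ?thesis .
qed

lemma nn_integral_duration:
  assumes "X \<in> borel_measurable M" "distr M borel X = L" "nonneg_law L" "0 \<le> s"
  shows "(\<integral>\<^sup>+\<omega>. ennreal (exp (- s * X \<omega>)) \<partial>M) = ennreal (lst L s)"
proof -
  have "(\<integral>\<^sup>+\<omega>. ennreal (exp (- s * X \<omega>)) \<partial>M) = (\<integral>\<^sup>+x. ennreal (exp (- s * x)) \<partial>distr M borel X)"
    using assms by (subst nn_integral_distr) auto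
  then show ?thesis using nn_integral_exp_eq_lst[OF assms(3,4)] assms by simp
qed

lemma dstate_eq: "dstate n \<omega> = (location (state n \<omega>), content (state n \<omega>), served (state n \<omega>), visits (state n \<omega>))"
  by (simp add: dstate_def discrete_def)

lemma measurable_of_two_dstates: "(\<lambda>\<omega>. f (dstate m \<omega>) (dstate n \<omega>)) \<in> borel_measurable M"
  by (rule measurable_compose_countable[OF measurable_of_dstate dstate_measurable])

text \<open>Common scheme for services and switch-over times: \<open>\<Phi>\<close> selects the
  states in which the step is of the kind considered, \<open>C x\<close> names the fresh sources
  that it uses, \<open>U x\<close> is its duration, and \<open>Q x\<close> collects the other
  factors. The summation over paths is done here once for both.\<close>

lemma transition:
  fixes U :: "'c dstate \<Rightarrow> 'a \<Rightarrow> real"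
  assumes F: "F \<in> borel_measurable M"
    and F_eq: "\<And>\<omega>. \<omega> \<in> space M \<Longrightarrow> \<Phi> (dstate n \<omega>) \<Longrightarrow> F \<omega> = Q (dstate n \<omega>) \<omega> *
      (\<Prod>e\<in>UNIV. ennreal (z e ^ (arrivals I e (clock (state n \<omega>) + U (dstate n \<omega>) \<omega>) \<omega>
        - arrivals I e (clock (state n \<omega>)) \<omega>)))"
    and F_0: "\<And>\<omega>. \<not> \<Phi> (dstate n \<omega>) \<Longrightarrow> F \<omega> = 0"
    and C: "\<And>x. \<Phi> x \<Longrightarrow> C x \<inter> past x = {}" "\<And>x. \<Phi> x \<Longrightarrow> C x \<inter> range Arrival = {}"
    and U: "\<And>x. \<Phi> x \<Longrightarrow> U x \<in> borel_measurable (sources.collect (C x))"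
      "\<And>x \<omega>. \<Phi> x \<Longrightarrow> \<omega> \<in> space M \<Longrightarrow> 0 \<le> U x \<omega>"
    and Q: "\<And>x. \<Phi> x \<Longrightarrow> Q x \<in> borel_measurable (sources.collect (C x))"
    and z: "\<And>e. 0 \<le> z e" "\<And>e. z e \<le> 1"
    and int: "\<And>x. \<Phi> x \<Longrightarrow> (\<integral>\<^sup>+\<omega>. Q x \<omega> * ennreal (exp (- total z * U x \<omega>)) \<partial>M) = \<kappa> * g x"
  shows "(\<integral>\<^sup>+\<omega>. F \<omega> \<partial>M) = \<kappa> * (\<integral>\<^sup>+\<omega>. of_bool (\<Phi> (dstate n \<omega>)) * g (dstate n \<omega>) \<partial>M)"
proof -
  define G where "G \<omega> = of_bool (\<Phi> (dstate n \<omega>)) * g (dstate n \<omega>)" for \<omega>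
  have G: "G \<in> borel_measurable M"
    unfolding G_def by (rule measurable_of_dstate)
  have "(\<integral>\<^sup>+\<omega>. F \<omega> \<partial>M) = (\<integral>\<^sup>+\<omega>. \<kappa> * G \<omega> \<partial>M)"
  proof (rule nn_integral_partition_cong[OF path_measurable[of "Suc n"] F])
    show "(\<lambda>\<omega>. \<kappa> * G \<omega>) \<in> borel_measurable M" by (intro borel_measurable_times_ennreal borel_measurable_const G)
    fix l :: "'c dstate list"
    let ?path = "\<lambda>\<omega>. map (\<lambda>k. dstate k \<omega>) [0..<Suc n]"
    let ?x = "l ! n"
    have last: "length l = Suc n" "dstate n \<omega> = ?x" if "?path \<omega> = l" for \<omega>
      using that by (auto simp del: upt_Suc)
    show "(\<integral>\<^sup>+\<omega>. F \<omega> * of_bool (?path \<omega> = l) \<partial>M) = (\<integral>\<^sup>+\<omega>. \<kappa> * G \<omega> * of_bool (?path \<omega> = l) \<partial>M)"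
    proof (cases "length l = Suc n \<and> \<Phi> ?x")
      case False
      have "F \<omega> * of_bool (?path \<omega> = l) = 0 \<and> \<kappa> * G \<omega> * of_bool (?path \<omega> = l) = 0" for \<omega>
      proof (cases "?path \<omega> = l")
        case True
        have "\<not> \<Phi> (dstate n \<omega>)" using last[OF True] False by auto
        then have "F \<omega> = 0" "G \<omega> = 0" using F_0 by (auto simp: G_def)
        then show ?thesis
          by (simp_all only: mult_zero_left mult_zero_right)
      qed (simp_all only: of_bool_eq mult_zero_right simp_thms)
      then show ?thesis by (simp only:)
    next
      case True
      then have \<Phi>: "\<Phi> ?x" by simp
      have path_iff: "?path \<omega> = l \<longleftrightarrow> (\<forall>k\<le>n. dstate k \<omega> = l ! k)" for \<omega>
        using True by (auto simp: list_eq_iff_nth_eq less_Suc_eq_le simp del: upt_Suc)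
      let ?P = "\<lambda>\<omega>. of_bool (\<forall>k\<le>n. dstate k \<omega> = l ! k) :: ennreal"
      have P: "?P \<in> borel_measurable M"
      proof -
        have "Measurable.pred M (\<lambda>\<omega>. ?path \<omega> = l)"
          by (rule pred_eq_const1[OF path_measurable]) simp
        then show ?thesis unfolding path_iff by (rule borel_measurable_of_bool_pred)
      qed
      have "(\<integral>\<^sup>+\<omega>. F \<omega> * of_bool (?path \<omega> = l) \<partial>M) = (\<integral>\<^sup>+\<omega>. ?P \<omega> * (Q ?x \<omega> *
        (\<Prod>e\<in>UNIV. ennreal (z e ^ (arrivals I e (clock (state n \<omega>) + U ?x \<omega>) \<omega> - arrivals I e (clock (state n \<omega>)) \<omega>)))) \<partial>M)"
      proof (rule nn_integral_cong)
        fix \<omega> assume w: "\<omega> \<in> space M"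
        show "F \<omega> * of_bool (?path \<omega> = l) = ?P \<omega> * (Q ?x \<omega> *
          (\<Prod>e\<in>UNIV. ennreal (z e ^ (arrivals I e (clock (state n \<omega>) + U ?x \<omega>) \<omega> - arrivals I e (clock (state n \<omega>)) \<omega>))))"
        proof (cases "?path \<omega> = l")
          case True
          then have "?P \<omega> = 1" using path_iff by simp
          moreover have "F \<omega> * of_bool (?path \<omega> = l) = F \<omega>" unfolding True by simp
          ultimately show ?thesis using F_eq[OF w] \<Phi> last(2)[OF True] by (simp only: mult_1_left)
        qed (simp only: path_iff of_bool_eq mult_zero_left mult_zero_right simp_thms)
      qed
      also have "\<dots> = (\<integral>\<^sup>+\<omega>. ?P \<omega> \<partial>M) * (\<kappa> * g ?x)"
        unfolding int[OF \<Phi>, symmetric] total_def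
        by (rule path_future_increment[where n = n and \<pi> = "(!) l", OF C(1)[OF \<Phi>] C(2)[OF \<Phi>] U(1)[OF \<Phi>] U(2)[OF \<Phi>] Q[OF \<Phi>] z])
      also have "\<dots> = (\<integral>\<^sup>+\<omega>. ?P \<omega> * (\<kappa> * g ?x) \<partial>M)"
        by (rule nn_integral_multc[OF P, symmetric])
      also have "\<dots> = (\<integral>\<^sup>+\<omega>. \<kappa> * G \<omega> * of_bool (?path \<omega> = l) \<partial>M)"
      proof (rule nn_integral_cong)
        fix \<omega>
        show "?P \<omega> * (\<kappa> * g ?x) = \<kappa> * G \<omega> * of_bool (?path \<omega> = l)"
        proof (cases "?path \<omega> = l")
          case True
          then have "?P \<omega> = 1" using path_iff by simp
          moreover have "\<kappa> * G \<omega> * of_bool (?path \<omega> = l) = \<kappa> * G \<omega>" unfolding True by simp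
          moreover have "G \<omega> = g ?x" using \<Phi> last(2)[OF True] by (simp only: G_def of_bool_eq mult_1_left)
          ultimately show ?thesis by (simp only: mult_1_left)
        qed (simp only: path_iff of_bool_eq mult_zero_left mult_zero_right simp_thms)
      qed
      finally show ?thesis .
    qed
  qed
  also have "\<dots> = \<kappa> * (\<integral>\<^sup>+\<omega>. G \<omega> \<partial>M)" by (rule nn_integral_cmult[OF G])
  finally show ?thesis unfolding G_def .
qed

lemma monomial_remove:
  assumes "0 < n c"
  shows "monomial z n = z c * monomial z (\<lambda>e. n e - (if e = c then 1 else 0))"
proof -
  have "monomial z n = monomial z (\<lambda>e. (if e = c then 1 else 0) + (n e - (if e = c then 1 else 0)))"
    using assms by (intro arg_cong[where f = "monomial z"]) auto
  also have "\<dots> = monomial z (\<lambda>e. if e = c then 1 else 0) * monomial z (\<lambda>e. n e - (if e = c then 1 else 0))"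
    by (rule monomial_add)
  also have "monomial z (\<lambda>e. if e = c then 1 else 0) = z c"
    unfolding monomial_def by (subst prod.remove[of UNIV c]) auto
  finally show ?thesis .
qed

lemma ennreal_monomial_add:
  assumes "\<And>e. 0 \<le> z e"
  shows "ennreal (monomial z (\<lambda>e. m e + n e)) = ennreal (monomial z m) * (\<Prod>e\<in>UNIV. ennreal (z e ^ n e))"
  using assms by (simp add: monomial_add ennreal_mult monomial_nonneg prod_ennreal monomial_def[of z n] prod_nonneg)

text \<open>The next queue is decided by a fresh source too, so its indicator is part of
  \<open>Q\<close>, next to the monomial of the customers already present.\<close>

lemma switch_transition:
  assumes z: "\<And>e. 0 \<le> z e" "\<And>e. z e \<le> 1"
  shows "(\<integral>\<^sup>+\<omega>. of_bool (visits (state n \<omega>) = k \<and> location (state n \<omega>) = i \<and>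
        d i (content (state n \<omega>)) = None \<and> location (state (Suc n) \<omega>) = j) *
        ennreal (monomial z (content (state (Suc n) \<omega>))) \<partial>M)
    = ennreal (routing i j * lst (S i j) (total z)) *
      (\<integral>\<^sup>+\<omega>. of_bool (visits (state n \<omega>) = k \<and> location (state n \<omega>) = i \<and> d i (content (state n \<omega>)) = None) *
        ennreal (monomial z (content (state n \<omega>))) \<partial>M)"
proof -
  define \<Phi> where "\<Phi> = (\<lambda>(i' :: queue, m, \<sigma> :: 'c \<Rightarrow> nat, v). v = k \<and> i' = i \<and> d i m = None)"
  define F where "F \<omega> = of_bool (visits (state n \<omega>) = k \<and> location (state n \<omega>) = i \<and>
        d i (content (state n \<omega>)) = None \<and> location (state (Suc n) \<omega>) = j) *
        ennreal (monomial z (content (state (Suc n) \<omega>)))" for \<omega>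
  define Q where "Q = (\<lambda>(i' :: queue, m, \<sigma> :: 'c \<Rightarrow> nat, v) \<omega>. ennreal (monomial z m) * of_bool (route I i v \<omega> = j))"
  define U where "U = (\<lambda>(i' :: queue, m :: 'c \<Rightarrow> nat, \<sigma> :: 'c \<Rightarrow> nat, v). switch I i j v)"
  define C where "C = (\<lambda>(i' :: queue, m :: 'c \<Rightarrow> nat, \<sigma> :: 'c \<Rightarrow> nat, v). {Switch i j v, Route i v} :: 'c source set)"
  define g where "g = (\<lambda>(i' :: queue, m, \<sigma> :: 'c \<Rightarrow> nat, v :: nat). ennreal (monomial z m))"
  let ?\<kappa> = "ennreal (routing i j * lst (S i j) (total z))"
  note defs = \<Phi>_def Q_def U_def C_def g_def
  have "(\<integral>\<^sup>+\<omega>. F \<omega> \<partial>M) = ?\<kappa> * (\<integral>\<^sup>+\<omega>. of_bool (\<Phi> (dstate n \<omega>)) * g (dstate n \<omega>) \<partial>M)"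
  proof (rule transition[where Q = Q and U = U and C = C and z = z])
    define h where "h x y = of_bool (\<Phi> x \<and> fst y = j) * ennreal (monomial z (fst (snd y)))" for x and y :: "'c dstate"
    have "F = (\<lambda>\<omega>. h (dstate n \<omega>) (dstate (Suc n) \<omega>))"
      by (auto simp: fun_eq_iff F_def h_def \<Phi>_def dstate_eq)
    then show "F \<in> borel_measurable M" by (simp only:) (rule measurable_of_two_dstates)
    show "F \<omega> = 0" if "\<not> \<Phi> (dstate n \<omega>)" for \<omega>
      using that by (auto simp: F_def \<Phi>_def dstate_eq)
    show "C x \<inter> past x = {}" "C x \<inter> range Arrival = {}" for x
      by (cases x; auto simp: C_def past_def)+
    show "U x \<in> borel_measurable (sources.collect (C x))" for x
      unfolding U_def C_def by (cases x) (simp only: prod.case, rule switch_measurable_collect, simp)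
    show "0 \<le> U x \<omega>" if "\<omega> \<in> space M" for x \<omega>
      using switch_nonneg[OF that] by (cases x) (auto simp: U_def)
    show "Q x \<in> borel_measurable (sources.collect (C x))" for x
    proof -
      obtain i' m \<sigma> v where x: "x = (i', m, \<sigma>, v)" by (metis surj_pair)
      have "Measurable.pred (sources.collect (C x)) (\<lambda>\<omega>. route I i v \<omega> = j)"
        by (rule pred_eq_const1[OF route_measurable_collect]) (simp_all add: x C_def)
      then show ?thesis
        unfolding Q_def x prod.case by (intro borel_measurable_times_ennreal borel_measurable_const borel_measurable_of_bool_pred)
    qed
    show "F \<omega> = Q (dstate n \<omega>) \<omega> *
      (\<Prod>e\<in>UNIV. ennreal (z e ^ (arrivals I e (clock (state n \<omega>) + U (dstate n \<omega>) \<omega>) \<omega>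
        - arrivals I e (clock (state n \<omega>)) \<omega>)))" if \<Phi>: "\<Phi> (dstate n \<omega>)" for \<omega>
    proof -
      let ?s = "state n \<omega>"
      have s: "visits ?s = k" "location ?s = i" "d i (content ?s) = None"
        using \<Phi> by (auto simp: \<Phi>_def dstate_eq)
      have loc: "location (state (Suc n) \<omega>) = route I i k \<omega>"
        using s by (simp add: state_Suc step_def Let_def)
      show ?thesis
      proof (cases "route I i k \<omega> = j")
        case True
        have "content (state (Suc n) \<omega>) = (\<lambda>e. content ?s e +
            (arrivals I e (clock ?s + switch I i j k \<omega>) \<omega> - arrivals I e (clock ?s) \<omega>))"
          using s True by (simp add: state_Suc step_def Let_def)
        then show ?thesis
          using s True z by (simp add: F_def loc Q_def U_def dstate_eq ennreal_monomial_add)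
      next
        case False
        then show ?thesis using s by (simp add: F_def loc Q_def dstate_eq)
      qed
    qed
    show "(\<integral>\<^sup>+\<omega>. Q x \<omega> * ennreal (exp (- total z * U x \<omega>)) \<partial>M) = ?\<kappa> * g x" for x
    proof -
      obtain i' m \<sigma> v where x: "x = (i', m, \<sigma>, v)" by (metis surj_pair)
      \<comment> \<open>The route and the switch-over time are two independent sources, hence a
        product of the routing probability and an LST.\<close>
      have "(\<integral>\<^sup>+\<omega>. Q x \<omega> * ennreal (exp (- total z * U x \<omega>)) \<partial>M)
        = (\<integral>\<^sup>+\<omega>. Q x \<omega> \<partial>M) * (\<integral>\<^sup>+\<omega>. ennreal (exp (- total z * U x \<omega>)) \<partial>M)"
      proof (rule sources.nn_integral_mult_indep)
        show "{Route i v} \<inter> {Switch i j v} = {}" by simp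
        have "Measurable.pred (sources.collect {Route i v}) (\<lambda>\<omega>. route I i v \<omega> = j)"
          by (rule pred_eq_const1[OF route_measurable_collect]) simp_all
        then show "Q x \<in> borel_measurable (sources.collect {Route i v})"
          unfolding Q_def x prod.case by (intro borel_measurable_times_ennreal borel_measurable_const borel_measurable_of_bool_pred)
        show "(\<lambda>\<omega>. ennreal (exp (- total z * U x \<omega>))) \<in> borel_measurable (sources.collect {Switch i j v})"
          unfolding U_def x prod.case by (intro borel_measurable_exp_cmult switch_measurable_collect) simp
      qed
      also have "(\<integral>\<^sup>+\<omega>. Q x \<omega> \<partial>M) = ennreal (monomial z m) * ennreal (routing i j)"
      proof -
        have "Measurable.pred M (\<lambda>\<omega>. route I i v \<omega> = j)"
          by (rule pred_eq_const1[OF route_measurable]) simp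
        then show ?thesis
          unfolding Q_def x prod.case nn_integral_cmult[OF borel_measurable_of_bool_pred[OF \<open>Measurable.pred M _\<close>]]
            nn_integral_route by (simp only:)
      qed
      also have "(\<integral>\<^sup>+\<omega>. ennreal (exp (- total z * U x \<omega>)) \<partial>M) = ennreal (lst (S i j) (total z))"
        unfolding U_def x prod.case
        by (rule nn_integral_duration[OF switch_measurable switch_law switch_nonneg_law total_nonneg[OF z(2)]])
      also have "ennreal (monomial z m) * ennreal (routing i j) * ennreal (lst (S i j) (total z)) = ?\<kappa> * g x"
      proof -
        have "0 \<le> lst (S i j) (total z)"
          by (intro less_imp_le lst_pos switch_nonneg_law total_nonneg z)
        then show ?thesis by (simp add: g_def x ennreal_mult'' mult_ac)
      qed
      finally show ?thesis .
    qed
  qed (use z in auto)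
  also have "(\<integral>\<^sup>+\<omega>. of_bool (\<Phi> (dstate n \<omega>)) * g (dstate n \<omega>) \<partial>M)
    = (\<integral>\<^sup>+\<omega>. of_bool (visits (state n \<omega>) = k \<and> location (state n \<omega>) = i \<and> d i (content (state n \<omega>)) = None) *
        ennreal (monomial z (content (state n \<omega>))) \<partial>M)"
    by (intro nn_integral_cong) (simp add: \<Phi>_def g_def dstate_eq)
  finally show ?thesis unfolding F_def .
qed

text \<open>The customer served leaves, which costs the monomial a factor \<open>z c\<close>.
  Putting this factor on the left avoids a division by an argument that may be 0.\<close>

lemma service_transition:
  assumes z: "\<And>e. 0 \<le> z e" "\<And>e. z e \<le> 1"
  shows "ennreal (z c) * (\<integral>\<^sup>+\<omega>. of_bool (visits (state n \<omega>) = k \<and> location (state n \<omega>) = i \<and>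
        d i (content (state n \<omega>)) = Some c) *
        ennreal (monomial z (content (state (Suc n) \<omega>))) \<partial>M)
    = ennreal (lst (B c) (total z)) *
      (\<integral>\<^sup>+\<omega>. of_bool (visits (state n \<omega>) = k \<and> location (state n \<omega>) = i \<and> d i (content (state n \<omega>)) = Some c) *
        ennreal (monomial z (content (state n \<omega>))) \<partial>M)"
proof -
  define \<Phi> where "\<Phi> = (\<lambda>(i', m, \<sigma> :: 'c \<Rightarrow> nat, v). v = k \<and> i' = i \<and> d i m = Some c)"
  define F where "F \<omega> = of_bool (visits (state n \<omega>) = k \<and> location (state n \<omega>) = i \<and>
        d i (content (state n \<omega>)) = Some c) *
        ennreal (monomial z (content (state (Suc n) \<omega>)))" for \<omega>
  define rest where "rest m e = m e - (if e = c then 1 else 0)" for m :: "'c \<Rightarrow> nat" and e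
  define Q where "Q = (\<lambda>(i' :: queue, m, \<sigma> :: 'c \<Rightarrow> nat, v :: nat) (\<omega> :: 'a). ennreal (monomial z (rest m)))"
  define U where "U = (\<lambda>(i' :: queue, m :: 'c \<Rightarrow> nat, \<sigma>, v :: nat). service I c (\<sigma> c))"
  define C where "C = (\<lambda>(i' :: queue, m :: 'c \<Rightarrow> nat, \<sigma>, v :: nat). {Service c (\<sigma> c)} :: 'c source set)"
  define g where "g = (\<lambda>(i' :: queue, m, \<sigma> :: 'c \<Rightarrow> nat, v :: nat). ennreal (monomial z (rest m)))"
  let ?\<kappa> = "ennreal (lst (B c) (total z))"
  have "(\<integral>\<^sup>+\<omega>. F \<omega> \<partial>M) = ?\<kappa> * (\<integral>\<^sup>+\<omega>. of_bool (\<Phi> (dstate n \<omega>)) * g (dstate n \<omega>) \<partial>M)"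
  proof (rule transition[where Q = Q and U = U and C = C and z = z])
    define h where "h x y = of_bool (\<Phi> x) * ennreal (monomial z (fst (snd y)))" for x and y :: "'c dstate"
    have "F = (\<lambda>\<omega>. h (dstate n \<omega>) (dstate (Suc n) \<omega>))"
      by (auto simp: fun_eq_iff F_def h_def \<Phi>_def dstate_eq)
    then show "F \<in> borel_measurable M" by (simp only:) (rule measurable_of_two_dstates)
    show "F \<omega> = 0" if "\<not> \<Phi> (dstate n \<omega>)" for \<omega>
      using that by (auto simp: F_def \<Phi>_def dstate_eq)
    show "C x \<inter> past x = {}" "C x \<inter> range Arrival = {}" for x
      by (cases x; auto simp: C_def past_def)+
    show "U x \<in> borel_measurable (sources.collect (C x))" for x
      unfolding U_def C_def by (cases x) (simp only: prod.case, rule service_measurable_collect, simp)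
    show "0 \<le> U x \<omega>" if "\<omega> \<in> space M" for x \<omega>
      using service_nonneg[OF that] by (cases x) (auto simp: U_def)
    show "Q x \<in> borel_measurable (sources.collect (C x))" for x
      unfolding Q_def by (cases x) (simp only: prod.case borel_measurable_const)
    show "F \<omega> = Q (dstate n \<omega>) \<omega> *
      (\<Prod>e\<in>UNIV. ennreal (z e ^ (arrivals I e (clock (state n \<omega>) + U (dstate n \<omega>) \<omega>) \<omega>
        - arrivals I e (clock (state n \<omega>)) \<omega>)))" if \<Phi>: "\<Phi> (dstate n \<omega>)" for \<omega>
    proof -
      let ?s = "state n \<omega>"
      have s: "visits ?s = k" "location ?s = i" "d i (content ?s) = Some c"
        using \<Phi> by (auto simp: \<Phi>_def dstate_eq)
      have "content (state (Suc n) \<omega>) = (\<lambda>e. rest (content ?s) e +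
          (arrivals I e (clock ?s + service I c (served ?s c) \<omega>) \<omega> - arrivals I e (clock ?s) \<omega>))"
        using s by (simp add: state_Suc step_def Let_def rest_def)
      then show ?thesis
        using s z by (simp add: F_def Q_def U_def dstate_eq ennreal_monomial_add)
    qed
    show "(\<integral>\<^sup>+\<omega>. Q x \<omega> * ennreal (exp (- total z * U x \<omega>)) \<partial>M) = ?\<kappa> * g x" for x
    proof -
      obtain i' m \<sigma> v where x: "x = (i', m, \<sigma>, v)" by (metis surj_pair)
      have "(\<integral>\<^sup>+\<omega>. ennreal (monomial z (rest m)) * ennreal (exp (- total z * service I c (\<sigma> c) \<omega>)) \<partial>M)
        = ennreal (monomial z (rest m)) * (\<integral>\<^sup>+\<omega>. ennreal (exp (- total z * service I c (\<sigma> c) \<omega>)) \<partial>M)"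
        by (intro nn_integral_cmult borel_measurable_exp_cmult service_measurable)
      also have "(\<integral>\<^sup>+\<omega>. ennreal (exp (- total z * service I c (\<sigma> c) \<omega>)) \<partial>M) = ?\<kappa>"
        by (rule nn_integral_duration[OF service_measurable service_law service_nonneg_law total_nonneg[OF z(2)]])
      finally show ?thesis by (simp add: Q_def U_def g_def x mult.commute)
    qed
  qed (use z in auto)
  then have "ennreal (z c) * (\<integral>\<^sup>+\<omega>. F \<omega> \<partial>M)
      = ?\<kappa> * (ennreal (z c) * (\<integral>\<^sup>+\<omega>. of_bool (\<Phi> (dstate n \<omega>)) * g (dstate n \<omega>) \<partial>M))"
    by (simp add: mult_ac)
  also have "ennreal (z c) * (\<integral>\<^sup>+\<omega>. of_bool (\<Phi> (dstate n \<omega>)) * g (dstate n \<omega>) \<partial>M)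
    = (\<integral>\<^sup>+\<omega>. ennreal (z c) * (of_bool (\<Phi> (dstate n \<omega>)) * g (dstate n \<omega>)) \<partial>M)"
    by (rule nn_integral_cmult[symmetric]) (rule measurable_of_dstate)
  \<comment> \<open>\<open>serves\<close> guarantees that a customer of type \<open>c\<close> is
    present, so \<open>z c\<close> completes the monomial before the service.\<close>
  also have "\<dots> = (\<integral>\<^sup>+\<omega>. of_bool (visits (state n \<omega>) = k \<and> location (state n \<omega>) = i \<and> d i (content (state n \<omega>)) = Some c) *
        ennreal (monomial z (content (state n \<omega>))) \<partial>M)"
  proof (rule nn_integral_cong)
    fix \<omega>
    let ?s = "state n \<omega>"
    show "ennreal (z c) * (of_bool (\<Phi> (dstate n \<omega>)) * g (dstate n \<omega>)) =
      of_bool (visits ?s = k \<and> location ?s = i \<and> d i (content ?s) = Some c) * ennreal (monomial z (content ?s))"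
    proof (cases "d i (content ?s) = Some c")
      case True
      have "monomial z (content ?s) = z c * monomial z (rest (content ?s))"
        using serves[OF True] monomial_remove[of "content ?s" c z] by (simp add: rest_def[abs_def])
      then show ?thesis
        using z by (simp add: \<Phi>_def g_def dstate_eq ennreal_mult monomial_nonneg mult_ac)
    qed (simp add: \<Phi>_def dstate_eq)
  qed
  finally show ?thesis unfolding F_def .
qed

end

section \<open>From one polling epoch to the next\<close>

context exhaustive_polling
begin

definition weight :: "('c \<Rightarrow> real) \<Rightarrow> 'c dstate \<Rightarrow> ennreal" where
  "weight z x = ennreal (monomial z (fst (snd x)))"

definition present :: "nat \<Rightarrow> queue \<Rightarrow> 'c dstate \<Rightarrow> bool" where
  "present k i x \<longleftrightarrow> snd (snd (snd x)) = k \<and> fst x = i"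

definition ending :: "nat \<Rightarrow> queue \<Rightarrow> 'c dstate \<Rightarrow> bool" where
  "ending k i x \<longleftrightarrow> present k i x \<and> d i (fst (snd x)) = None"

definition serving :: "nat \<Rightarrow> queue \<Rightarrow> 'c dstate \<Rightarrow> bool" where
  "serving k i x \<longleftrightarrow> present k i x \<and> d i (fst (snd x)) \<noteq> None"

text \<open>Polling epoch \<open>k\<close> is state number \<open>n\<close>. Both the start of a
  visit and, one step later, the end of the preceding one are expressed by it.\<close>

definition entering :: "nat \<Rightarrow> nat \<Rightarrow> 'a \<Rightarrow> bool" where
  "entering k n \<omega> \<longleftrightarrow> visits (state n \<omega>) = k \<and> (\<forall>m<n. visits (state m \<omega>) \<noteq> k)"

text \<open>Mass balance of visit \<open>k\<close> to queue \<open>i\<close> over the steps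
  \<open>n\<close>: what is present is either served or ends the visit, and what is present one step
  later has either just entered or comes out of a service.\<close>

definition present_weight :: "nat \<Rightarrow> queue \<Rightarrow> ('c \<Rightarrow> real) \<Rightarrow> nat \<Rightarrow> ennreal" where
  "present_weight k i z n = (\<integral>\<^sup>+\<omega>. of_bool (present k i (dstate n \<omega>)) * weight z (dstate n \<omega>) \<partial>M)"

definition ending_weight :: "nat \<Rightarrow> queue \<Rightarrow> ('c \<Rightarrow> real) \<Rightarrow> nat \<Rightarrow> ennreal" where
  "ending_weight k i z n = (\<integral>\<^sup>+\<omega>. of_bool (ending k i (dstate n \<omega>)) * weight z (dstate n \<omega>) \<partial>M)"

definition serving_weight :: "nat \<Rightarrow> queue \<Rightarrow> ('c \<Rightarrow> real) \<Rightarrow> nat \<Rightarrow> ennreal" where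
  "serving_weight k i z n = (\<integral>\<^sup>+\<omega>. of_bool (serving k i (dstate n \<omega>)) * weight z (dstate n \<omega>) \<partial>M)"

definition served_weight :: "nat \<Rightarrow> queue \<Rightarrow> ('c \<Rightarrow> real) \<Rightarrow> nat \<Rightarrow> ennreal" where
  "served_weight k i z n = (\<integral>\<^sup>+\<omega>. of_bool (serving k i (dstate n \<omega>)) * weight z (dstate (Suc n) \<omega>) \<partial>M)"

definition entering_weight :: "nat \<Rightarrow> queue \<Rightarrow> ('c \<Rightarrow> real) \<Rightarrow> nat \<Rightarrow> ennreal" where
  "entering_weight k i z n =
    (\<integral>\<^sup>+\<omega>. of_bool (entering k n \<omega> \<and> fst (dstate n \<omega>) = i) * weight z (dstate n \<omega>) \<partial>M)"

lemma present_split: "of_bool (present k i x) = (of_bool (serving k i x) + of_bool (ending k i x) :: ennreal)"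
  by (auto simp: serving_def ending_def)

lemma present_weight_split: "present_weight k i z n = serving_weight k i z n + ending_weight k i z n"
  unfolding present_weight_def serving_weight_def ending_weight_def present_split distrib_right
  by (rule nn_integral_add) (rule measurable_of_dstate)+

lemma visits_0: "visits (state 0 \<omega>) = 0"
  by (simp add: state_after_def)

lemma visits_Suc:
  "visits (state (Suc n) \<omega>) =
    (if d (location (state n \<omega>)) (content (state n \<omega>)) = None then Suc (visits (state n \<omega>)) else visits (state n \<omega>))"
  by (simp add: state_Suc step_def Let_def split: option.split)

lemma location_Suc:
  "d (location (state n \<omega>)) (content (state n \<omega>)) \<noteq> None \<Longrightarrow> location (state (Suc n) \<omega>) = location (state n \<omega>)"
  by (auto simp: state_Suc step_def Let_def)

lemma visits_mono: "m \<le> n \<Longrightarrow> visits (state m \<omega>) \<le> visits (state n \<omega>)"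
  by (induction n) (auto simp: le_Suc_eq visits_Suc)

lemma entering_0: "entering k 0 \<omega> \<longleftrightarrow> k = 0"
  by (auto simp: entering_def visits_0)

lemma not_entering_0_Suc: "\<not> entering 0 (Suc n) \<omega>"
  by (auto simp: entering_def visits_0)

lemma entering_Suc:
  "entering (Suc k) (Suc n) \<omega> \<longleftrightarrow>
    visits (state n \<omega>) = k \<and> d (location (state n \<omega>)) (content (state n \<omega>)) = None"
proof
  assume *: "visits (state n \<omega>) = k \<and> d (location (state n \<omega>)) (content (state n \<omega>)) = None"
  have "visits (state m \<omega>) \<noteq> Suc k" if "m < Suc n" for m
    using visits_mono[of m n \<omega>] that * by auto
  then show "entering (Suc k) (Suc n) \<omega>" using * by (auto simp: entering_def visits_Suc)
next
  assume "entering (Suc k) (Suc n) \<omega>"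
  then show "visits (state n \<omega>) = k \<and> d (location (state n \<omega>)) (content (state n \<omega>)) = None"
    by (auto simp: entering_def visits_Suc split: if_splits)
qed

lemma entering_measurable_weight:
  "(\<lambda>\<omega>. of_bool (entering k n \<omega> \<and> fst (dstate n \<omega>) = i) * weight z (dstate n \<omega>)) \<in> borel_measurable M"
proof (cases n)
  case 0
  have "(\<lambda>\<omega>. of_bool (k = 0 \<and> fst (dstate n \<omega>) = i) * weight z (dstate n \<omega>)) \<in> borel_measurable M"
    by (rule measurable_of_dstate)
  then show ?thesis by (simp only: 0 entering_0)
next
  case (Suc n')
  define h where "h x y = of_bool (0 < k \<and> snd (snd (snd x)) = k - 1 \<and> d (fst x) (fst (snd x)) = None \<and> fst y = i)
      * weight z y" for x y :: "'c dstate"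
  have "(\<lambda>\<omega>. of_bool (entering k n \<omega> \<and> fst (dstate n \<omega>) = i) * weight z (dstate n \<omega>))
      = (\<lambda>\<omega>. h (dstate n' \<omega>) (dstate n \<omega>))"
    by (cases k) (auto simp: fun_eq_iff h_def Suc entering_Suc not_entering_0_Suc dstate_eq)
  then show ?thesis by (simp only:) (rule measurable_of_two_dstates)
qed

lemma served_measurable:
  "(\<lambda>\<omega>. of_bool (serving k i (dstate n \<omega>)) * weight z (dstate (Suc n) \<omega>)) \<in> borel_measurable M"
  by (rule measurable_of_two_dstates[of "\<lambda>x y. of_bool (serving k i x) * weight z y"])

lemma present_Suc:
  "of_bool (present k i (dstate (Suc n) \<omega>))
    = (of_bool (entering k (Suc n) \<omega> \<and> fst (dstate (Suc n) \<omega>) = i) + of_bool (serving k i (dstate n \<omega>)) :: ennreal)"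
proof (cases "d (location (state n \<omega>)) (content (state n \<omega>)) = None")
  case True
  then show ?thesis
    by (cases k) (auto simp: present_def serving_def dstate_eq visits_Suc entering_Suc not_entering_0_Suc)
next
  case False
  then show ?thesis
    using location_Suc[OF False]
    by (cases k) (auto simp: present_def serving_def dstate_eq visits_Suc entering_Suc not_entering_0_Suc)
qed

lemma present_weight_Suc: "present_weight k i z (Suc n) = entering_weight k i z (Suc n) + served_weight k i z n"
  unfolding present_weight_def entering_weight_def served_weight_def present_Suc distrib_right
  by (rule nn_integral_add[OF entering_measurable_weight served_measurable])

lemma present_weight_0: "present_weight k i z 0 = entering_weight k i z 0"
  unfolding present_weight_def entering_weight_def
  by (intro nn_integral_cong) (auto simp: present_def entering_0 dstate_eq visits_0)

lemma serving_eq_sum: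
  "of_bool (serving k i x) = (\<Sum>c\<in>UNIV. of_bool (present k i x \<and> d i (fst (snd x)) = Some c) :: ennreal)"
proof (cases "d i (fst (snd x))")
  case (Some c)
  have "(\<Sum>e\<in>UNIV. of_bool (present k i x \<and> d i (fst (snd x)) = Some e) :: ennreal)
      = (\<Sum>e\<in>UNIV. if c = e then of_bool (present k i x) else 0)"
    by (intro sum.cong) (auto simp: Some)
  then show ?thesis by (simp add: serving_def Some)
qed (simp add: serving_def)

lemma serving_weight_eq_sum:
  "serving_weight k i z n = (\<Sum>c\<in>UNIV. \<integral>\<^sup>+\<omega>. of_bool (present k i (dstate n \<omega>) \<and>
    d i (fst (snd (dstate n \<omega>))) = Some c) * weight z (dstate n \<omega>) \<partial>M)"
  unfolding serving_weight_def serving_eq_sum sum_distrib_right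
  by (rule nn_integral_sum) (rule measurable_of_dstate)

lemma served_weight_eq_sum:
  "served_weight k i z n = (\<Sum>c\<in>UNIV. \<integral>\<^sup>+\<omega>. of_bool (present k i (dstate n \<omega>) \<and>
    d i (fst (snd (dstate n \<omega>))) = Some c) * weight z (dstate (Suc n) \<omega>) \<partial>M)"
  unfolding served_weight_def serving_eq_sum sum_distrib_right
  by (rule nn_integral_sum,
      rule measurable_of_two_dstates[of "\<lambda>x y. of_bool (present k i x \<and> d i (fst (snd x)) = Some c) * weight z y" for c])

lemma served_summand:
  assumes z: "\<And>e. 0 \<le> z e" "\<And>e. z e \<le> 1"
  shows "ennreal (z c) * (\<integral>\<^sup>+\<omega>. of_bool (present k i (dstate n \<omega>) \<and>
      d i (fst (snd (dstate n \<omega>))) = Some c) * weight z (dstate (Suc n) \<omega>) \<partial>M)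
    = ennreal (lst (B c) (total z)) * (\<integral>\<^sup>+\<omega>. of_bool (present k i (dstate n \<omega>) \<and>
      d i (fst (snd (dstate n \<omega>))) = Some c) * weight z (dstate n \<omega>) \<partial>M)"
  using service_transition[OF z, where n = n and k = k and i = i and c = c]
  by (simp add: present_def weight_def dstate_eq conj_assoc)

lemma served_summand_eq_0:
  assumes "q c \<noteq> i"
  shows "of_bool (present k i x \<and> d i (fst (snd x)) = Some c) = (0 :: ennreal)"
  using serves[of i "fst (snd x)" c] assms by auto

text \<open>The root condition makes the two factors in \<open>served_summand\<close> equal. They
  can be cancelled because an LST is positive.\<close>

lemma served_weight_eq:
  assumes z: "\<And>e. 0 \<le> z e" "\<And>e. z e \<le> 1"
    and root: "\<And>c. q c = i \<Longrightarrow> z c = lst (B c) (total z)"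
  shows "served_weight k i z n = serving_weight k i z n"
  unfolding served_weight_eq_sum serving_weight_eq_sum
proof (rule sum.cong[OF refl])
  fix c :: 'c
  let ?P = "\<lambda>\<omega>. of_bool (present k i (dstate n \<omega>) \<and> d i (fst (snd (dstate n \<omega>))) = Some c) :: ennreal"
  show "(\<integral>\<^sup>+\<omega>. ?P \<omega> * weight z (dstate (Suc n) \<omega>) \<partial>M) = (\<integral>\<^sup>+\<omega>. ?P \<omega> * weight z (dstate n \<omega>) \<partial>M)"
  proof (cases "q c = i")
    case True
    have "0 < lst (B c) (total z)" by (intro lst_pos service_nonneg_law total_nonneg z)
    then have "ennreal (z c) \<noteq> 0" "ennreal (z c) \<noteq> top" by (simp_all flip: root[OF True])
    then show ?thesis
      using served_summand[where z = z and k = k and i = i and n = n and c = c, OF z]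
      unfolding root[OF True, symmetric] by (simp add: ennreal_mult_cancel_left)
  qed (simp add: served_summand_eq_0)
qed

text \<open>The submartingale version: a service raises the weight at least by the factor
  \<alpha>.\<close>

lemma served_weight_ge:
  assumes z: "\<And>e. 0 < z e" "\<And>e. z e \<le> 1" and \<alpha>: "0 \<le> \<alpha>"
    and sub: "\<And>c. q c = i \<Longrightarrow> \<alpha> * z c \<le> lst (B c) (total z)"
  shows "ennreal \<alpha> * serving_weight k i z n \<le> served_weight k i z n"
  unfolding served_weight_eq_sum serving_weight_eq_sum sum_distrib_left
proof (rule sum_mono)
  fix c :: 'c
  let ?P = "\<lambda>\<omega>. of_bool (present k i (dstate n \<omega>) \<and> d i (fst (snd (dstate n \<omega>))) = Some c) :: ennreal"
  let ?S = "\<integral>\<^sup>+\<omega>. ?P \<omega> * weight z (dstate n \<omega>) \<partial>M"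
  let ?T = "\<integral>\<^sup>+\<omega>. ?P \<omega> * weight z (dstate (Suc n) \<omega>) \<partial>M"
  show "ennreal \<alpha> * ?S \<le> ?T"
  proof (cases "q c = i")
    case True
    have "ennreal (z c) * (ennreal \<alpha> * ?S) = ennreal (\<alpha> * z c) * ?S"
      using z(1)[of c] \<alpha> by (simp add: ennreal_mult mult_ac)
    also have "\<dots> \<le> ennreal (lst (B c) (total z)) * ?S"
      by (intro mult_right_mono ennreal_leI sub True) simp
    also have "\<dots> = ennreal (z c) * ?T"
      by (rule served_summand[OF less_imp_le[OF z(1)] z(2), symmetric])
    finally show ?thesis
      using z(1)[of c] by (simp add: ennreal_mult_le_mult_iff)
  qed (simp add: served_summand_eq_0)
qed

lemma weight_1: "weight (\<lambda>_. 1) x = 1"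
  by (simp add: weight_def monomial_def)

lemma weight_le_1:
  assumes "\<And>e. 0 \<le> z e" "\<And>e. z e \<le> 1"
  shows "weight z x \<le> 1"
  unfolding weight_def monomial_def ennreal_le_1
  using assms by (intro prod_le_1) (auto intro: power_le_one)

text \<open>This is where exhaustive service enters: at the end of a visit all exponents that belong
  to the visited queue are 0. Hence the arguments of its types may be chosen freely, in particular
  as a root.\<close>

lemma weight_ending_cong:
  assumes "ending k i x" "\<And>c. q c \<noteq> i \<Longrightarrow> z c = w c"
  shows "weight z x = weight w x"
proof -
  have "fst (snd x) c = 0" if "q c = i" for c
    using assms(1) leaves[OF _ that] by (auto simp: ending_def)
  then show ?thesis
    unfolding weight_def monomial_def using assms(2)
    by (intro arg_cong[where f = ennreal] prod.cong) (auto, metis power_0)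
qed

lemma ending_weight_cong:
  assumes "\<And>c. q c \<noteq> i \<Longrightarrow> z c = w c"
  shows "ending_weight k i z n = ending_weight k i w n"
  unfolding ending_weight_def
proof (rule nn_integral_cong)
  fix \<omega>
  show "of_bool (ending k i (dstate n \<omega>)) * weight z (dstate n \<omega>) =
      of_bool (ending k i (dstate n \<omega>)) * weight w (dstate n \<omega>)"
    using weight_ending_cong[of k i "dstate n \<omega>" z w] assms
    by (cases "ending k i (dstate n \<omega>)") simp_all
qed

lemma entering_unique: "entering k m \<omega> \<Longrightarrow> entering k n \<omega> \<Longrightarrow> m = n"
  unfolding entering_def by (metis linorder_neqE_nat)

lemma ending_iff_entering:
  "ending k i (dstate n \<omega>) \<longleftrightarrow> entering (Suc k) (Suc n) \<omega> \<and> location (state n \<omega>) = i"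
  by (auto simp: ending_def present_def entering_Suc dstate_eq)

lemma polled_eq: "entering k n \<omega> \<Longrightarrow> polled d I k \<omega> = (location (state n \<omega>), content (state n \<omega>))"
proof -
  assume n: "entering k n \<omega>"
  have "(LEAST n. visits (state n \<omega>) = k) = n"
    by (rule Least_equality) (use n in \<open>auto simp: entering_def not_le[symmetric]\<close>)
  then show ?thesis by (simp add: polled_def Let_def)
qed

definition reached :: "nat \<Rightarrow> 'a \<Rightarrow> bool" where
  "reached k \<omega> \<longleftrightarrow> (\<exists>n. entering k n \<omega>)"

lemma reached_iff: "reached k \<omega> \<longleftrightarrow> (\<exists>n. visits (state n \<omega>) = k)"
proof
  assume "\<exists>n. visits (state n \<omega>) = k"
  then have "entering k (LEAST n. visits (state n \<omega>) = k) \<omega>"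
    by (auto simp: entering_def dest: not_less_Least intro: LeastI)
  then show "reached k \<omega>" by (auto simp: reached_def)
qed (auto simp: reached_def entering_def)

text \<open>The factor \<open>reached\<close> removes the sample points at which
  \<open>polled\<close> is an arbitrary value; \<open>AE_reached\<close> will show that they form a
  null set.\<close>

definition polled_weight :: "nat \<Rightarrow> queue \<Rightarrow> ('c \<Rightarrow> real) \<Rightarrow> ennreal" where
  "polled_weight k i z = (\<integral>\<^sup>+\<omega>. of_bool (reached k \<omega> \<and> fst (polled d I k \<omega>) = i) *
    ennreal (monomial z (snd (polled d I k \<omega>))) \<partial>M)"

lemma suminf_entering_weight: "(\<Sum>n. entering_weight k i z n) = polled_weight k i z"
proof -
  have "(\<Sum>n. entering_weight k i z n)
      = (\<integral>\<^sup>+\<omega>. (\<Sum>n. of_bool (entering k n \<omega> \<and> fst (dstate n \<omega>) = i) * weight z (dstate n \<omega>)) \<partial>M)"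
    unfolding entering_weight_def by (rule nn_integral_suminf[symmetric]) (rule entering_measurable_weight)
  also have "\<dots> = polled_weight k i z"
    unfolding polled_weight_def
  proof (rule nn_integral_cong)
    fix \<omega>
    show "(\<Sum>n. of_bool (entering k n \<omega> \<and> fst (dstate n \<omega>) = i) * weight z (dstate n \<omega>))
      = of_bool (reached k \<omega> \<and> fst (polled d I k \<omega>) = i) * ennreal (monomial z (snd (polled d I k \<omega>)))"
    proof (cases "\<exists>n. entering k n \<omega>")
      case True
      then obtain n where n: "entering k n \<omega>" by blast
      have split: "of_bool (entering k m \<omega> \<and> fst (dstate m \<omega>) = i) * weight z (dstate m \<omega>)
          = of_bool (entering k m \<omega>) * (of_bool (fst (dstate m \<omega>) = i) * weight z (dstate m \<omega>))" for m
        by simp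
      have "(\<Sum>m. of_bool (entering k m \<omega> \<and> fst (dstate m \<omega>) = i) * weight z (dstate m \<omega>))
          = of_bool (fst (dstate n \<omega>) = i) * weight z (dstate n \<omega>)"
        unfolding split by (rule suminf_of_bool_unique[where P = "\<lambda>m. entering k m \<omega>", OF entering_unique n])
      then show ?thesis
        using True by (auto simp: reached_def polled_eq[OF n] dstate_eq weight_def)
    qed (simp add: reached_def)
  qed
  finally show ?thesis .
qed

lemma reached_measurable: "{\<omega> \<in> space M. reached k \<omega>} \<in> sets M"
proof -
  have "Measurable.pred M (\<lambda>\<omega>. snd (snd (snd (dstate n \<omega>))) = k)" for n
    by (rule pred_eq_const1[OF measurable_compose[OF dstate_measurable, where L = "count_space UNIV"]]) simp_all
  then have "Measurable.pred M (\<lambda>\<omega>. visits (state n \<omega>) = k)" for n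
    by (simp only: dstate_eq snd_conv)
  then have "Measurable.pred M (\<lambda>\<omega>. \<exists>n. visits (state n \<omega>) = k)"
    by (intro pred_intros_countable)
  then show ?thesis unfolding reached_iff by (rule predE)
qed

text \<open>A visit ends at most once, at one queue, and its end leads to epoch
  \<open>Suc k\<close>. So the double sum is a probability.\<close>

lemma sum_ending_weight_1:
  "(\<Sum>i\<in>UNIV. \<Sum>n. ending_weight k i (\<lambda>_. 1) n) = emeasure M {\<omega> \<in> space M. reached (Suc k) \<omega>}"
proof -
  have m: "(\<lambda>\<omega>. of_bool (ending k i (dstate n \<omega>)) :: ennreal) \<in> borel_measurable M" for i n
    by (rule measurable_of_dstate)
  have "(\<Sum>i\<in>UNIV. \<Sum>n. ending_weight k i (\<lambda>_. 1) n)
      = (\<Sum>i\<in>UNIV. \<integral>\<^sup>+\<omega>. (\<Sum>n. of_bool (ending k i (dstate n \<omega>))) \<partial>M)"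
    unfolding ending_weight_def weight_1 mult_1_right by (simp only: nn_integral_suminf[OF m])
  also have "\<dots> = (\<integral>\<^sup>+\<omega>. (\<Sum>i\<in>UNIV. \<Sum>n. of_bool (ending k i (dstate n \<omega>))) \<partial>M)"
    by (rule nn_integral_sum[symmetric]) (intro borel_measurable_suminf_order m)
  also have "\<dots> = (\<integral>\<^sup>+\<omega>. of_bool (reached (Suc k) \<omega>) \<partial>M)"
  proof (rule nn_integral_cong)
    fix \<omega>
    show "(\<Sum>i\<in>UNIV. \<Sum>n. of_bool (ending k i (dstate n \<omega>))) = (of_bool (reached (Suc k) \<omega>) :: ennreal)"
    proof (cases "reached (Suc k) \<omega>")
      case True
      then obtain n' where n': "entering (Suc k) n' \<omega>" by (auto simp: reached_def)
      then obtain n where n: "entering (Suc k) (Suc n) \<omega>" by (cases n') (auto simp: entering_0)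
      let ?P = "\<lambda>m. entering (Suc k) (Suc m) \<omega>"
      have "(\<Sum>m. of_bool (ending k i (dstate m \<omega>))) = (of_bool (location (state n \<omega>) = i) :: ennreal)" for i
      proof -
        have "of_bool (ending k i (dstate m \<omega>)) = (of_bool (?P m) * of_bool (location (state m \<omega>) = i) :: ennreal)" for m
          by (simp add: ending_iff_entering)
        then show ?thesis
          by (simp only:) (rule suminf_of_bool_unique[of ?P], auto dest: entering_unique simp: n)
      qed
      then show ?thesis using True by (cases "location (state n \<omega>)") (simp_all add: UNIV_queue)
    next
      case False
      then have "\<not> ending k i (dstate n \<omega>)" for i n
        by (auto simp: ending_iff_entering reached_def)
      then show ?thesis using False by simp
    qed
  qed
  also have "\<dots> = emeasure M {\<omega> \<in> space M. reached (Suc k) \<omega>}"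
    by (rule nn_integral_of_bool[OF reached_measurable])
  finally show ?thesis .
qed

lemma suminf_ending_weight_le_1:
  assumes "\<And>e. 0 \<le> z e" "\<And>e. z e \<le> 1"
  shows "(\<Sum>n. ending_weight k i z n) \<le> 1"
proof -
  have "(\<Sum>n. ending_weight k i z n) \<le> (\<Sum>n. ending_weight k i (\<lambda>_. 1) n)"
    unfolding ending_weight_def weight_1
    by (intro suminf_le nn_integral_mono mult_left_mono weight_le_1 assms) auto
  also have "\<dots> \<le> (\<Sum>i\<in>UNIV. \<Sum>n. ending_weight k i (\<lambda>_. 1) n)"
    by (rule member_le_sum) auto
  also have "\<dots> \<le> 1" unfolding sum_ending_weight_1 by (rule emeasure_le_1)
  finally show ?thesis .
qed

lemma present_weight_le:
  assumes "\<And>e. 0 \<le> z e" "\<And>e. z e \<le> 1"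
  shows "present_weight k i z n \<le> (\<integral>\<^sup>+\<omega>. of_bool (visits (state n \<omega>) = k) \<partial>M)"
  unfolding present_weight_def
proof (rule nn_integral_mono)
  fix \<omega>
  show "of_bool (present k i (dstate n \<omega>)) * weight z (dstate n \<omega>) \<le> of_bool (visits (state n \<omega>) = k)"
    using weight_le_1[of z "dstate n \<omega>"] assms by (auto simp: present_def dstate_eq)
qed

text \<open>Every service raises the weight by a factor of at least \<open>1 + \<eta>\<close>,
  whereas all weights are bounded. So the weight in service is summable over the steps, the weight
  present tends to 0, and the weight that leaves accounts for all that has entered.\<close>

lemma entering_weight_le_ending_weight:
  assumes z: "\<And>e. 0 < z e" "\<And>e. z e \<le> 1" and \<eta>: "0 < \<eta>"
    and sub: "\<And>c. q c = i \<Longrightarrow> (1 + \<eta>) * z c \<le> lst (B c) (total z)"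
  shows "(\<Sum>n. entering_weight k i z n) \<le> (\<Sum>n. ending_weight k i z n)"
proof -
  let ?P = "present_weight k i z" and ?E = "ending_weight k i z" and ?S = "serving_weight k i z"
    and ?A = "entering_weight k i z"
  have z0: "0 \<le> z e" for e using z(1)[of e] by simp
  have step: "?A (Suc n) + ennreal (1 + \<eta>) * ?S n \<le> ?P (Suc n)" for n
    unfolding present_weight_Suc by (intro add_left_mono served_weight_ge z sub) (use \<eta> in auto)
  \<comment> \<open>Inflow up to step \<open>m\<close> plus the gain from services, against what is
    still present plus what has left.\<close>
  have main: "(\<Sum>n<Suc m. ?A n) + ennreal \<eta> * (\<Sum>n<m. ?S n) \<le> ?P m + (\<Sum>n<m. ?E n)" for m
  proof (induction m)
    case 0
    then show ?case by (simp add: present_weight_0)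
  next
    case (Suc m)
    have "(\<Sum>n<Suc (Suc m). ?A n) + ennreal \<eta> * (\<Sum>n<Suc m. ?S n)
        = ((\<Sum>n<Suc m. ?A n) + ennreal \<eta> * (\<Sum>n<m. ?S n)) + (?A (Suc m) + ennreal \<eta> * ?S m)"
      by (simp add: distrib_left add_ac)
    also have "\<dots> \<le> (?P m + (\<Sum>n<m. ?E n)) + (?A (Suc m) + ennreal \<eta> * ?S m)"
      by (intro add_right_mono Suc)
    also have "\<dots> = (\<Sum>n<Suc m. ?E n) + (?A (Suc m) + ennreal (1 + \<eta>) * ?S m)"
      using \<eta> by (simp add: present_weight_split distrib_right add_ac)
    also have "\<dots> \<le> (\<Sum>n<Suc m. ?E n) + ?P (Suc m)" by (intro add_left_mono step)
    finally show ?case by (simp add: add_ac)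
  qed
  have P_le: "?P n \<le> 1" for n
  proof -
    have "?P n \<le> (\<integral>\<^sup>+\<omega>. of_bool (visits (state n \<omega>) = k) \<partial>M)" by (intro present_weight_le z0 z)
    also have "\<dots> \<le> (\<integral>\<^sup>+\<omega>. 1 \<partial>M)" by (intro nn_integral_mono) auto
    finally show ?thesis by (simp add: emeasure_space_1)
  qed
  have E_le: "(\<Sum>n. ?E n) \<le> 1" by (intro suminf_ending_weight_le_1 z0 z)
  have E_part: "(\<Sum>n<m. ?E n) \<le> (\<Sum>n. ?E n)" for m by (rule sum_le_suminf) auto
  \<comment> \<open>Both terms on the right of \<open>main\<close> are at most 1.\<close>
  have "(\<Sum>n<m. ?S n) \<le> ennreal (2 / \<eta>)" for m
  proof -
    have "ennreal \<eta> * (\<Sum>n<m. ?S n) \<le> (\<Sum>n<Suc m. ?A n) + ennreal \<eta> * (\<Sum>n<m. ?S n)"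
      by (simp add: add_increasing)
    also have "\<dots> \<le> ?P m + (\<Sum>n<m. ?E n)" by (rule main)
    also have "\<dots> \<le> 1 + 1" by (intro add_mono P_le order_trans[OF E_part E_le])
    finally have "ennreal \<eta> * (\<Sum>k<m. ?S k) \<le> ennreal 2" by simp
    then have "ennreal (1 / \<eta>) * (ennreal \<eta> * (\<Sum>k<m. ?S k)) \<le> ennreal (1 / \<eta>) * ennreal 2"
      by (intro mult_left_mono) auto
    then show ?thesis using \<eta> by (simp add: mult.assoc[symmetric] ennreal_mult[symmetric] del: ennreal_numeral)
  qed
  then have "(\<Sum>n. ?S n) \<le> ennreal (2 / \<eta>)" by (intro suminf_le_const) auto
  then have "?S \<longlonglongrightarrow> 0" by (intro ennreal_summable_tendsto_0) (simp add: le_less_trans)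
  moreover have "?E \<longlonglongrightarrow> 0"
    by (intro ennreal_summable_tendsto_0) (use E_le in \<open>simp add: le_less_trans\<close>)
  ultimately have "(\<lambda>m. ?S m + ?E m) \<longlonglongrightarrow> 0 + 0" by (rule tendsto_add)
  then have P0: "?P \<longlonglongrightarrow> 0" by (simp add: present_weight_split[symmetric])
  have "(\<Sum>n<Suc m. ?A n) \<le> ?P m + (\<Sum>n. ?E n)" for m
  proof -
    have "(\<Sum>n<Suc m. ?A n) \<le> (\<Sum>n<Suc m. ?A n) + ennreal \<eta> * (\<Sum>n<m. ?S n)"
      by (simp add: add_increasing2)
    also have "\<dots> \<le> ?P m + (\<Sum>n<m. ?E n)" by (rule main)
    finally show ?thesis using E_part[of m] by (meson add_left_mono order_trans)
  qed
  moreover have "(\<lambda>m. \<Sum>n<Suc m. ?A n) \<longlonglongrightarrow> (\<Sum>n. ?A n)"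
    by (intro LIMSEQ_Suc[OF summable_LIMSEQ]) auto
  moreover have "(\<lambda>m. ?P m + (\<Sum>n. ?E n)) \<longlonglongrightarrow> 0 + (\<Sum>n. ?E n)"
    by (intro tendsto_add P0 tendsto_const)
  ultimately have "(\<Sum>n. ?A n) \<le> 0 + (\<Sum>n. ?E n)" by (intro LIMSEQ_le) auto
  then show ?thesis by simp
qed

text \<open>Optional stopping for the martingale of a visit. The mass still present is at most the
  probability that visit \<open>k\<close> is in progress, which tends to 0 since the visit ends
  almost surely.\<close>

lemma entering_weight_eq_ending_weight:
  assumes z: "\<And>e. 0 \<le> z e" "\<And>e. z e \<le> 1"
    and root: "\<And>c. q c = i \<Longrightarrow> z c = lst (B c) (total z)"
    and leave: "AE \<omega> in M. reached (Suc k) \<omega>"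
  shows "(\<Sum>n. entering_weight k i z n) = (\<Sum>n. ending_weight k i z n)"
proof -
  let ?P = "present_weight k i z" and ?E = "ending_weight k i z" and ?A = "entering_weight k i z"
  have served: "served_weight k i z m = serving_weight k i z m" for m
    by (rule served_weight_eq) (use z root in auto)
  have main: "(\<Sum>n<Suc m. ?A n) = ?P m + (\<Sum>n<m. ?E n)" for m
  proof (induction m)
    case 0
    then show ?case by (simp add: present_weight_0)
  next
    case (Suc m)
    have "(\<Sum>n<Suc (Suc m). ?A n) = ?P m + (\<Sum>n<m. ?E n) + ?A (Suc m)"
      using Suc by simp
    also have "\<dots> = ?P (Suc m) + (\<Sum>n<Suc m. ?E n)"
      unfolding present_weight_Suc present_weight_split[of k i z m] served
      by (simp add: add_ac)
    finally show ?case .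
  qed
  have "(\<lambda>n. \<integral>\<^sup>+\<omega>. of_bool (visits (state n \<omega>) = k) \<partial>M) \<longlonglongrightarrow> (\<integral>\<^sup>+\<omega>. 0 \<partial>M)"
  proof (rule nn_integral_dominated_convergence[where w = "\<lambda>_. 1"])
    show "AE \<omega> in M. (\<lambda>n. of_bool (visits (state n \<omega>) = k) :: ennreal) \<longlonglongrightarrow> 0"
      using leave
    proof eventually_elim
      case (elim \<omega>)
      then obtain m where m: "visits (state m \<omega>) = Suc k" by (auto simp: reached_iff)
      have "visits (state n \<omega>) \<noteq> k" if "m \<le> n" for n using visits_mono[OF that, of \<omega>] m by simp
      then have "eventually (\<lambda>n. of_bool (visits (state n \<omega>) = k) = (0::ennreal)) sequentially"
        by (auto simp: eventually_sequentially)
      then show ?case by (rule tendsto_eventually)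
    qed
    show "(\<lambda>\<omega>. of_bool (visits (state n \<omega>) = k) :: ennreal) \<in> borel_measurable M" for n
      using measurable_of_dstate[of "\<lambda>x. of_bool (snd (snd (snd x)) = k) :: ennreal" n]
      by (simp only: dstate_eq snd_conv)
  qed (auto simp: emeasure_space_1)
  then have "?P \<longlonglongrightarrow> 0"
    by (intro ennreal_tendsto_0_le[where f = ?P and g = "\<lambda>n. \<integral>\<^sup>+\<omega>. of_bool (visits (state n \<omega>) = k) \<partial>M"]
        present_weight_le z) simp
  then have "(\<lambda>m. ?P m + (\<Sum>n<m. ?E n)) \<longlonglongrightarrow> 0 + (\<Sum>n. ?E n)"
    by (intro tendsto_add summable_LIMSEQ) auto
  moreover have "(\<lambda>m. \<Sum>n<Suc m. ?A n) \<longlonglongrightarrow> (\<Sum>n. ?A n)"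
    by (intro LIMSEQ_Suc[OF summable_LIMSEQ]) auto
  ultimately have "(\<Sum>n. ?A n) = 0 + (\<Sum>n. ?E n)"
    unfolding main by (rule LIMSEQ_unique[rotated])
  then show ?thesis by simp
qed

lemma entering_weight_Suc:
  assumes z: "\<And>e. 0 \<le> z e" "\<And>e. z e \<le> 1"
  shows "entering_weight (Suc k) j z (Suc n) =
    (\<Sum>i\<in>UNIV. ennreal (routing i j * lst (S i j) (total z)) * ending_weight k i z n)"
proof -
  define h where "h i x y = of_bool (ending k i x \<and> fst y = j) * weight z y" for i and x y :: "'c dstate"
  have "entering_weight (Suc k) j z (Suc n) = (\<integral>\<^sup>+\<omega>. (\<Sum>i\<in>UNIV. h i (dstate n \<omega>) (dstate (Suc n) \<omega>)) \<partial>M)"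
    unfolding entering_weight_def
  proof (rule nn_integral_cong)
    fix \<omega>
    show "of_bool (entering (Suc k) (Suc n) \<omega> \<and> fst (dstate (Suc n) \<omega>) = j) * weight z (dstate (Suc n) \<omega>)
        = (\<Sum>i\<in>UNIV. h i (dstate n \<omega>) (dstate (Suc n) \<omega>))"
      by (cases "location (state n \<omega>)") (simp_all add: h_def ending_iff_entering UNIV_queue)
  qed
  also have "\<dots> = (\<Sum>i\<in>UNIV. \<integral>\<^sup>+\<omega>. h i (dstate n \<omega>) (dstate (Suc n) \<omega>) \<partial>M)"
    by (rule nn_integral_sum) (rule measurable_of_two_dstates)
  also have "\<dots> = (\<Sum>i\<in>UNIV. ennreal (routing i j * lst (S i j) (total z)) * ending_weight k i z n)"
    using switch_transition[OF z, where k = k and n = n and j = j]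
    by (intro sum.cong) (auto simp: h_def ending_weight_def ending_def present_def weight_def dstate_eq conj_assoc)
  finally show ?thesis .
qed

lemma polled_weight_Suc:
  assumes z: "\<And>e. 0 \<le> z e" "\<And>e. z e \<le> 1"
  shows "polled_weight (Suc k) j z =
    (\<Sum>i\<in>UNIV. ennreal (routing i j * lst (S i j) (total z)) * (\<Sum>n. ending_weight k i z n))"
proof -
  have "polled_weight (Suc k) j z = (\<Sum>n. entering_weight (Suc k) j z n)"
    by (rule suminf_entering_weight[symmetric])
  also have "\<dots> = (\<Sum>n. entering_weight (Suc k) j z (Suc n)) + entering_weight (Suc k) j z 0"
    by (subst suminf_offset[where i = 1]) auto
  also have "entering_weight (Suc k) j z 0 = 0"
    by (simp add: entering_weight_def entering_0)
  also have "(\<Sum>n. entering_weight (Suc k) j z (Suc n))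
      = (\<Sum>i\<in>UNIV. \<Sum>n. ennreal (routing i j * lst (S i j) (total z)) * ending_weight k i z n)"
    unfolding entering_weight_Suc[OF z] by (rule suminf_sum) auto
  finally show ?thesis by simp
qed

end

text \<open>Finiteness of a visit is a matter of the load of the visited queue; the total load
  enters later, through the contraction.\<close>

locale stable_polling = exhaustive_polling M lam B S p I d q
  for M :: "'a measure" and lam :: "'c::finite \<Rightarrow> real" and B S p
    and I :: "('a, 'c) polling_input" and d q +
  assumes load: "(\<Sum>c | q c = i. lam c * mean (B c)) < 1"
begin

text \<open>Weights slightly below \<open>1\<close>, decreasing in the mean service time, give a strict submartingale during a
  visit to \<open>i\<close>. The summand \<open>\<delta>\<close> takes care of types with service time \<open>0\<close>.\<close>

definition drift_weight :: "queue \<Rightarrow> real \<Rightarrow> real \<Rightarrow> 'c \<Rightarrow> real" where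
  "drift_weight i \<delta> \<epsilon> c = (if q c = i then 1 - \<epsilon> * (mean (B c) + \<delta>) else 1)"

lemma drift_weight_submartingale:
  "\<exists>\<epsilon>0 \<delta>. 0 < \<epsilon>0 \<and> 0 < \<delta> \<and> (\<forall>\<epsilon>. 0 < \<epsilon> \<and> \<epsilon> \<le> \<epsilon>0 \<longrightarrow>
    (\<forall>c. 0 < drift_weight i \<delta> \<epsilon> c \<and> drift_weight i \<delta> \<epsilon> c \<le> 1 \<and>
      (q c = i \<longrightarrow> (1 + \<epsilon> * \<delta>) * drift_weight i \<delta> \<epsilon> c \<le> lst (B c) (total (drift_weight i \<delta> \<epsilon>)))))"
proof -
  define l where "l = (\<Sum>c | q c = i. lam c)"
  define \<rho> where "\<rho> = (\<Sum>c | q c = i. lam c * mean (B c))"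
  \<comment> \<open>Solves \<open>\<rho> + \<delta> * (1 + l) = 1\<close>, so that the discount rate
    \<open>\<epsilon> * (\<rho> + \<delta> * l)\<close> is at most \<epsilon>. The summand 1 keeps
    the denominator positive.\<close>
  define \<delta> where "\<delta> = (1 - \<rho>) / (1 + l)"
  define \<mu> where "\<mu> = (\<Sum>c\<in>UNIV. mean (B c))"
  have l: "0 \<le> l" unfolding l_def using lam_pos by (intro sum_nonneg) (auto intro: less_imp_le)
  have m: "0 \<le> mean (B c)" for c by (rule mean_nonneg[OF service_nonneg_law])
  have \<rho>: "\<rho> < 1" unfolding \<rho>_def by (rule load)
  have \<delta>: "0 < \<delta>" using \<rho> l by (simp add: \<delta>_def)
  have "\<delta> * (1 + l) = 1 - \<rho>" using l by (simp add: \<delta>_def)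
  then have \<rho>\<delta>: "\<rho> + \<delta> * l \<le> 1" using \<delta> by (simp add: algebra_simps)
  have \<mu>: "mean (B c) \<le> \<mu>" "0 \<le> \<mu>" for c
    unfolding \<mu>_def using m by (auto intro: member_le_sum sum_nonneg)
  \<comment> \<open>Keeps \<open>\<epsilon> * (mean (B c) + \<delta>)\<close> at most 1/2 for every
    type, so that all weights are positive.\<close>
  define \<epsilon>0 where "\<epsilon>0 = 1 / (2 * (\<mu> + \<delta>))"
  have \<epsilon>0: "0 < \<epsilon>0" using \<mu> \<delta> by (simp add: \<epsilon>0_def add_nonneg_pos)
  show ?thesis
  proof (rule exI[of _ \<epsilon>0], rule exI[of _ \<delta>], rule conjI[OF \<epsilon>0 conjI[OF \<delta>]], rule allI, rule impI, rule allI)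
    fix \<epsilon> c'
    assume *: "0 < \<epsilon> \<and> \<epsilon> \<le> \<epsilon>0"
    define z where "z = drift_weight i \<delta> \<epsilon>"
    have \<epsilon>: "0 < \<epsilon>" "\<epsilon> \<le> \<epsilon>0" and z: "z c = (if q c = i then 1 - \<epsilon> * (mean (B c) + \<delta>) else 1)" for c
      using * by (auto simp: z_def drift_weight_def)
    have small: "\<epsilon> * (mean (B c) + \<delta>) \<le> 1 / 2" for c
    proof -
      have "\<epsilon> * (mean (B c) + \<delta>) \<le> \<epsilon>0 * (\<mu> + \<delta>)"
        using \<epsilon> \<mu> \<delta> m[of c] by (intro mult_mono) auto
      also have "\<dots> = 1 / 2"
      proof -
        have "\<mu> + \<delta> \<noteq> 0" using \<mu>(2) \<delta> by linarith
        then show ?thesis by (simp add: \<epsilon>0_def)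
      qed
      finally show ?thesis .
    qed
    have pos: "0 < z c \<and> z c \<le> 1" for c
      using small[of c] \<epsilon> m[of c] \<delta> by (auto simp: z)
    have "total z = (\<Sum>c\<in>UNIV. if q c = i then lam c * (\<epsilon> * (mean (B c) + \<delta>)) else 0)"
      unfolding total_def by (intro sum.cong) (auto simp: z)
    also have "\<dots> = (\<Sum>c | q c = i. lam c * (\<epsilon> * (mean (B c) + \<delta>)))"
      by (simp add: sum.If_cases)
    also have "\<dots> = \<epsilon> * (\<rho> + \<delta> * l)"
      by (simp add: \<rho>_def l_def sum_distrib_left sum.distrib algebra_simps)
    also have "\<dots> \<le> \<epsilon> * 1" using \<epsilon> \<rho>\<delta> by (intro mult_left_mono) auto
    finally have tot: "total z \<le> \<epsilon>" by simp
    have tot0: "0 \<le> total z" by (rule total_nonneg) (use pos in auto)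
    have "(1 + \<epsilon> * \<delta>) * z c \<le> lst (B c) (total z)" if c: "q c = i" for c
    proof -
      \<comment> \<open>The required growth uses up the summand \<delta> of the weight; what is left
        is the tangent bound for the LST at a discount rate of at most \<epsilon>.\<close>
      have "(1 + \<epsilon> * \<delta>) * z c = z c + \<epsilon> * \<delta> * z c" by (simp add: algebra_simps)
      also have "\<dots> \<le> z c + \<epsilon> * \<delta> * 1"
        using pos[of c] \<epsilon> \<delta> by (intro add_left_mono mult_left_mono) auto
      also have "\<dots> = 1 - \<epsilon> * mean (B c)" using c by (simp add: z algebra_simps)
      also have "\<dots> \<le> 1 - total z * mean (B c)"
        using tot m[of c] by (simp add: mult_right_mono)
      also have "\<dots> \<le> lst (B c) (total z)" by (rule lst_ge_linear[OF service_nonneg_law tot0])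
      finally show ?thesis .
    qed
    then show "0 < drift_weight i \<delta> \<epsilon> c' \<and> drift_weight i \<delta> \<epsilon> c' \<le> 1 \<and>
      (q c' = i \<longrightarrow> (1 + \<epsilon> * \<delta>) * drift_weight i \<delta> \<epsilon> c' \<le> lst (B c') (total (drift_weight i \<delta> \<epsilon>)))"
      using pos[of c'] unfolding z_def by blast
  qed
qed

lemma polled_measurable: "polled d I k \<in> measurable M (count_space UNIV)"
proof -
  have "Measurable.pred M (\<lambda>\<omega>. snd (snd (snd (dstate n \<omega>))) = k)" for n
    by (rule pred_eq_const1[OF measurable_compose[OF dstate_measurable, where L = "count_space UNIV"]]) simp_all
  then have "(\<lambda>\<omega>. LEAST n. snd (snd (snd (dstate n \<omega>))) = k) \<in> measurable M (count_space UNIV)"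
    by (rule measurable_Least)
  then have "(\<lambda>\<omega>. (\<lambda>x. (fst x, fst (snd x))) (dstate (LEAST n. snd (snd (snd (dstate n \<omega>))) = k) \<omega>))
      \<in> measurable M (count_space UNIV)"
    by (intro measurable_compose[OF measurable_compose_countable[OF dstate_measurable]]) simp_all
  also have "(\<lambda>\<omega>. (\<lambda>x. (fst x, fst (snd x))) (dstate (LEAST n. snd (snd (snd (dstate n \<omega>))) = k) \<omega>)) = polled d I k"
    by (simp add: fun_eq_iff polled_def Let_def dstate_eq)
  finally show ?thesis .
qed

lemma polled_weight_integrand_measurable:
  "(\<lambda>\<omega>. of_bool (reached k \<omega> \<and> fst (polled d I k \<omega>) = i) * ennreal (monomial z (snd (polled d I k \<omega>))))
    \<in> borel_measurable M"
proof -
  have r: "(\<lambda>\<omega>. of_bool (reached k \<omega>) :: ennreal) \<in> borel_measurable M"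
    by (rule borel_measurable_of_bool_pred) (use reached_measurable in \<open>simp add: pred_def\<close>)
  have "(\<lambda>\<omega>. of_bool (fst (polled d I k \<omega>) = i) * ennreal (monomial z (snd (polled d I k \<omega>)))) \<in> borel_measurable M"
    by (rule measurable_compose[OF polled_measurable]) simp
  with r have "(\<lambda>\<omega>. of_bool (reached k \<omega>) * (of_bool (fst (polled d I k \<omega>) = i) * ennreal (monomial z (snd (polled d I k \<omega>)))))
      \<in> borel_measurable M"
    by (rule borel_measurable_times_ennreal)
  then show ?thesis by (simp only: of_bool_conj mult.assoc)
qed

lemma polled_weight_tendsto:
  assumes z: "\<And>j e. 0 \<le> z j e" "\<And>j e. z j e \<le> 1" "\<And>e. (\<lambda>j. z j e) \<longlonglongrightarrow> 1"
  shows "(\<lambda>j. polled_weight k i (z j)) \<longlonglongrightarrow> polled_weight k i (\<lambda>_. 1)"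
  unfolding polled_weight_def
proof (rule nn_integral_dominated_convergence[where w = "\<lambda>_. 1"])
  have "(\<lambda>j. monomial (z j) n) \<longlonglongrightarrow> monomial (\<lambda>_. 1) n" for n
    unfolding monomial_def by (intro tendsto_prod tendsto_power z)
  then show "AE \<omega> in M. (\<lambda>j. of_bool (reached k \<omega> \<and> fst (polled d I k \<omega>) = i) *
      ennreal (monomial (z j) (snd (polled d I k \<omega>)))) \<longlonglongrightarrow>
      of_bool (reached k \<omega> \<and> fst (polled d I k \<omega>) = i) * ennreal (monomial (\<lambda>_. 1) (snd (polled d I k \<omega>)))"
    by (intro AE_I2 ennreal_tendsto_cmult tendsto_ennrealI) auto
  fix j
  have "monomial (z j) n \<le> 1" for n
    unfolding monomial_def using z by (intro prod_le_1) (auto intro: power_le_one)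
  then show "AE \<omega> in M. of_bool (reached k \<omega> \<and> fst (polled d I k \<omega>) = i) *
      ennreal (monomial (z j) (snd (polled d I k \<omega>))) \<le> 1"
    by (intro AE_I2) (auto simp: ennreal_le_1)
qed (auto simp: emeasure_space_1 intro!: polled_weight_integrand_measurable)

text \<open>The drift weights differ from 1 only at the visited queue, so they do not change the
  ending weights, while the weights at the start of the visit tend to the undiscounted ones as
  \<epsilon> goes to 0.\<close>

lemma polled_weight_le_ending_weight:
  "polled_weight k i (\<lambda>_. 1) \<le> (\<Sum>n. ending_weight k i (\<lambda>_. 1) n)"
proof -
  obtain \<epsilon>0 \<delta> where \<epsilon>0: "0 < \<epsilon>0" and \<delta>: "0 < \<delta>"
    and sub: "\<forall>\<epsilon>. 0 < \<epsilon> \<and> \<epsilon> \<le> \<epsilon>0 \<longrightarrow>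
    (\<forall>c. 0 < drift_weight i \<delta> \<epsilon> c \<and> drift_weight i \<delta> \<epsilon> c \<le> 1 \<and>
      (q c = i \<longrightarrow> (1 + \<epsilon> * \<delta>) * drift_weight i \<delta> \<epsilon> c \<le> lst (B c) (total (drift_weight i \<delta> \<epsilon>))))"
    using drift_weight_submartingale[of i] by blast
  define \<epsilon> where "\<epsilon> j = \<epsilon>0 / real (Suc j)" for j
  define z where "z j = drift_weight i \<delta> (\<epsilon> j)" for j
  have \<epsilon>: "0 < \<epsilon> j" "\<epsilon> j \<le> \<epsilon>0" for j
  proof -
    show "0 < \<epsilon> j" using \<epsilon>0 unfolding \<epsilon>_def by (intro divide_pos_pos) auto
    have "\<epsilon>0 / real (Suc j) \<le> \<epsilon>0 / 1" using \<epsilon>0 by (intro divide_left_mono) auto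
    then show "\<epsilon> j \<le> \<epsilon>0" unfolding \<epsilon>_def by (simp only: div_by_1)
  qed
  have sub_z: "0 < z j c \<and> z j c \<le> 1 \<and> (q c = i \<longrightarrow> (1 + \<epsilon> j * \<delta>) * z j c \<le> lst (B c) (total (z j)))" for j c
    unfolding z_def using sub \<epsilon>[of j] by blast
  have z: "0 < z j c" "z j c \<le> 1" for j c using sub_z[of j c] by auto
  have z_sub: "(1 + \<epsilon> j * \<delta>) * z j c \<le> lst (B c) (total (z j))" if "q c = i" for j c
    using sub_z[of j c] that by blast
  have "\<epsilon> \<longlonglongrightarrow> 0"
    unfolding \<epsilon>_def by (intro LIMSEQ_Suc lim_const_over_n)
  then have "(\<lambda>j. 1 - \<epsilon> j * (mean (B c) + \<delta>)) \<longlonglongrightarrow> 1 - 0 * (mean (B c) + \<delta>)" for c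
    by (intro tendsto_intros)
  then have lim: "(\<lambda>j. z j c) \<longlonglongrightarrow> 1" for c
    by (cases "q c = i") (simp_all add: z_def drift_weight_def)
  have "polled_weight k i (z j) \<le> (\<Sum>n. ending_weight k i (\<lambda>_. 1) n)" for j
  proof -
    have "polled_weight k i (z j) \<le> (\<Sum>n. ending_weight k i (z j) n)"
      unfolding suminf_entering_weight[symmetric]
      by (rule entering_weight_le_ending_weight[OF z mult_pos_pos[OF \<epsilon>(1) \<delta>] z_sub])
    also have "\<dots> = (\<Sum>n. ending_weight k i (\<lambda>_. 1) n)"
      by (intro suminf_cong ending_weight_cong) (simp add: z_def drift_weight_def)
    finally show ?thesis .
  qed
  moreover have "0 \<le> z j c" for j c using z(1)[of j c] by simp
  ultimately show ?thesis
    by (intro LIMSEQ_le_const2[OF polled_weight_tendsto[where z = z, OF _ z(2) lim]]) auto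
qed

text \<open>If epoch \<open>k\<close> is reached almost surely, the visits that begin there have
  total mass 1, and no less ends.\<close>

lemma AE_reached: "AE \<omega> in M. reached k \<omega>"
proof (induction k)
  case 0
  then show ?case by (auto simp: reached_iff intro: exI[of _ 0] visits_0)
next
  case (Suc k)
  have pm: "(\<lambda>\<omega>. of_bool (reached k \<omega> \<and> fst (polled d I k \<omega>) = i) :: ennreal) \<in> borel_measurable M" for i
    using polled_weight_integrand_measurable[of k i "\<lambda>_. 1"] by (simp add: monomial_def)
  have "1 = (\<integral>\<^sup>+\<omega>. 1 \<partial>M)" by (simp add: emeasure_space_1)
  also have "\<dots> = (\<integral>\<^sup>+\<omega>. (\<Sum>i\<in>UNIV. of_bool (reached k \<omega> \<and> fst (polled d I k \<omega>) = i)) \<partial>M)"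
  proof (rule nn_integral_cong_AE)
    show "AE \<omega> in M. 1 = (\<Sum>i\<in>UNIV. of_bool (reached k \<omega> \<and> fst (polled d I k \<omega>) = i) :: ennreal)"
      using Suc
    proof eventually_elim
      case (elim \<omega>)
      then show ?case by (cases "fst (polled d I k \<omega>)") (simp_all add: UNIV_queue)
    qed
  qed
  also have "\<dots> = (\<Sum>i\<in>UNIV. polled_weight k i (\<lambda>_. 1))"
    unfolding polled_weight_def by (subst nn_integral_sum[OF pm]) (simp add: monomial_def)
  also have "\<dots> \<le> (\<Sum>i\<in>UNIV. \<Sum>n. ending_weight k i (\<lambda>_. 1) n)"
    by (intro sum_mono polled_weight_le_ending_weight)
  also have "\<dots> = emeasure M {\<omega> \<in> space M. reached (Suc k) \<omega>}"
    by (rule sum_ending_weight_1)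
  finally have "emeasure M {\<omega> \<in> space M. reached (Suc k) \<omega>} = 1"
    using emeasure_le_1 by (intro antisym) auto
  then have "prob {\<omega> \<in> space M. reached (Suc k) \<omega>} = 1" by (simp add: measure_def)
  then have "AE \<omega> in M. \<omega> \<in> {\<omega> \<in> space M. reached (Suc k) \<omega>}" by (rule AE_prob_1)
  then show ?case by (auto elim: eventually_mono)
qed

text \<open>Ending weights ignore the arguments at the queue just left, so there \<open>z\<close>
  may be replaced by the root \<open>w i\<close>; conservation then carries the weight back to the
  beginning of the visit.\<close>

lemma polled_weight_recursion:
  assumes z: "\<And>e. 0 \<le> z e" "\<And>e. z e \<le> 1"
    and w: "\<And>i e. 0 \<le> w i e" "\<And>i e. w i e \<le> 1" "\<And>i c. q c \<noteq> i \<Longrightarrow> w i c = z c"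
      "\<And>i c. q c = i \<Longrightarrow> w i c = lst (B c) (total (w i))"
  shows "polled_weight (Suc k) j z =
    (\<Sum>i\<in>UNIV. ennreal (routing i j * lst (S i j) (total z)) * polled_weight k i (w i))"
  unfolding polled_weight_Suc[OF z]
proof (intro sum.cong refl arg_cong2[where f = "(*)"])
  fix i
  have "polled_weight k i (w i) = (\<Sum>n. ending_weight k i (w i) n)"
    unfolding suminf_entering_weight[symmetric]
    by (rule entering_weight_eq_ending_weight) (use w AE_reached in auto)
  also have "\<dots> = (\<Sum>n. ending_weight k i z n)"
    by (intro suminf_cong ending_weight_cong w(3))
  finally show "(\<Sum>n. ending_weight k i z n) = polled_weight k i (w i)" by simp
qed

text \<open>Not normalized: the value at 1 is the probability that epoch \<open>k\<close> belongs to
  queue \<open>i\<close>. This makes the recursion linear.\<close>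

definition polled_pgf :: "nat \<Rightarrow> queue \<Rightarrow> ('c \<Rightarrow> real) \<Rightarrow> real" where
  "polled_pgf k i z = (\<integral>\<omega>. of_bool (fst (polled d I k \<omega>) = i) * monomial z (snd (polled d I k \<omega>)) \<partial>M)"

lemma polled_integrand_measurable:
  "(\<lambda>\<omega>. of_bool (fst (polled d I k \<omega>) = i) * monomial z (snd (polled d I k \<omega>))) \<in> borel_measurable M"
  by (rule measurable_compose[OF polled_measurable]) simp

lemma polled_weight_eq:
  assumes z: "\<And>e. 0 \<le> z e" "\<And>e. z e \<le> 1"
  shows "polled_weight k i z = ennreal (polled_pgf k i z)"
proof -
  have le: "monomial z n \<le> 1" for n
    unfolding monomial_def using z by (intro prod_le_1) (auto intro: power_le_one)
  have "polled_weight k i z = (\<integral>\<^sup>+\<omega>. ennreal (of_bool (fst (polled d I k \<omega>) = i) * monomial z (snd (polled d I k \<omega>))) \<partial>M)"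
    unfolding polled_weight_def
  proof (rule nn_integral_cong_AE)
    show "AE \<omega> in M. of_bool (reached k \<omega> \<and> fst (polled d I k \<omega>) = i) * ennreal (monomial z (snd (polled d I k \<omega>)))
        = ennreal (of_bool (fst (polled d I k \<omega>) = i) * monomial z (snd (polled d I k \<omega>)))"
      using AE_reached[of k] by eventually_elim auto
  qed
  also have "\<dots> = ennreal (polled_pgf k i z)"
    unfolding polled_pgf_def
  proof (rule nn_integral_eq_integral)
    show "integrable M (\<lambda>\<omega>. of_bool (fst (polled d I k \<omega>) = i) * monomial z (snd (polled d I k \<omega>)))"
      by (rule integrable_const_bound[where B = 1, OF _ polled_integrand_measurable])
        (use le monomial_nonneg[OF z(1)] in \<open>auto intro!: AE_I2\<close>)
  qed (use monomial_nonneg[OF z(1)] in auto)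
  finally show ?thesis .
qed

lemma polled_pgf_nonneg: "(\<And>e. 0 \<le> z e) \<Longrightarrow> 0 \<le> polled_pgf k i z"
  unfolding polled_pgf_def using monomial_nonneg[of z] by (intro integral_nonneg_AE AE_I2) auto

lemma polled_pgf_recursion:
  assumes p: "\<And>i. 0 \<le> p i" "\<And>i. p i \<le> 1"
    and z: "\<And>e. 0 \<le> z e" "\<And>e. z e \<le> 1"
    and w: "\<And>i e. 0 \<le> w i e" "\<And>i e. w i e \<le> 1" "\<And>i c. q c \<noteq> i \<Longrightarrow> w i c = z c"
      "\<And>i c. q c = i \<Longrightarrow> w i c = lst (B c) (total (w i))"
  shows "polled_pgf (Suc k) j z = (\<Sum>i\<in>UNIV. routing i j * lst (S i j) (total z) * polled_pgf k i (w i))"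
proof -
  have nn: "0 \<le> routing i j * lst (S i j) (total z)" for i
    using p by (intro mult_nonneg_nonneg less_imp_le[OF lst_pos] switch_nonneg_law total_nonneg z)
      (simp add: routing_def)
  have "ennreal (polled_pgf (Suc k) j z)
      = (\<Sum>i\<in>UNIV. ennreal (routing i j * lst (S i j) (total z)) * ennreal (polled_pgf k i (w i)))"
    using polled_weight_recursion[of z w k j, OF z w] by (simp add: polled_weight_eq z w(1,2))
  also have "\<dots> = ennreal (\<Sum>i\<in>UNIV. routing i j * lst (S i j) (total z) * polled_pgf k i (w i))"
    using nn polled_pgf_nonneg[of "w _", OF w(1)] by (simp add: ennreal_mult' sum_ennreal[symmetric] del: sum_ennreal)
  finally show ?thesis
    using polled_pgf_nonneg[OF z(1)]
    by (subst (asm) ennreal_inj) (auto intro!: sum_nonneg mult_nonneg_nonneg[OF nn] polled_pgf_nonneg w(1))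
qed

lemma polled_pgf_tendsto:
  assumes z: "\<And>j e. 0 \<le> z j e" "\<And>j e. z j e \<le> 1" "\<And>e. (\<lambda>j. z j e) \<longlonglongrightarrow> 1"
  shows "(\<lambda>j. polled_pgf k i (z j)) \<longlonglongrightarrow> polled_pgf k i (\<lambda>_. 1)"
proof -
  have "(\<lambda>j. ennreal (polled_pgf k i (z j))) \<longlonglongrightarrow> ennreal (polled_pgf k i (\<lambda>_. 1))"
    using polled_weight_tendsto[of z k i, OF z] by (simp add: polled_weight_eq z(1,2))
  then show ?thesis
    by (rule tendsto_ennrealD) (use polled_pgf_nonneg z(1) in \<open>auto intro!: always_eventually\<close>)
qed

lemma sum_polled_pgf_1: "(\<Sum>i\<in>UNIV. polled_pgf k i (\<lambda>_. 1)) = 1"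
proof -
  have int: "integrable M (\<lambda>\<omega>. of_bool (fst (polled d I k \<omega>) = i) :: real)" for i
    by (rule integrable_const_bound[where B = 1])
      (use polled_integrand_measurable[of k i "\<lambda>_. 1"] in \<open>auto simp: monomial_def intro!: AE_I2\<close>)
  have "(\<Sum>i\<in>UNIV. polled_pgf k i (\<lambda>_. 1)) = (\<Sum>i\<in>UNIV. \<integral>\<omega>. of_bool (fst (polled d I k \<omega>) = i) \<partial>M)"
    by (simp add: polled_pgf_def monomial_def)
  also have "\<dots> = (\<integral>\<omega>. (\<Sum>i\<in>UNIV. of_bool (fst (polled d I k \<omega>) = i)) \<partial>M)"
    by (rule Bochner_Integration.integral_sum[symmetric]) (rule int)
  also have "(\<lambda>\<omega>. \<Sum>i\<in>UNIV. of_bool (fst (polled d I k \<omega>) = i) :: real) = (\<lambda>_. 1)"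
  proof
    fix \<omega>
    show "(\<Sum>i\<in>UNIV. of_bool (fst (polled d I k \<omega>) = i) :: real) = 1"
      by (cases "fst (polled d I k \<omega>)") (simp_all add: UNIV_queue)
  qed
  finally show ?thesis by (simp add: prob_space)
qed

lemma polling_pgf_eq:
  assumes z: "\<And>e. 0 \<le> z e" "\<And>e. z e \<le> 1" and pos: "0 < polled_pgf k i (\<lambda>_. 1)"
  shows "polling_pgf M d I k i z = polled_pgf k i z / polled_pgf k i (\<lambda>_. 1)"
proof -
  let ?A = "{\<omega> \<in> space M. fst (polled d I k \<omega>) = i}"
  have A: "?A \<in> sets M"
    by (rule predE, rule measurable_compose[OF polled_measurable]) simp
  have mono: "(\<lambda>\<omega>. monomial z (snd (polled d I k \<omega>))) \<in> borel_measurable M" for z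
    by (rule measurable_compose[OF polled_measurable]) simp
  have num: "(\<integral>\<^sup>+\<omega>. ennreal (monomial z (snd (polled d I k \<omega>))) * indicator ?A \<omega> \<partial>M) = ennreal (polled_pgf k i z)"
    if z: "\<And>e. 0 \<le> z e" "\<And>e. z e \<le> 1" for z
    unfolding polled_weight_eq[OF z, symmetric] polled_weight_def
  proof (rule nn_integral_cong_AE)
    show "AE \<omega> in M. ennreal (monomial z (snd (polled d I k \<omega>))) * indicator ?A \<omega>
        = of_bool (reached k \<omega> \<and> fst (polled d I k \<omega>) = i) * ennreal (monomial z (snd (polled d I k \<omega>)))"
      using AE_reached[of k] AE_space by eventually_elim (auto simp: indicator_def)
  qed
  have den: "emeasure M ?A = ennreal (polled_pgf k i (\<lambda>_. 1))"
    using num[of "\<lambda>_. 1"] A by (simp add: monomial_def)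
  have "polling_pgf M d I k i z = (\<integral>\<omega>. monomial z (snd (polled d I k \<omega>)) \<partial>uniform_measure M ?A)"
    by (simp add: polling_pgf_def monomial_def)
  also have "\<dots> = enn2real (\<integral>\<^sup>+\<omega>. ennreal (monomial z (snd (polled d I k \<omega>))) \<partial>uniform_measure M ?A)"
    by (rule integral_eq_nn_integral)
      (use mono monomial_nonneg[OF z(1)] in \<open>auto simp: uniform_measure_def\<close>)
  also have "(\<integral>\<^sup>+\<omega>. ennreal (monomial z (snd (polled d I k \<omega>))) \<partial>uniform_measure M ?A)
      = ennreal (polled_pgf k i z) / ennreal (polled_pgf k i (\<lambda>_. 1))"
    unfolding num[OF z, symmetric] den[symmetric]
    by (rule nn_integral_uniform_measure[OF measurable_compose[OF mono measurable_ennreal] A])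
  also have "\<dots> = ennreal (polled_pgf k i z / polled_pgf k i (\<lambda>_. 1))"
    by (rule divide_ennreal[OF polled_pgf_nonneg[OF z(1)] pos])
  finally show ?thesis using polled_pgf_nonneg[OF z(1)] pos by simp
qed

lemma steady_state_polled_pgf:
  assumes "steady_state M d I"
  shows "polled_pgf k i z = polled_pgf 0 i z"
proof -
  have eq: "polled_pgf k i z = (\<integral>x. of_bool (fst x = i) * monomial z (snd x) \<partial>distr M (count_space UNIV) (polled d I k))" for k
    unfolding polled_pgf_def by (rule integral_distr[OF polled_measurable, symmetric]) simp
  have "distr M (count_space UNIV) (polled d I k) = distr M (count_space UNIV) (polled d I 0)"
    using assms unfolding steady_state_def by blast
  then show ?thesis unfolding eq[of k] eq[of 0] by (simp only:)
qed

end

section \<open>The infinite products\<close>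

fun other :: "queue \<Rightarrow> queue" where
  "other Q1 = Q2" | "other Q2 = Q1"

lemma other_other [simp]: "other (other i) = i"
  by (cases i) auto

lemma neq_iff_other: "i \<noteq> j \<longleftrightarrow> i = other j"
  by (cases i; cases j) auto

text \<open>The quotient is the sum of the geometric series with terms
  \<open>(1 - a) * x * (a * y) ^ n\<close>: some self-polls of the same queue and one switch from
  the other one. The bound is linear in the defects of \<open>x\<close> and
  \<open>y\<close>.\<close>

lemma geometric_factor:
  fixes a x y :: real
  assumes "0 \<le> a" "a < 1" "0 < x" "x \<le> 1" "0 < y" "y \<le> 1"
  shows "0 < (1 - a) * x / (1 - a * y)" "(1 - a) * x / (1 - a * y) \<le> 1"
    "1 - (1 - a) * x / (1 - a * y) \<le> ((1 - x) + (1 - y)) / (1 - a)"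
proof -
  have "a * y \<le> a * 1" using assms by (intro mult_left_mono) auto
  then have den: "1 - a \<le> 1 - a * y" by simp
  show "0 < (1 - a) * x / (1 - a * y)" using assms den by (intro divide_pos_pos mult_pos_pos) auto
  have "(1 - a) * x \<le> (1 - a) * 1" using assms by (intro mult_left_mono) auto
  then have "(1 - a) * x \<le> 1 - a * y" using den by simp
  then show "(1 - a) * x / (1 - a * y) \<le> 1" using assms den by (simp add: divide_le_eq)
  have "1 - (1 - a) * x / (1 - a * y) = (a * (1 - y) + (1 - a) * (1 - x)) / (1 - a * y)"
    using assms den by (simp add: field_simps)
  also have "\<dots> \<le> ((1 - x) + (1 - y)) / (1 - a)"
  proof (rule frac_le)
    have "a * (1 - y) \<le> 1 * (1 - y)" "(1 - a) * (1 - x) \<le> 1 * (1 - x)"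
      using assms by (intro mult_right_mono; simp)+
    then show "a * (1 - y) + (1 - a) * (1 - x) \<le> (1 - x) + (1 - y)" by simp
  qed (use assms den in auto)
  finally show "1 - (1 - a) * x / (1 - a * y) \<le> ((1 - x) + (1 - y)) / (1 - a)" .
qed

text \<open>The analytic part, free of probability: these bounds are all that the convergence of the
  products needs from the busy periods. \<open>theta_ge\<close> is the first-moment bound for a busy
  period, cleared of its denominator.\<close>

locale two_queues =
  fixes l :: "queue \<Rightarrow> real" and S :: "queue \<Rightarrow> queue \<Rightarrow> real measure"
    and p :: "queue \<Rightarrow> real" and theta :: "queue \<Rightarrow> real \<Rightarrow> real" and m :: "queue \<Rightarrow> real"
  assumes rate_pos: "\<And>i. 0 < l i"
    and switch_law: "\<And>i j. nonneg_law (S i j)"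
    and stay: "\<And>i. 0 \<le> p i" "\<And>i. p i < 1"
    and theta_pos: "\<And>i s. 0 \<le> s \<Longrightarrow> 0 < theta i s"
    and theta_le_1: "\<And>i s. 0 \<le> s \<Longrightarrow> theta i s \<le> 1"
    and theta_ge: "\<And>i s. 0 \<le> s \<Longrightarrow> (1 - theta i s) * (1 - l i * m i) \<le> s * m i"
    and service_mean_nonneg: "\<And>i. 0 \<le> m i"
    and total_load: "l Q1 * m Q1 + l Q2 * m Q2 < 1"
begin

lemma load_nonneg: "0 \<le> l i * m i"
  using rate_pos[of i] service_mean_nonneg[of i] by simp

lemma load_less_1: "l i * m i < 1"
  using total_load load_nonneg[of Q1] load_nonneg[of Q2] by (cases i) auto

lemma theta_defect: "0 \<le> s \<Longrightarrow> 1 - theta i s \<le> s * (m i / (1 - l i * m i))"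
  using theta_ge[of s i] load_less_1[of i] by (simp add: pos_le_divide_eq)

lemma K12_bounds:
  assumes "0 \<le> z" "z \<le> 1"
  shows "0 < K12 l theta z" "K12 l theta z \<le> 1"
    "1 - K12 l theta z \<le> l Q2 * m Q1 / (1 - l Q1 * m Q1) * (1 - z)"
proof -
  have "0 \<le> l Q2 * (1 - z)" using rate_pos[of Q2] assms by simp
  then show "0 < K12 l theta z" "K12 l theta z \<le> 1"
    "1 - K12 l theta z \<le> l Q2 * m Q1 / (1 - l Q1 * m Q1) * (1 - z)"
    using theta_pos theta_le_1 theta_defect[of "l Q2 * (1 - z)" Q1] by (simp_all add: K12_def mult_ac)
qed

lemma K21_bounds:
  assumes "0 \<le> z" "z \<le> 1"
  shows "0 < K21 l theta z" "K21 l theta z \<le> 1"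
    "1 - K21 l theta z \<le> l Q1 * m Q2 / (1 - l Q2 * m Q2) * (1 - z)"
proof -
  have "0 \<le> l Q1 * (1 - z)" using rate_pos[of Q1] assms by simp
  then show "0 < K21 l theta z" "K21 l theta z \<le> 1"
    "1 - K21 l theta z \<le> l Q1 * m Q2 / (1 - l Q2 * m Q2) * (1 - z)"
    using theta_pos theta_le_1 theta_defect[of "l Q1 * (1 - z)" Q2] by (simp_all add: K21_def mult_ac)
qed

definition contraction :: real where
  "contraction = (l Q1 * m Q1) * (l Q2 * m Q2) / ((1 - l Q1 * m Q1) * (1 - l Q2 * m Q2))"

lemma contraction_nonneg: "0 \<le> contraction"
  unfolding contraction_def
  by (intro divide_nonneg_nonneg mult_nonneg_nonneg[OF load_nonneg load_nonneg] mult_nonneg_nonneg)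
    (use load_less_1 in \<open>simp_all add: less_imp_le\<close>)

lemma contraction_less_1: "contraction < 1"
proof -
  let ?a = "l Q1 * m Q1" and ?b = "l Q2 * m Q2"
  \<comment> \<open>The difference of the two sides is \<open>1 - ?a - ?b\<close>.\<close>
  have "?a * ?b < (1 - ?a) * (1 - ?b)" using total_load by (simp add: algebra_simps)
  moreover have "0 < (1 - ?a) * (1 - ?b)" using load_less_1 by (intro mult_pos_pos) auto
  ultimately show ?thesis unfolding contraction_def by (simp add: divide_less_eq)
qed

lemma f1_bounds:
  assumes "0 \<le> z" "z \<le> 1"
  shows "0 \<le> f1 l theta z" "f1 l theta z \<le> 1" "1 - f1 l theta z \<le> contraction * (1 - z)"
proof -
  note K = K12_bounds[OF assms]
  have K0: "0 \<le> K12 l theta z" using K by simp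
  show "0 \<le> f1 l theta z" "f1 l theta z \<le> 1" using K21_bounds[OF K0 K(2)] by (auto simp: f1_def)
  have "1 - f1 l theta z \<le> l Q1 * m Q2 / (1 - l Q2 * m Q2) * (1 - K12 l theta z)"
    using K21_bounds(3)[OF K0 K(2)] by (simp add: f1_def)
  also have "\<dots> \<le> l Q1 * m Q2 / (1 - l Q2 * m Q2) * (l Q2 * m Q1 / (1 - l Q1 * m Q1) * (1 - z))"
    using K(3) rate_pos[of Q1] service_mean_nonneg[of Q2] load_less_1[of Q2]
    by (intro mult_left_mono divide_nonneg_nonneg mult_nonneg_nonneg) auto
  also have "\<dots> = contraction * (1 - z)" by (simp add: contraction_def mult_ac)
  finally show "1 - f1 l theta z \<le> contraction * (1 - z)" .
qed

lemma f1_iterate_bounds: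
  assumes "0 \<le> z" "z \<le> 1"
  shows "0 \<le> (f1 l theta ^^ j) z \<and> (f1 l theta ^^ j) z \<le> 1 \<and>
    1 - (f1 l theta ^^ j) z \<le> contraction ^ j * (1 - z)"
proof (induction j)
  case (Suc j)
  let ?x = "(f1 l theta ^^ j) z"
  have x: "0 \<le> ?x" "?x \<le> 1" using Suc by auto
  have "1 - f1 l theta ?x \<le> contraction * (1 - ?x)" by (rule f1_bounds(3)[OF x])
  also have "\<dots> \<le> contraction * (contraction ^ j * (1 - z))"
    using Suc contraction_nonneg by (intro mult_left_mono) auto
  finally show ?case using f1_bounds[OF x] by (simp add: mult.assoc)
qed (use assms in auto)

lemma M_pgf_bounds:
  assumes "0 \<le> x" "x \<le> 1" "0 \<le> y" "y \<le> 1"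
  shows "0 < M_pgf l S i j x y" "M_pgf l S i j x y \<le> 1"
    "1 - M_pgf l S i j x y \<le> mean (S i j) * (l Q1 * (1 - x) + l Q2 * (1 - y))"
proof -
  have "0 \<le> l Q1 * (1 - x) + l Q2 * (1 - y)" using rate_pos[of Q1] rate_pos[of Q2] assms by simp
  then show "0 < M_pgf l S i j x y" "M_pgf l S i j x y \<le> 1"
    "1 - M_pgf l S i j x y \<le> mean (S i j) * (l Q1 * (1 - x) + l Q2 * (1 - y))"
    unfolding M_pgf_def
    using lst_pos[OF switch_law] lst_le_1[OF switch_law] lst_ge_linear[OF switch_law[of i j],
        of "l Q1 * (1 - x) + l Q2 * (1 - y)"]
    by (simp_all add: mult.commute[of "mean (S i j)"])
qed

text \<open>A bound linear in \<open>1 - z\<close> turns the geometric decay along the iterates of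
  \<open>f1\<close> into summability, hence into convergence of the product.\<close>

lemma a1_bounds:
  "\<exists>C\<ge>0. \<forall>z. 0 \<le> z \<and> z \<le> 1 \<longrightarrow> 0 < a1 l S p theta z \<and> a1 l S p theta z \<le> 1 \<and> 1 - a1 l S p theta z \<le> C * (1 - z)"
proof -
  \<comment> \<open>Bounds the argument of the switch-over LSTs by \<open>c * (1 - z)\<close>, for
    both values that occur as second argument, \<open>z\<close> and
    \<open>f1 l theta z\<close>.\<close>
  define c where "c = l Q1 * (l Q2 * m Q1 / (1 - l Q1 * m Q1)) + l Q2"
  define C1 where "C1 = (mean (S Q2 Q1) + mean (S Q1 Q1)) * c / (1 - p Q1)"
  define C2 where "C2 = (mean (S Q1 Q2) + mean (S Q2 Q2)) * c / (1 - p Q2)"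
  have mean0: "0 \<le> mean (S i j)" for i j by (rule mean_nonneg[OF switch_law])
  have c0: "0 \<le> c"
    unfolding c_def using rate_pos service_mean_nonneg load_less_1
    by (intro add_nonneg_nonneg mult_nonneg_nonneg divide_nonneg_nonneg) (auto intro: less_imp_le)
  have C0: "0 \<le> C1" "0 \<le> C2"
    unfolding C1_def C2_def
    by (intro divide_nonneg_nonneg mult_nonneg_nonneg add_nonneg_nonneg mean0 c0,
        use stay in \<open>simp add: less_imp_le\<close>)+
  have bound: "0 < a1 l S p theta z \<and> a1 l S p theta z \<le> 1 \<and> 1 - a1 l S p theta z \<le> (C1 + C2) * (1 - z)"
    if z: "0 \<le> z" "z \<le> 1" for z
  proof -
    let ?K = "K12 l theta z" and ?f = "f1 l theta z"
    have K: "0 \<le> ?K" "?K \<le> 1" using K12_bounds[OF z] by auto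
    note f = f1_bounds[OF z]
    have f_z: "1 - ?f \<le> 1 - z"
    proof -
      have "contraction * (1 - z) \<le> 1 * (1 - z)"
        using contraction_less_1 z by (intro mult_right_mono) auto
      then show ?thesis using f(3) by simp
    qed
    have arg: "l Q1 * (1 - ?K) + l Q2 * (1 - y) \<le> c * (1 - z)" if "1 - y \<le> 1 - z" for y
    proof -
      have "l Q1 * (1 - ?K) \<le> l Q1 * (l Q2 * m Q1 / (1 - l Q1 * m Q1) * (1 - z))"
        using K12_bounds(3)[OF z] rate_pos[of Q1] by (intro mult_left_mono) auto
      moreover have "l Q2 * (1 - y) \<le> l Q2 * (1 - z)"
        using that rate_pos[of Q2] by (intro mult_left_mono) auto
      ultimately show ?thesis by (simp add: c_def algebra_simps)
    qed
    have M: "1 - M_pgf l S i j ?K y \<le> mean (S i j) * (c * (1 - z))"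
      if "0 \<le> y" "y \<le> 1" "1 - y \<le> 1 - z" for i j y
      using M_pgf_bounds(3)[OF K that(1,2), of i j] mult_left_mono[OF arg[OF that(3)] mean0[of i j]] by simp
    define X where "X = (1 - p Q1) * M_pgf l S Q2 Q1 ?K z / (1 - p Q1 * M_pgf l S Q1 Q1 ?K z)"
    define Y where "Y = (1 - p Q2) * M_pgf l S Q1 Q2 ?K ?f / (1 - p Q2 * M_pgf l S Q2 Q2 ?K ?f)"
    have a1: "a1 l S p theta z = X * Y" by (simp add: a1_def X_def Y_def r_def)
    note X = geometric_factor[OF stay(1)[of Q1] stay(2)[of Q1] M_pgf_bounds(1,2)[OF K z, of Q2 Q1]
        M_pgf_bounds(1,2)[OF K z, of Q1 Q1], folded X_def]
    note Y = geometric_factor[OF stay(1)[of Q2] stay(2)[of Q2] M_pgf_bounds(1,2)[OF K f(1,2), of Q1 Q2]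
        M_pgf_bounds(1,2)[OF K f(1,2), of Q2 Q2], folded Y_def]
    have "1 - X \<le> (mean (S Q2 Q1) * (c * (1 - z)) + mean (S Q1 Q1) * (c * (1 - z))) / (1 - p Q1)"
      using M[OF z order_refl] stay(2)[of Q1] by (intro order_trans[OF X(3)] divide_right_mono add_mono) auto
    then have 1: "1 - X \<le> C1 * (1 - z)" by (simp add: C1_def algebra_simps)
    have "1 - Y \<le> (mean (S Q1 Q2) * (c * (1 - z)) + mean (S Q2 Q2) * (c * (1 - z))) / (1 - p Q2)"
      using M[OF f(1,2) f_z] stay(2)[of Q2] by (intro order_trans[OF Y(3)] divide_right_mono add_mono) auto
    then have 2: "1 - Y \<le> C2 * (1 - z)" by (simp add: C2_def algebra_simps)
    \<comment> \<open>Expanding this product bounds the defect of \<open>X * Y\<close> by the sum of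
      the two defects.\<close>
    have "0 \<le> (1 - X) * (1 - Y)" using X Y by (intro mult_nonneg_nonneg) auto
    then have "1 - X * Y \<le> (1 - X) + (1 - Y)" by (simp add: algebra_simps)
    also have "\<dots> \<le> (C1 + C2) * (1 - z)" using 1 2 by (simp add: algebra_simps)
    finally show ?thesis using X Y by (simp add: a1 mult_le_one)
  qed
  show ?thesis using bound C0 by (intro exI[of _ "C1 + C2"]) auto
qed

lemma convergent_prod_a1:
  assumes z: "0 \<le> z" "z \<le> 1"
  shows "convergent_prod (\<lambda>j. a1 l S p theta ((f1 l theta ^^ j) z))"
proof -
  obtain C where C: "0 \<le> C" and bound: "\<And>z. 0 \<le> z \<Longrightarrow> z \<le> 1 \<Longrightarrow>
      0 < a1 l S p theta z \<and> a1 l S p theta z \<le> 1 \<and> 1 - a1 l S p theta z \<le> C * (1 - z)"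
    using a1_bounds by blast
  have "summable (\<lambda>j. norm (a1 l S p theta ((f1 l theta ^^ j) z) - 1))"
  proof (rule summable_comparison_test')
    show "summable (\<lambda>j. C * (contraction ^ j * (1 - z)))"
      using contraction_nonneg contraction_less_1 by (intro summable_mult summable_mult2 summable_geometric) auto
    fix j :: nat
    let ?x = "(f1 l theta ^^ j) z"
    have x: "0 \<le> ?x" "?x \<le> 1" "1 - ?x \<le> contraction ^ j * (1 - z)" using f1_iterate_bounds[OF z, of j] by auto
    have "norm (a1 l S p theta ?x - 1) = 1 - a1 l S p theta ?x" using bound[OF x(1,2)] by simp
    also have "\<dots> \<le> C * (1 - ?x)" using bound[OF x(1,2)] by blast
    also have "\<dots> \<le> C * (contraction ^ j * (1 - z))" using C x(3) by (intro mult_left_mono) auto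
    finally show "norm (norm (a1 l S p theta ?x - 1)) \<le> C * (contraction ^ j * (1 - z))" by simp
  qed
  then have "abs_convergent_prod (\<lambda>j. a1 l S p theta ((f1 l theta ^^ j) z))"
    by (rule summable_imp_abs_convergent_prod)
  then show ?thesis by (rule abs_convergent_prod_imp_convergent_prod)
qed

lemma f1_iterate_tendsto:
  assumes z: "0 \<le> z" "z \<le> 1"
  shows "(\<lambda>j. (f1 l theta ^^ j) z) \<longlonglongrightarrow> 1"
proof -
  have "(\<lambda>j. contraction ^ j * (1 - z)) \<longlonglongrightarrow> 0 * (1 - z)"
    using contraction_nonneg contraction_less_1 by (intro tendsto_mult LIMSEQ_power_zero tendsto_const) auto
  then have "(\<lambda>j. 1 - (f1 l theta ^^ j) z) \<longlonglongrightarrow> 0"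
    by (intro real_tendsto_sandwich[OF _ _ tendsto_const, of 0 "\<lambda>j. 1 - (f1 l theta ^^ j) z"])
      (use f1_iterate_bounds[OF z] in \<open>auto intro!: always_eventually\<close>)
  then have "(\<lambda>j. 1 - (1 - (f1 l theta ^^ j) z)) \<longlonglongrightarrow> 1 - 0" by (intro tendsto_intros)
  then show ?thesis by simp
qed

end

context two_queues
begin

text \<open>Exchanging the names of the queues turns \<open>a1\<close> and \<open>f1\<close> into \<open>a2\<close> and \<open>f2\<close>.\<close>

lemma swapped:
  "two_queues (l \<circ> other) (\<lambda>i j. S (other i) (other j)) (p \<circ> other) (theta \<circ> other) (m \<circ> other)"
  by unfold_locales
    (use rate_pos switch_law stay theta_pos theta_le_1 theta_ge service_mean_nonneg total_load in
      \<open>auto simp: add.commute\<close>)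

lemma K12_swap: "K12 (l \<circ> other) (theta \<circ> other) = K21 l theta"
  by (simp add: fun_eq_iff K12_def K21_def)

lemma K21_swap: "K21 (l \<circ> other) (theta \<circ> other) = K12 l theta"
  by (simp add: fun_eq_iff K12_def K21_def)

lemma f1_swap: "f1 (l \<circ> other) (theta \<circ> other) = f2 l theta"
  by (simp add: fun_eq_iff f1_def f2_def K12_swap K21_swap)

lemma M_pgf_swap: "M_pgf (l \<circ> other) (\<lambda>i j. S (other i) (other j)) i j x y = M_pgf l S (other i) (other j) y x"
  by (simp add: M_pgf_def add.commute)

lemma a1_swap: "a1 (l \<circ> other) (\<lambda>i j. S (other i) (other j)) (p \<circ> other) (theta \<circ> other) = a2 l S p theta"
  by (simp add: fun_eq_iff a1_def a2_def K12_swap K21_swap f1_swap M_pgf_swap r_def)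

lemmas convergent_prod_a2 = two_queues.convergent_prod_a1[OF swapped, unfolded a1_swap f1_swap]
lemmas f2_iterate_tendsto = two_queues.f1_iterate_tendsto[OF swapped, unfolded f1_swap]

end

section \<open>Solving the stationary equations\<close>

text \<open>\<open>theta_eq\<close> is the functional equation of the busy period, written as a sum
  over the types of a queue, so that no merged service law is mentioned.\<close>

locale stationary_polling = stable_polling M lam B S p I d q + two_queues l S p theta m
  for M :: "'a measure" and lam :: "'c::finite \<Rightarrow> real" and B S p
    and I :: "('a, 'c) polling_input" and d q l theta m +
  assumes rate_eq: "\<And>i. l i = (\<Sum>c | q c = i. lam c)"
    and theta_eq: "\<And>i s. 0 \<le> s \<Longrightarrow>
      l i * theta i s = (\<Sum>c | q c = i. lam c * lst (B c) (s + l i * (1 - theta i s)))"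
    and steady: "steady_state M d I"
begin

definition mix :: "('c \<Rightarrow> real) \<Rightarrow> queue \<Rightarrow> real" where
  "mix z i = (\<Sum>c | q c = i. lam c * z c) / l i"

text \<open>During a visit to \<open>i\<close>, arrivals at the other queue act as discounting at
  this rate; it is the argument of \<open>theta\<close> in \<open>K12\<close> and
  \<open>K21\<close>.\<close>

definition foreign :: "queue \<Rightarrow> ('c \<Rightarrow> real) \<Rightarrow> real" where
  "foreign i z = l (other i) * (1 - mix z (other i))"

text \<open>After a visit to \<open>i\<close>, the customers present at its beginning count as the customers that
  arrived at the other queue during the busy periods they have caused.\<close>

definition after_visit :: "queue \<Rightarrow> ('c \<Rightarrow> real) \<Rightarrow> 'c \<Rightarrow> real" where
  "after_visit i z c =
    (if q c = i then lst (B c) (foreign i z + l i * (1 - theta i (foreign i z))) else z c)"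

definition unit_cube :: "('c \<Rightarrow> real) set" where
  "unit_cube = {z. \<forall>c. 0 \<le> z c \<and> z c \<le> 1}"

lemma sum_rate_defect: "(\<Sum>c | q c = i. lam c * (1 - z c)) = l i * (1 - mix z i)"
  using rate_pos[of i] by (simp add: mix_def rate_eq[symmetric] right_diff_distrib sum_subtractf)

lemma total_eq: "total z = l i * (1 - mix z i) + foreign i z"
proof -
  have "total z = (\<Sum>c | q c = i. lam c * (1 - z c)) + (\<Sum>c | q c = other i. lam c * (1 - z c))"
    unfolding total_def
    by (subst sum.union_disjoint[symmetric]) (auto intro!: sum.cong simp: neq_iff_other[symmetric])
  then show ?thesis by (simp add: sum_rate_defect foreign_def)
qed

lemma mix_bounds:
  assumes "z \<in> unit_cube"
  shows "0 \<le> mix z i" "mix z i \<le> 1"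
proof -
  have "0 \<le> (\<Sum>c | q c = i. lam c * z c)"
    using assms lam_pos by (intro sum_nonneg mult_nonneg_nonneg) (auto simp: unit_cube_def intro: less_imp_le)
  then show "0 \<le> mix z i" using rate_pos[of i] by (simp add: mix_def)
  have "0 \<le> (\<Sum>c | q c = i. lam c * (1 - z c))"
    using assms lam_pos by (intro sum_nonneg mult_nonneg_nonneg) (auto simp: unit_cube_def intro: less_imp_le)
  then show "mix z i \<le> 1"
    unfolding sum_rate_defect using rate_pos[of i] by (simp add: zero_le_mult_iff)
qed

lemma foreign_nonneg: "z \<in> unit_cube \<Longrightarrow> 0 \<le> foreign i z"
  using mix_bounds[of z "other i"] rate_pos[of "other i"] by (simp add: foreign_def)

text \<open>\<open>theta_eq\<close> divided by \<open>l i\<close>. Here the different types of one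
  queue merge into a single busy period.\<close>

lemma mix_after_visit: "z \<in> unit_cube \<Longrightarrow> mix (after_visit i z) i = theta i (foreign i z)"
proof -
  assume z: "z \<in> unit_cube"
  have "(\<Sum>c | q c = i. lam c * after_visit i z c) = l i * theta i (foreign i z)"
    unfolding theta_eq[OF foreign_nonneg[OF z]] by (intro sum.cong) (auto simp: after_visit_def)
  then show ?thesis using rate_pos[of i] by (simp add: mix_def)
qed

lemma mix_after_visit_other: "mix (after_visit i z) (other i) = mix z (other i)"
proof -
  have "other i \<noteq> i" by (cases i) auto
  then have "(\<Sum>c | q c = other i. lam c * after_visit i z c) = (\<Sum>c | q c = other i. lam c * z c)"
    by (intro sum.cong) (auto simp: after_visit_def)
  then show ?thesis by (simp add: mix_def)
qed

lemma foreign_after_visit: "foreign i (after_visit i z) = foreign i z"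
  by (simp add: foreign_def mix_after_visit_other)

lemma total_after_visit:
  "z \<in> unit_cube \<Longrightarrow> total (after_visit i z) = foreign i z + l i * (1 - theta i (foreign i z))"
  by (simp add: total_eq[of _ i] mix_after_visit foreign_after_visit)

lemma after_visit_in_unit_cube:
  assumes z: "z \<in> unit_cube"
  shows "after_visit i z \<in> unit_cube"
proof -
  have s: "0 \<le> foreign i z" by (rule foreign_nonneg[OF z])
  have "0 \<le> foreign i z + l i * (1 - theta i (foreign i z))"
    using s theta_le_1[OF s, of i] rate_pos[of i] by simp
  then show ?thesis
    using z lst_pos[OF service_nonneg_law] lst_le_1[OF service_nonneg_law]
    by (auto simp: unit_cube_def after_visit_def intro: less_imp_le)
qed

text \<open>The new arguments depend on \<open>z\<close> only through the other queue, which the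
  substitution leaves alone.\<close>

lemma after_visit_idem: "after_visit i (after_visit i z) = after_visit i z"
  by (simp add: fun_eq_iff after_visit_def foreign_after_visit)

section \<open>The stationary equations and their value at 1\<close>

definition pgf :: "queue \<Rightarrow> ('c \<Rightarrow> real) \<Rightarrow> real" where
  "pgf i z = polled_pgf 0 i z"

lemma stationary_equation:
  assumes z: "z \<in> unit_cube"
  shows "pgf j z = (\<Sum>i\<in>UNIV. routing i j * lst (S i j) (total z) * pgf i (after_visit i z))"
proof -
  have "polled_pgf (Suc 0) j z
      = (\<Sum>i\<in>UNIV. routing i j * lst (S i j) (total z) * polled_pgf 0 i (after_visit i z))"
  proof (rule polled_pgf_recursion)
    show "p i \<le> 1" for i using stay(2)[of i] by simp
    show "0 \<le> after_visit i z e" "after_visit i z e \<le> 1" for i e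
      using after_visit_in_unit_cube[OF z, of i] by (auto simp: unit_cube_def)
    show "after_visit i z c = z c" if "q c \<noteq> i" for i c
      using that by (simp add: after_visit_def)
    show "after_visit i z c = lst (B c) (total (after_visit i z))" if "q c = i" for i c
      unfolding total_after_visit[OF z] using that by (simp add: after_visit_def)
  qed (use z stay in \<open>auto simp: unit_cube_def\<close>)
  then show ?thesis by (simp add: pgf_def steady_state_polled_pgf[OF steady, of "Suc 0"])
qed

lemma stationary_equation_other:
  "z \<in> unit_cube \<Longrightarrow> pgf i z = p i * lst (S i i) (total z) * pgf i (after_visit i z) +
    (1 - p (other i)) * lst (S (other i) i) (total z) * pgf (other i) (after_visit (other i) z)"
  by (cases i) (simp_all add: stationary_equation UNIV_queue routing_def)

lemma one_in_unit_cube: "(\<lambda>_. 1) \<in> unit_cube"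
  by (simp add: unit_cube_def)

lemma theta_0: "theta i 0 = 1"
  using theta_ge[of 0 i] theta_le_1[of 0 i] load_less_1[of i] by (simp add: mult_le_0_iff)

lemma after_visit_1: "after_visit i (\<lambda>_. 1) = (\<lambda>_. 1)"
proof -
  have "mix (\<lambda>_. 1) (other i) = 1"
    using rate_pos[of "other i"] by (simp add: mix_def rate_eq[symmetric])
  then show ?thesis
    by (simp add: fun_eq_iff after_visit_def foreign_def theta_0 lst_0[OF service_nonneg_law])
qed

text \<open>The stationary equation at 1 is the balance equation of the routing chain.\<close>

lemma balance: "(1 - p i) * pgf i (\<lambda>_. 1) = (1 - p (other i)) * pgf (other i) (\<lambda>_. 1)"
proof -
  have "total (\<lambda>_. 1) = 0" by (simp add: total_def)
  then show ?thesis
    using stationary_equation_other[OF one_in_unit_cube, of i]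
    by (simp add: after_visit_1 lst_0[OF switch_nonneg_law] algebra_simps)
qed

lemma pgf_1_pos: "0 < pgf i (\<lambda>_. 1)"
proof -
  have nn: "0 \<le> pgf j (\<lambda>_. 1)" for j by (simp add: pgf_def polled_pgf_nonneg)
  have "pgf i (\<lambda>_. 1) + pgf (other i) (\<lambda>_. 1) = 1"
    using sum_polled_pgf_1[of 0] by (cases i) (simp_all add: pgf_def UNIV_queue)
  moreover have "pgf (other i) (\<lambda>_. 1) = 0" if "pgf i (\<lambda>_. 1) = 0"
    using balance[of i] that stay(2)[of "other i"] by simp
  ultimately show ?thesis using nn[of i] by (cases "pgf i (\<lambda>_. 1) = 0") auto
qed

text \<open>The generating function at the instants at which the server leaves \<open>i\<close>,
  expressed by the one at the beginning of the visit.\<close>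

definition visit_pgf :: "queue \<Rightarrow> ('c \<Rightarrow> real) \<Rightarrow> real" where
  "visit_pgf i z = pgf i (after_visit i z)"

definition factor :: "queue \<Rightarrow> ('c \<Rightarrow> real) \<Rightarrow> real" where
  "factor i z = (1 - p (other i)) * lst (S (other i) i) (total z) / (1 - p i * lst (S i i) (total z))"

text \<open>By idempotence, polling the same queue again reproduces the unknown itself, so the
  equation is linear in it. Solving for it puts \<open>1 - p i * lst (S i i) (total z)\<close> into
  the denominator, which is positive since \<open>p i < 1\<close>.\<close>

lemma visit_pgf_step:
  assumes z: "z \<in> unit_cube"
  shows "visit_pgf i z = factor i (after_visit i z) * visit_pgf (other i) (after_visit i z)"
proof -
  let ?y = "after_visit i z"
  have y: "?y \<in> unit_cube" by (rule after_visit_in_unit_cube[OF z])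
  have t: "0 \<le> total ?y" using y by (intro total_nonneg) (auto simp: unit_cube_def)
  have "p i * lst (S i i) (total ?y) \<le> p i * 1"
    using stay(1)[of i] lst_le_1[OF switch_nonneg_law t] by (intro mult_left_mono) auto
  then have "p i * lst (S i i) (total ?y) < 1" using stay(2)[of i] by simp
  moreover have "visit_pgf i z = p i * lst (S i i) (total ?y) * visit_pgf i z +
      (1 - p (other i)) * lst (S (other i) i) (total ?y) * visit_pgf (other i) ?y"
    using stationary_equation_other[OF y, of i] by (simp add: visit_pgf_def after_visit_idem)
  ultimately show ?thesis by (simp add: factor_def field_simps)
qed

section \<open>A visit to each queue in turn, and the iteration of this cycle\<close>

definition cycle :: "queue \<Rightarrow> ('c \<Rightarrow> real) \<Rightarrow> 'c \<Rightarrow> real" where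
  "cycle i z = after_visit (other i) (after_visit i z)"

definition cycle_factor :: "queue \<Rightarrow> real \<Rightarrow> real" where
  "cycle_factor i = (case i of Q1 \<Rightarrow> a1 l S p theta | Q2 \<Rightarrow> a2 l S p theta)"

definition cycle_map :: "queue \<Rightarrow> real \<Rightarrow> real" where
  "cycle_map i = (case i of Q1 \<Rightarrow> f1 l theta | Q2 \<Rightarrow> f2 l theta)"

lemma cycle_in_unit_cube: "z \<in> unit_cube \<Longrightarrow> cycle i z \<in> unit_cube"
  unfolding cycle_def by (intro after_visit_in_unit_cube)

lemma mix_after_visit_Q1:
  "z \<in> unit_cube \<Longrightarrow> mix (after_visit Q1 z) Q1 = K12 l theta (mix z Q2)"
  "mix (after_visit Q1 z) Q2 = mix z Q2"
  using mix_after_visit[of z Q1] mix_after_visit_other[of Q1 z] by (simp_all add: K12_def foreign_def)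

lemma mix_after_visit_Q2:
  "z \<in> unit_cube \<Longrightarrow> mix (after_visit Q2 z) Q2 = K21 l theta (mix z Q1)"
  "mix (after_visit Q2 z) Q1 = mix z Q1"
  using mix_after_visit[of z Q2] mix_after_visit_other[of Q2 z] by (simp_all add: K21_def foreign_def)

lemma mix_cycle: "z \<in> unit_cube \<Longrightarrow> mix (cycle i z) (other i) = cycle_map i (mix z (other i))"
  by (cases i) (simp_all add: cycle_def cycle_map_def f1_def f2_def mix_after_visit_Q1 mix_after_visit_Q2
      after_visit_in_unit_cube)

lemma lst_total: "lst (S i j) (total z) = M_pgf l S i j (mix z Q1) (mix z Q2)"
  by (simp add: M_pgf_def total_eq[of z Q1] foreign_def)

text \<open>Two applications of \<open>visit_pgf_step\<close> lead back to queue \<open>i\<close>.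
  The product of the two factors depends on \<open>z\<close> only through the average at the other
  queue, and there it is \<open>a1\<close> or \<open>a2\<close>.\<close>

lemma visit_pgf_cycle:
  assumes z: "z \<in> unit_cube"
  shows "visit_pgf i z = cycle_factor i (mix z (other i)) * visit_pgf i (cycle i z)"
proof -
  have y: "after_visit i z \<in> unit_cube" by (rule after_visit_in_unit_cube[OF z])
  have "visit_pgf i z = factor i (after_visit i z) * factor (other i) (cycle i z) * visit_pgf i (cycle i z)"
    using visit_pgf_step[OF z, of i] visit_pgf_step[OF y, of "other i"] by (simp add: cycle_def)
  also have "factor i (after_visit i z) * factor (other i) (cycle i z) = cycle_factor i (mix z (other i))"
    using z y
    by (cases i) (simp_all add: factor_def cycle_factor_def cycle_def lst_total a1_def a2_def r_def
        f1_def f2_def mix_after_visit_Q1 mix_after_visit_Q2)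
  finally show ?thesis .
qed

lemma cycle_iterate:
  assumes z: "z \<in> unit_cube"
  shows "(cycle i ^^ n) z \<in> unit_cube \<and>
    mix ((cycle i ^^ n) z) (other i) = (cycle_map i ^^ n) (mix z (other i)) \<and>
    visit_pgf i z = (\<Prod>j<n. cycle_factor i ((cycle_map i ^^ j) (mix z (other i)))) * visit_pgf i ((cycle i ^^ n) z)"
proof (induction n)
  case (Suc n)
  let ?y = "(cycle i ^^ n) z"
  have y: "?y \<in> unit_cube" and my: "mix ?y (other i) = (cycle_map i ^^ n) (mix z (other i))" using Suc by auto
  show ?case
    using Suc visit_pgf_cycle[OF y, of i] cycle_in_unit_cube[OF y, of i] mix_cycle[OF y, of i]
    by (simp add: my)
qed (use z in simp)

lemma cycle_map_tendsto: "0 \<le> x \<Longrightarrow> x \<le> 1 \<Longrightarrow> (\<lambda>n. (cycle_map i ^^ n) x) \<longlonglongrightarrow> 1"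
  by (cases i) (simp_all add: cycle_map_def f1_iterate_tendsto f2_iterate_tendsto)

lemma convergent_cycle_factor:
  "0 \<le> x \<Longrightarrow> x \<le> 1 \<Longrightarrow> convergent_prod (\<lambda>n. cycle_factor i ((cycle_map i ^^ n) x))"
  by (cases i) (simp_all add: cycle_map_def cycle_factor_def convergent_prod_a1 convergent_prod_a2)

text \<open>After \<open>n\<close> cycles a finite product has split off. The arguments of the
  remaining factor tend to 1 for each type, not only on average, so this factor tends to its value
  at 1.\<close>

lemma visit_pgf_eq:
  assumes z: "z \<in> unit_cube"
  shows "visit_pgf i z = (\<Prod>j. cycle_factor i ((cycle_map i ^^ j) (mix z (other i)))) * pgf i (\<lambda>_. 1)"
proof -
  let ?x = "mix z (other i)"
  define zs where "zs n = after_visit i ((cycle i ^^ n) z)" for n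
  have cyc: "(cycle i ^^ n) z \<in> unit_cube" "mix ((cycle i ^^ n) z) (other i) = (cycle_map i ^^ n) ?x" for n
    using cycle_iterate[OF z, of n i] by auto
  have cube: "zs n \<in> unit_cube" for n unfolding zs_def by (rule after_visit_in_unit_cube[OF cyc(1)])
  \<comment> \<open>From \<open>theta_defect\<close>: the total discount rate after a visit is at
    most \<open>c\<close> times the rate \<open>foreign\<close> due to the other queue.\<close>
  define c where "c = 1 + l i * (m i / (1 - l i * m i))"
  have tot: "total (zs n) \<le> l (other i) * (1 - (cycle_map i ^^ n) ?x) * c" for n
  proof -
    let ?s = "foreign i ((cycle i ^^ n) z)"
    have s: "0 \<le> ?s" "?s = l (other i) * (1 - (cycle_map i ^^ n) ?x)"
      by (rule foreign_nonneg[OF cyc(1)]) (simp add: foreign_def cyc(2))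
    have "total (zs n) = ?s + l i * (1 - theta i ?s)" unfolding zs_def by (rule total_after_visit[OF cyc(1)])
    also have "\<dots> \<le> ?s + l i * (?s * (m i / (1 - l i * m i)))"
      using theta_defect[OF s(1), of i] rate_pos[of i] by (intro add_left_mono mult_left_mono) auto
    also have "\<dots> = ?s * c" by (simp add: c_def algebra_simps)
    finally show ?thesis unfolding s(2) .
  qed
  have "(\<lambda>n. l (other i) * (1 - (cycle_map i ^^ n) ?x) * c) \<longlonglongrightarrow> l (other i) * (1 - 1) * c"
    by (intro tendsto_intros cycle_map_tendsto mix_bounds[OF z])
  then have bound0: "(\<lambda>n. l (other i) * (1 - (cycle_map i ^^ n) ?x) * c) \<longlonglongrightarrow> 0" by simp
  have tot0: "0 \<le> total (zs n)" for n using cube[of n] by (intro total_nonneg) (auto simp: unit_cube_def)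
  have tot_lim: "(\<lambda>n. total (zs n)) \<longlonglongrightarrow> 0"
    by (rule real_tendsto_sandwich[OF _ _ tendsto_const bound0]) (use tot tot0 in auto)
  have lim: "(\<lambda>n. zs n e) \<longlonglongrightarrow> 1" for e
  proof -
    \<comment> \<open>All summands of \<open>total\<close> are nonnegative, so \<open>total\<close>
      tending to 0 forces every single argument to 1.\<close>
    have "lam e * (1 - zs n e) \<le> total (zs n)" for n
      unfolding total_def using cube[of n] lam_pos
      by (intro member_le_sum mult_nonneg_nonneg) (auto simp: unit_cube_def intro: less_imp_le)
    then have "1 - zs n e \<le> total (zs n) / lam e" for n
      using lam_pos[of e] by (simp add: pos_le_divide_eq mult.commute)
    moreover have "0 \<le> 1 - zs n e" for n using cube[of n] by (auto simp: unit_cube_def)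
    moreover have "(\<lambda>n. total (zs n) / lam e) \<longlonglongrightarrow> 0 / lam e"
      by (intro tendsto_divide tot_lim tendsto_const) (use lam_pos[of e] in simp)
    ultimately have "(\<lambda>n. 1 - zs n e) \<longlonglongrightarrow> 0"
      by (intro real_tendsto_sandwich[OF _ _ tendsto_const, of 0 "\<lambda>n. 1 - zs n e" _ "\<lambda>n. total (zs n) / lam e"]) auto
    then have "(\<lambda>n. 1 - (1 - zs n e)) \<longlonglongrightarrow> 1 - 0" by (intro tendsto_intros)
    then show ?thesis by simp
  qed
  have "(\<lambda>n. pgf i (zs n)) \<longlonglongrightarrow> pgf i (\<lambda>_. 1)"
    unfolding pgf_def by (rule polled_pgf_tendsto) (use cube lim in \<open>auto simp: unit_cube_def\<close>)
  then have vlim: "(\<lambda>n. visit_pgf i ((cycle i ^^ n) z)) \<longlonglongrightarrow> pgf i (\<lambda>_. 1)"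
    by (simp add: visit_pgf_def zs_def)
  have plim: "(\<lambda>n. \<Prod>j<n. cycle_factor i ((cycle_map i ^^ j) ?x)) \<longlonglongrightarrow> (\<Prod>j. cycle_factor i ((cycle_map i ^^ j) ?x))"
    using convergent_prod_LIMSEQ[OF convergent_cycle_factor[OF mix_bounds[OF z]]]
    by (simp add: LIMSEQ_lessThan_iff_atMost)
  have "(\<lambda>n. visit_pgf i z) \<longlonglongrightarrow> (\<Prod>j. cycle_factor i ((cycle_map i ^^ j) ?x)) * pgf i (\<lambda>_. 1)"
    using tendsto_mult[OF plim vlim] unfolding cycle_iterate[OF z, THEN conjunct2, THEN conjunct2, symmetric] .
  then show ?thesis by (rule LIMSEQ_unique[OF tendsto_const])
qed

theorem polling_pgf_eq_V:
  assumes z: "\<And>c. 0 \<le> z c" "\<And>c. z c \<le> 1"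
  shows "polling_pgf M d I k j z = V l S p theta j (mix z Q1) (mix z Q2)"
proof -
  have cube: "z \<in> unit_cube" using z by (simp add: unit_cube_def)
  have steady_pgf: "polled_pgf k j y = pgf j y" for y
    using steady_state_polled_pgf[OF steady] by (simp add: pgf_def)
  have "polling_pgf M d I k j z = pgf j z / pgf j (\<lambda>_. 1)"
    using polling_pgf_eq[where z = z and k = k and i = j, OF z] pgf_1_pos[of j] by (simp add: steady_pgf)
  also have "\<dots> = V l S p theta j (mix z Q1) (mix z Q2)"
  proof -
    define W where "W i = (\<Prod>n. cycle_factor i ((cycle_map i ^^ n) (mix z (other i))))" for i
    \<comment> \<open>Here the forward routing probabilities turn into those of the reversed chain,
      that is, into \<open>r\<close>.\<close>
    have ratio: "(1 - p (other j)) * pgf (other j) (\<lambda>_. 1) / pgf j (\<lambda>_. 1) = 1 - p j"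
      using balance[of j] pgf_1_pos[of j] by (simp add: field_simps)
    have "pgf j z = p j * M_pgf l S j j (mix z Q1) (mix z Q2) * (W j * pgf j (\<lambda>_. 1)) +
      (1 - p (other j)) * M_pgf l S (other j) j (mix z Q1) (mix z Q2) * (W (other j) * pgf (other j) (\<lambda>_. 1))"
      using stationary_equation_other[OF cube, of j] visit_pgf_eq[OF cube]
      by (simp add: visit_pgf_def lst_total W_def)
    then have "pgf j z / pgf j (\<lambda>_. 1) = p j * M_pgf l S j j (mix z Q1) (mix z Q2) * W j +
      ((1 - p (other j)) * pgf (other j) (\<lambda>_. 1) / pgf j (\<lambda>_. 1)) *
        M_pgf l S (other j) j (mix z Q1) (mix z Q2) * W (other j)"
      using pgf_1_pos[of j] by (simp add: add_divide_distrib)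
    then show ?thesis
      unfolding ratio
      by (cases j) (simp_all add: V_def r_def W_def cycle_factor_def cycle_map_def)
  qed
  finally show ?thesis .
qed

end

section \<open>The priority and the non-priority system as instances\<close>

fun customer_queue :: "customer \<Rightarrow> queue" where
  "customer_queue Type_H = Q1" | "customer_queue Type_L = Q1" | "customer_queue Type_2 = Q2"

lemma customers_of_queue:
  "{c. customer_queue c = Q1} = {Type_H, Type_L}" "{c. customer_queue c = Q2} = {Type_2}"
  by (auto elim: customer_queue.elims)

text \<open>Multiplying by the merged rate cancels the denominators of the mixture probabilities,
  which gives the sums over types that the general setting works with.\<close>

lemma merged_service_law:
  assumes rates: "\<forall>c. 0 < lam c" and services: "\<forall>c. nonneg_law (B c)"
  shows "nonneg_law (merged_service lam B i)"
    and "merged_rate lam i * mean (merged_service lam B i) = (\<Sum>c | customer_queue c = i. lam c * mean (B c))"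
    and "0 \<le> s \<Longrightarrow> merged_rate lam i * lst (merged_service lam B i) s = (\<Sum>c | customer_queue c = i. lam c * lst (B c) s)"
proof -
  have pos: "0 < lam Type_H" "0 < lam Type_L" using rates by auto
  let ?a = "lam Type_H / (lam Type_H + lam Type_L)"
  have a: "0 \<le> ?a" "?a \<le> 1" "1 - ?a = lam Type_L / (lam Type_H + lam Type_L)"
    using pos by (auto simp: field_simps)
  have sum: "0 < lam Type_H + lam Type_L" using pos by simp
  have key: "(lam Type_H + lam Type_L) * (lam Type_H * x / (lam Type_H + lam Type_L) + lam Type_L * y / (lam Type_H + lam Type_L))
      = lam Type_H * x + lam Type_L * y" for x y
    using sum by (simp add: distrib_left)
  note laws = services[rule_format, of Type_H] services[rule_format, of Type_L]
  show "nonneg_law (merged_service lam B i)"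
    using services nonneg_law_mixture[OF laws a(1,2)] by (cases i) simp_all
  show "merged_rate lam i * mean (merged_service lam B i) = (\<Sum>c | customer_queue c = i. lam c * mean (B c))"
    by (cases i) (simp_all add: customers_of_queue mean_mixture[OF laws a(1,2)] a(3) key)
  show "merged_rate lam i * lst (merged_service lam B i) s = (\<Sum>c | customer_queue c = i. lam c * lst (B c) s)"
    if "0 \<le> s"
    by (cases i) (simp_all add: customers_of_queue lst_mixture[OF laws a(1,2) that] a(3) key)
qed

theorem theorem1:
  fixes lam :: "customer \<Rightarrow> real" and B :: "customer \<Rightarrow> real measure"
    and S :: "queue \<Rightarrow> queue \<Rightarrow> real measure" and p :: "queue \<Rightarrow> real"
    and P :: "queue \<Rightarrow> 'b measure" and N :: "queue \<Rightarrow> real \<Rightarrow> 'b \<Rightarrow> nat"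
    and X :: "queue \<Rightarrow> nat \<Rightarrow> 'b \<Rightarrow> real"
    and theta :: "queue \<Rightarrow> real \<Rightarrow> real"
    and M :: "'a measure" and I :: "('a, customer) polling_input"
    and M' :: "'d measure" and I' :: "('d, queue) polling_input"
  assumes rates: "\<forall>c. 0 < lam c"
    and services: "\<forall>c. nonneg_law (B c)"
    and switches: "\<forall>i j. nonneg_law (S i j)"
    and routing: "\<forall>i. 0 \<le> p i \<and> p i < 1"
    and stable: "lam Type_H * mean (B Type_H) + lam Type_L * mean (B Type_L)
                   + lam Type_2 * mean (B Type_2) < 1"
    and busy_queues: "\<forall>i. mg1_queue (P i) (merged_rate lam i) (N i) (merged_service lam B i) (X i)"
    and busy_lst: "\<forall>i s. theta i s = lst (distr (P i) borel (busy_period (N i) (X i))) s"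
  shows
    "(\<forall>z\<in>{0..1}.
        convergent_prod (\<lambda>j. a1 (merged_rate lam) S p theta ((f1 (merged_rate lam) theta ^^ j) z)) \<and>
        convergent_prod (\<lambda>j. a2 (merged_rate lam) S p theta ((f2 (merged_rate lam) theta ^^ j) z))) \<and>
     (polling_system M lam B S p I \<and> steady_state M priority I \<longrightarrow>
       (\<forall>i k. \<forall>zH\<in>{0..1}. \<forall>zL\<in>{0..1}. \<forall>z2\<in>{0..1}.
          polling_pgf M priority I k i (case_customer zH zL z2) =
          V (merged_rate lam) S p theta i
            ((lam Type_H * zH + lam Type_L * zL) / (lam Type_H + lam Type_L)) z2)) \<and>
     (polling_system M' (merged_rate lam) (merged_service lam B) S p I' \<and>
      steady_state M' no_priority I' \<longrightarrow>
       (\<forall>i k. \<forall>z1\<in>{0..1}. \<forall>z2\<in>{0..1}.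
          polling_pgf M' no_priority I' k i (case_queue z1 z2) =
          V (merged_rate lam) S p theta i z1 z2))"
proof -
  let ?l = "merged_rate lam" and ?B = "merged_service lam B"
  define m where "m i = mean (?B i)" for i
  note law = merged_service_law(1)[OF rates services]
  note load = merged_service_law(2)[OF rates services, folded m_def]
  note mix_lst = merged_service_law(3)[OF rates services]
  have l_pos: "0 < ?l i" for i using rates by (cases i) (auto simp: add_pos_pos)
  have m_nonneg: "0 \<le> m i" for i unfolding m_def by (rule mean_nonneg[OF law])
  have total_load: "?l Q1 * m Q1 + ?l Q2 * m Q2 < 1"
    using stable unfolding load by (simp add: customers_of_queue)
  have load_less_1: "?l i * m i < 1" for i
    using total_load mult_nonneg_nonneg[OF less_imp_le[OF l_pos[of Q1]] m_nonneg[of Q1]]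
      mult_nonneg_nonneg[OF less_imp_le[OF l_pos[of Q2]] m_nonneg[of Q2]] by (cases i) auto
  have theta: "0 < theta i s" "theta i s \<le> 1" "theta i s = lst (?B i) (s + ?l i * (1 - theta i s))"
    if s: "0 \<le> s" for i s
  proof -
    interpret mg1_queue "P i" "?l i" "N i" "?B i" "X i" using busy_queues by blast
    have int: "integrable (?B i) (\<lambda>x. x)" using law[of i] by (simp add: nonneg_law_def)
    have "?l i * mean (?B i) < 1" using load_less_1[of i] by (simp add: m_def)
    note * = busy_period_lst[OF int this s]
    show "0 < theta i s" "theta i s \<le> 1" "theta i s = lst (?B i) (s + ?l i * (1 - theta i s))"
      using * busy_lst by simp_all
  qed
  have arg_nonneg: "0 \<le> s + ?l i * (1 - theta i s)" if "0 \<le> s" for i s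
    using that theta(2)[OF that, of i] l_pos[of i] by simp
  interpret two_queues ?l S p theta m
  proof
    fix i :: queue
    show "0 < ?l i" "0 \<le> p i" "p i < 1" "0 \<le> m i" by (use l_pos routing m_nonneg in auto)
  next
    fix i and s :: real assume s: "0 \<le> s"
    show "0 < theta i s" "theta i s \<le> 1" by (rule theta[OF s])+
    \<comment> \<open>The tangent bound at the argument occurring in the functional equation; solved
      for the defect of \<open>theta i s\<close>, it is \<open>theta_ge\<close>.\<close>
    have "1 - (s + ?l i * (1 - theta i s)) * m i \<le> theta i s"
      using lst_ge_linear[OF law arg_nonneg[OF s], of i i] theta(3)[OF s, of i] by (simp add: m_def)
    then show "(1 - theta i s) * (1 - ?l i * m i) \<le> s * m i" by (simp add: algebra_simps)
  qed (use switches total_load in auto)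
  have theta_eq: "?l i * theta i s = (\<Sum>c | customer_queue c = i. lam c * lst (B c) (s + ?l i * (1 - theta i s)))"
    if "0 \<le> s" for i s
    using mix_lst[OF arg_nonneg[OF that], of i i] theta(3)[OF that, of i] by simp
  have priority_case: "polling_pgf M priority I k i (case_customer zH zL z2) =
      V ?l S p theta i ((lam Type_H * zH + lam Type_L * zL) / (lam Type_H + lam Type_L)) z2"
    if "polling_system M lam B S p I" "steady_state M priority I"
      "zH \<in> {0..1}" "zL \<in> {0..1}" "z2 \<in> {0..1}" for i k zH zL z2
  proof -
    interpret polling_system M lam B S p I by fact
    interpret stationary_polling M lam B S p I priority customer_queue ?l theta m
    proof
      show "customer_queue c = i \<and> 0 < n c" if "priority i n = Some c" for i n c
        using that by (cases i) (auto split: if_splits)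
      show "n c = 0" if "priority i n = None" "customer_queue c = i" for i n c
        using that by (cases i; cases c) (auto split: if_splits)
      show "(\<Sum>c | customer_queue c = i. lam c * mean (B c)) < 1" for i
        using load_less_1[of i] by (simp add: load)
      show "?l i = (\<Sum>c | customer_queue c = i. lam c)" for i
        by (cases i) (simp_all add: customers_of_queue)
    qed (use services switches theta_eq that in auto)
    have "polling_pgf M priority I k i (case_customer zH zL z2) =
        V ?l S p theta i (mix (case_customer zH zL z2) Q1) (mix (case_customer zH zL z2) Q2)"
      by (rule polling_pgf_eq_V) (use that in \<open>auto split: customer.split\<close>)
    \<comment> \<open>For the priority system \<open>mix\<close> at \<open>Q1\<close> is the
      weighted average of \<open>zH\<close> and \<open>zL\<close>, and at \<open>Q2\<close> it is
      \<open>z2\<close>.\<close>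
    then show ?thesis
      using l_pos[of Q2] by (simp add: mix_def customers_of_queue)
  qed
  have plain_case: "polling_pgf M' no_priority I' k i (case_queue z1 z2) = V ?l S p theta i z1 z2"
    if "polling_system M' ?l ?B S p I'" "steady_state M' no_priority I'"
      "z1 \<in> {0..1}" "z2 \<in> {0..1}" for i k z1 z2
  proof -
    interpret polling_system M' ?l ?B S p I' by fact
    interpret stationary_polling M' ?l ?B S p I' no_priority "\<lambda>i. i" ?l theta m
    proof
      show "c = i \<and> 0 < n c" if "no_priority i n = Some c" for i n c
        using that by (auto simp: no_priority_def split: if_splits)
      show "n c = 0" if "no_priority i n = None" "c = i" for i n c
        using that by (auto simp: no_priority_def split: if_splits)
      show "(\<Sum>c | c = i. ?l c * mean (?B c)) < 1" for i
        using load_less_1[of i] by (simp add: m_def)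
      show "?l i * theta i s = (\<Sum>c | c = i. ?l c * lst (?B c) (s + ?l i * (1 - theta i s)))" if "0 \<le> s" for i s
        using theta(3)[OF that, of i] by simp
    qed (use law switches that in auto)
    have "polling_pgf M' no_priority I' k i (case_queue z1 z2) =
        V ?l S p theta i (mix (case_queue z1 z2) Q1) (mix (case_queue z1 z2) Q2)"
      by (rule polling_pgf_eq_V) (use that in \<open>auto split: queue.split\<close>)
    then show ?thesis
      using l_pos[of Q1] l_pos[of Q2] by (simp add: mix_def)
  qed
  show ?thesis
    using convergent_prod_a1 convergent_prod_a2 priority_case plain_case by (intro conjI ballI allI impI) auto
qed

end
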